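(* Let $\mu,\nu$ be probability measures on $\mathcal{X}$ with $\mu\ll\nu$. Assume that the measurement channel is continuous in total variation (whenever $a_n\to a$ in $\mathcal{X}$, $\|h_{a_n}Q-h_aQ\|_{TV}\to0$) and that the model is observable. Then for every $f\in C_b(\mathcal{X})$, $\lim_{n\to\infty}E^\mu\left[\left|\int f\,d\pi_n^\mu-\int f\,d\pi_n^\nu\right|\right]=0$.
   Context: Setting: $\mathcal{X},\mathcal{Y},\mathcal{Z}$ are Polish spaces. $T$ is a transition kernel on $\mathcal{X}$; $\{Z_n\}$ is i.i.d. with law $Q$, independent of the states; $h:\mathcal{X}\times\mathcal{Z}\to\mathcal{Y}$ measurable, $h_x=h(x,\cdot)$, $h_xQ$ the pushforward of $Q$ under $h_x$. $\{X_n\}$ is a Markov chain with kernel $T$, $X_0\sim\mu$, $Y_n=h(X_n,Z_n)$; $P^\mu$, $E^\mu$ are joint law and expectation. Filter $\pi_n^{\mu}=P^{\mu}(X_n\in\cdot\mid Y_0,\dots,Y_n)$. $\|P-R\|_{TV}=\sup_{\|f\|_\infty\le1}|\int f\,dP-\int f\,dR|$. For $N\in\mathbb{N}$ let $P(dy_{[1,N]}\mid X_1=x)$ be the conditional law of $(Y_1,\dots,Y_N)$ given $X_1=x$. The model is observable if for some $N$, for every $f\in C_b(\mathcal{X})$ and $\epsilon>0$ there is a bounded measurable $g:\mathcal{Y}^N\to\mathbb{R}$ with $\sup_x|f(x)-\int g(y_{[1,N]})P(dy_{[1,N]}\mid X_1=x)|<\epsilon$. *)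

theory Defs
  imports "HOL-Probability.Probability"
begin

fun state_law :: "('x::polish_space \<Rightarrow> 'x measure) \<Rightarrow> nat \<Rightarrow> 'x measure \<Rightarrow> nat \<Rightarrow> (nat \<Rightarrow> 'x) measure" where
  "state_law T s \<mu> 0 =
     distr \<mu> (PiM {s..s} (\<lambda>_. borel)) (\<lambda>x. \<lambda>i\<in>{s..s}. x)"
| "state_law T s \<mu> (Suc k) =
     bind (state_law T s \<mu> k)
       (\<lambda>\<omega>. distr (T (\<omega> (s + k))) (PiM {s..s + Suc k} (\<lambda>_. borel))
               (\<lambda>x'. \<lambda>i\<in>{s..s + Suc k}. if i = s + Suc k then x' else \<omega> i))"

text \<open>Joint law of (X_s..X_(s+k), Y_s..Y_(s+k)) with Y_i = h(X_i, Z_i), where the Z_i are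
  i.i.d. with law Q and independent of the states.\<close>

definition joint_law ::
  "('x::polish_space \<Rightarrow> 'x measure) \<Rightarrow> 'z::polish_space measure \<Rightarrow> ('x \<Rightarrow> 'z \<Rightarrow> 'y::polish_space)
   \<Rightarrow> nat \<Rightarrow> 'x measure \<Rightarrow> nat \<Rightarrow> ((nat \<Rightarrow> 'x) \<times> (nat \<Rightarrow> 'y)) measure" where
  "joint_law T Q h s \<mu> k =
     bind (state_law T s \<mu> k)
       (\<lambda>\<omega>. distr (PiM {s..s + k} (\<lambda>_. Q))
               (PiM {s..s + k} (\<lambda>_. borel) \<Otimes>\<^sub>M PiM {s..s + k} (\<lambda>_. borel))
               (\<lambda>z. (\<omega>, \<lambda>i\<in>{s..s + k}. h (\<omega> i) (z i))))"

text \<open>P^mu restricted to times 0..n: the joint law of (X_0..X_n, Y_0..Y_n).\<close>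

definition path_law where
  "path_law T Q h \<mu> n = joint_law T Q h 0 \<mu> n"

definition obs_sigma ::
  "nat \<Rightarrow> ((nat \<Rightarrow> 'x::polish_space) \<times> (nat \<Rightarrow> 'y::polish_space)) measure" where
  "obs_sigma n = vimage_algebra
      (space (PiM {0..n} (\<lambda>_. (borel::'x measure)) \<Otimes>\<^sub>M PiM {0..n} (\<lambda>_. (borel::'y measure))))
      snd (PiM {0..n} (\<lambda>_. (borel::'y measure)))"

text \<open>The integral of f against the filter pi_n^mu = P^mu(X_n \<in> . | Y_0..Y_n), i.e.
  E^mu[f(X_n) | Y_0..Y_n], as a sigma(Y_0..Y_n)-measurable function on path space.\<close>

definition filter_int where
  "filter_int T Q h \<mu> n f =
     real_cond_exp (path_law T Q h \<mu> n) (obs_sigma n) (\<lambda>\<omega>. f (fst \<omega> n))"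

definition obs_law_given_X1 where
  "obs_law_given_X1 T Q h N x =
     distr (joint_law T Q h 1 (return borel x) (N - 1)) (PiM {1..N} (\<lambda>_. borel)) snd"

definition tv_norm :: "'a measure \<Rightarrow> 'a measure \<Rightarrow> real" where
  "tv_norm P R = (SUP g \<in> {g \<in> borel_measurable P. \<forall>y. \<bar>g y\<bar> \<le> 1}.
                    \<bar>(\<integral>y. g y \<partial>P) - (\<integral>y. g y \<partial>R)\<bar>)"

definition channel_tv_continuous ::
  "'z measure \<Rightarrow> ('x::topological_space \<Rightarrow> 'z \<Rightarrow> 'y::topological_space) \<Rightarrow> bool" where
  "channel_tv_continuous Q h \<longleftrightarrow>
     (\<forall>a (an :: nat \<Rightarrow> 'x). an \<longlonglongrightarrow> a \<longrightarrow>
        (\<lambda>n. tv_norm (distr Q borel (h (an n))) (distr Q borel (h a))) \<longlonglongrightarrow> 0)"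

definition observable where
  "observable T Q h \<longleftrightarrow>
     (\<exists>N::nat. N \<ge> 1 \<and>
       (\<forall>f :: 'x::polish_space \<Rightarrow> real. continuous_on UNIV f \<and> bounded (range f) \<longrightarrow>
         (\<forall>\<epsilon>>0. \<exists>g :: (nat \<Rightarrow> 'y::polish_space) \<Rightarrow> real.
            g \<in> borel_measurable (PiM {1..N} (\<lambda>_. borel)) \<and>
            (\<exists>B. \<forall>y\<in>space (PiM {1..N} (\<lambda>_. (borel::'y measure))). \<bar>g y\<bar> \<le> B) \<and>
            (SUP x. \<bar>f x - (\<integral>y. g y \<partial>obs_law_given_X1 T Q h N x)\<bar>) < \<epsilon>)))"

end

theory Submission
  imports Defs
begin

text \<open>Let \<open>\<rho>\<close> be the density of \<open>\<mu>\<close> with respect to \<open>\<nu>\<close>, let \<open>r\<close> be a truncation of it, and let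
  \<open>D n\<close> be the conditional expectation of \<open>r(X\<^sub>0)\<close> given \<open>Y\<^sub>0, \<dots>, Y\<^sub>n\<close> under \<open>P\<^sup>\<nu>\<close>. If \<open>s\<close> is the sign
  of the difference of the two filters at time \<open>n + 1\<close>, then Bayes' formula bounds the error by
  \<open>E\<^sup>\<nu>[(r(X\<^sub>0) - D n) s f(X\<^sub>n\<^sub>+\<^sub>1)]\<close>, up to the truncation error and \<open>E\<^sup>\<nu>|D (n + 1) - D n|\<close>.

  Integrating out \<open>Y\<^sub>n\<^sub>+\<^sub>1\<close> turns \<open>s f(X\<^sub>n\<^sub>+\<^sub>1)\<close> into a random member of a family of functions of \<open>X\<^sub>n\<^sub>+\<^sub>1\<close>
  which, by total variation continuity of the channel, is bounded and equicontinuous. With a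
  partition of unity such functions are, up to \<open>\<epsilon>\<close>, mixtures with bounded coefficient sequences.
  Observability represents each mixture approximately by a function \<open>g\<close> of \<open>N\<close> observations, and a
  Baire argument in the spirit of Schur's theorem on weak convergence in \<open>\<ell>\<^sup>1\<close> gives a bound \<open>B\<close> on
  \<open>g\<close> that is uniform over the coefficients. This uniformity is indispensable since the coefficients
  depend on the past observations. The Markov property finally replaces the mixture by a function of
  \<open>Y\<^sub>0, \<dots>, Y\<^sub>n\<^sub>+\<^sub>N\<close>, so that only \<open>B E\<^sup>\<nu>|D (n + N) - D n|\<close> remains, and the increments of the
  bounded martingale \<open>D\<close> tend to \<open>0\<close> in \<open>L\<^sup>2\<close>.\<close>

section \<open>Uniform approximation over equicontinuous families\<close>

text \<open>Observability represents one function at a time and says nothing about the size of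
  \<open>g\<close>. The function met here depends on n and on the observed past, so the bound on
  \<open>g\<close> has to be fixed before either is known. Were the representation exact, the open
  mapping theorem would supply such a bound; observability only makes the representable functions
  dense. The category argument works with coefficient sequences instead. Density in a cylinder is
  enough for it because only the first M coefficients are ever prescribed: M depends on the law of
  X_(n+1), the bound does not, and the other coefficients cost only the mass which that law gives to
  the tail of the partition.

  The step from time n to n + 1 has two reasons. The weight r(X_0) - D n does not involve Y_(n+1),
  so the fresh noise can be averaged out, which turns a merely measurable sign into an
  equicontinuous function of the state. And observability read at the state X_(n+1) concerns exactly
  Y_(n+1), ..., Y_(n+N). Bayes' formula is used in a form linear in the density, so nothing is
  divided by a posterior density.\<close>

text \<open>The Baire category theorem in a countable product of discrete spaces. The sets \<open>R B\<close> need not be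
  closed, so only their density in a cylinder is obtained.\<close>

lemma cylinder_category:
  fixes R :: "nat \<Rightarrow> (nat \<Rightarrow> 'a) set"
  assumes cov: "\<And>c. (\<And>i. c i \<in> C) \<Longrightarrow> \<exists>B. c \<in> R B" and ne: "C \<noteq> {}"
  obtains B k c where "\<And>i. c i \<in> C"
    "\<And>p M. (\<And>i. p i \<in> C) \<Longrightarrow> (\<And>i. i < k \<Longrightarrow> p i = c i) \<Longrightarrow> \<exists>q\<in>R B. \<forall>i<M. q i = p i"
proof (rule ccontr)
  note wit = that
  assume no_wit: "\<not> thesis"
  \<comment> \<open>If no cylinder works for \<open>B\<close>, each cylinder contains a smaller one
    disjoint from \<open>R B\<close>. Iterating over \<open>B\<close> = 0, 1, 2, ... gives nested
    cylinders whose common point lies in no \<open>R B\<close>.\<close>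
  have neg: "\<exists>p M. (\<forall>i. p i \<in> C) \<and> (\<forall>i<k. p i = c i) \<and> (\<forall>q\<in>R B. \<exists>i<M. q i \<noteq> p i)"
    if c: "\<forall>i. c i \<in> C" for B k c
  proof (rule ccontr)
    assume *: "\<not> ?thesis"
    have "\<exists>q\<in>R B. \<forall>i<M. q i = p i" if "\<And>i. p i \<in> C" "\<And>i. i < k \<Longrightarrow> p i = c i" for p M
    proof (rule ccontr)
      assume "\<not> ?thesis"
      with that have "(\<forall>i. p i \<in> C) \<and> (\<forall>i<k. p i = c i) \<and> (\<forall>q\<in>R B. \<exists>i<M. q i \<noteq> p i)" by simp
      with * show False by iprover
    qed
    with c have thesis by (intro wit[of c k B]) simp_all
    with no_wit show False by contradiction
  qed
  \<comment> \<open>A stage is a sequence together with the length of its frozen prefix.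
    \<open>n < snd y\<close> drives the lengths to infinity, so every coordinate is eventually
    frozen.\<close>
  define next_ok where "next_ok n x y \<longleftrightarrow> snd x \<le> snd y \<and> n < snd y \<and>
      (\<forall>i<snd x. fst y i = fst x i) \<and> (\<forall>q\<in>R n. \<exists>i<snd y. q i \<noteq> fst y i)"
    for n and x y :: "(nat \<Rightarrow> 'a) \<times> nat"
  obtain a where a: "a \<in> C" using ne by blast
  have "\<exists>F. \<forall>n. (\<forall>i. fst (F n) i \<in> C) \<and> next_ok n (F n) (F (Suc n))"
  proof (rule dependent_nat_choice)
    show "\<exists>x :: (nat \<Rightarrow> 'a) \<times> nat. \<forall>i. fst x i \<in> C"
      using a by (intro exI[of _ "(\<lambda>_. a, 0)"]) auto
    fix x :: "(nat \<Rightarrow> 'a) \<times> nat" and n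
    assume "\<forall>i. fst x i \<in> C"
    from neg[OF this, of "snd x" n] obtain p M where
      p: "\<forall>i. p i \<in> C" "\<forall>i<snd x. p i = fst x i" and M: "\<forall>q\<in>R n. \<exists>i<M. q i \<noteq> p i"
      by blast
    from M have "\<forall>q\<in>R n. \<exists>i<max M (max (snd x) (Suc n)). q i \<noteq> p i"
      by (meson less_max_iff_disj)
    with p show "\<exists>y. (\<forall>i. fst y i \<in> C) \<and> next_ok n x y"
      by (intro exI[of _ "(p, max M (max (snd x) (Suc n)))"]) (simp add: next_ok_def le_max_iff_disj less_max_iff_disj)
  qed
  then obtain F where F: "\<And>n i. fst (F n) i \<in> C" and step: "\<And>n. next_ok n (F n) (F (Suc n))"
    by blast
  have mono: "snd (F n) \<le> snd (F (n + j)) \<and> (\<forall>i<snd (F n). fst (F (n + j)) i = fst (F n) i)" for n j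
  proof (induction j)
    case (Suc j)
    with step[of "n + j"] show ?case
      by (auto simp: next_ok_def)
  qed simp
  define l where "l i = fst (F (Suc i)) i" for i
  have l: "fst (F n) i = l i" if "i < snd (F n)" for n i
  proof -
    have "i < snd (F (Suc i))" using step[of i] by (simp add: next_ok_def)
    with mono[of "Suc i" n] mono[of n "Suc i"] that show ?thesis
      unfolding l_def by (metis add.commute)
  qed
  have "l i \<in> C" for i using F by (simp add: l_def)
  then obtain B where "l \<in> R B" using cov by blast
  with step[of B] l show False unfolding next_ok_def by metis
qed

section \<open>Partitions of unity\<close>

text \<open>By the Lindelof property countably many half-radius balls cover the space. Instead of
  dividing bump functions by their sum, the increments of their running maximum are taken: they
  telescope to 1, and once a bump equals 1 on an open set all later increments vanish there, which
  is local finiteness.\<close>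

lemma countable_partition_of_unity:
  fixes U :: "'x::polish_space \<Rightarrow> 'x set"
  assumes U: "\<And>a. open (U a)" "\<And>a. a \<in> U a"
  obtains x :: "nat \<Rightarrow> 'x" and \<phi> :: "nat \<Rightarrow> 'x \<Rightarrow> real"
  where "\<And>i. continuous_on UNIV (\<phi> i)" "\<And>i y. 0 \<le> \<phi> i y" "\<And>i y. \<phi> i y \<noteq> 0 \<Longrightarrow> y \<in> U (x i)"
    "\<And>y. \<exists>k V. open V \<and> y \<in> V \<and> (\<forall>z\<in>V. \<forall>i\<ge>k. \<phi> i z = 0)"
    "\<And>y. (\<lambda>i. \<phi> i y) sums 1"
proof -
  have "\<exists>e>0. ball a e \<subseteq> U a" for a
    using U by (simp add: open_contains_ball_eq)
  then obtain e where e: "\<And>a. 0 < e a" "\<And>a. ball a (e a) \<subseteq> U a" by metis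
  obtain F where F: "F \<subseteq> range (\<lambda>a. ball a (e a / 2))" "countable F" "\<Union>F = \<Union>(range (\<lambda>a. ball a (e a / 2)))"
    by (rule Lindelof[of "range (\<lambda>a. ball a (e a / 2))"]) auto
  obtain A where A: "countable A" "F = (\<lambda>a. ball a (e a / 2)) ` A"
    using countable_subset_image[of F "\<lambda>a. ball a (e a / 2)" UNIV] F(1,2) by auto
  have cover: "\<exists>a\<in>A. y \<in> ball a (e a / 2)" for y
  proof -
    have "y \<in> \<Union>(range (\<lambda>a. ball a (e a / 2)))" using e(1)[of y] by (intro UnionI[of "ball y (e y / 2)"]) auto
    then have "y \<in> \<Union>F" by (simp only: F(3))
    then show ?thesis unfolding A(2) by blast
  qed
  then have "A \<noteq> {}" by blast
  define x where "x = from_nat_into A"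
  have x: "\<exists>j. y \<in> ball (x j) (e (x j) / 2)" for y
    using cover[of y] from_nat_into_surj[OF A(1)] unfolding x_def by metis
  \<comment> \<open>A tent that is 1 on the half-radius ball and 0 outside the full ball, which is
    contained in \<open>U (x j)\<close>.\<close>
  define \<theta> where "\<theta> j y = max 0 (min 1 (2 - 2 * dist (x j) y / e (x j)))" for j y
  have \<theta>_cont: "continuous_on UNIV (\<theta> j)" for j
    unfolding \<theta>_def using e(1)[of "x j"] by (intro continuous_intros) auto
  have \<theta>_range: "0 \<le> \<theta> j y" "\<theta> j y \<le> 1" for j y by (auto simp: \<theta>_def)
  have \<theta>_supp: "y \<in> U (x j)" if "\<theta> j y > 0" for j y
  proof -
    have "2 * dist (x j) y / e (x j) < 2" using that by (simp add: \<theta>_def)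
    then have "y \<in> ball (x j) (e (x j))" using e(1)[of "x j"] by (simp add: field_simps)
    then show ?thesis using e(2) by blast
  qed
  have \<theta>_1: "\<theta> j y = 1" if "y \<in> ball (x j) (e (x j) / 2)" for j y
  proof -
    have "2 * dist (x j) y / e (x j) \<le> 1" using that e(1)[of "x j"] by (simp add: field_simps)
    then show ?thesis by (simp add: \<theta>_def)
  qed
  define u where "u = rec_nat (\<lambda>_. 0) (\<lambda>n v y. max (v y) (\<theta> n y))"
  have u_0: "u 0 y = 0" and u_Suc: "u (Suc n) y = max (u n y) (\<theta> n y)" for n y
    by (simp_all add: u_def)
  have u_cont: "continuous_on UNIV (u n)" for n
  proof (induction n)
    case 0 then show ?case by (simp add: u_def)
  next
    case (Suc n)
    have "continuous_on UNIV (\<lambda>y. max (u n y) (\<theta> n y))"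
      by (intro continuous_on_max Suc \<theta>_cont)
    then show ?case by (simp add: u_Suc cong: continuous_on_cong)
  qed
  have u_le: "u n y \<le> 1" for n y
    by (induction n) (auto simp: u_0 u_Suc \<theta>_range)
  have u_ge: "0 \<le> u n y" for n y
    by (induction n) (auto simp: u_0 u_Suc \<theta>_range le_max_iff_disj)
  have u_mono: "m \<le> n \<Longrightarrow> u m y \<le> u n y" for m n y
    by (rule lift_Suc_mono_le[of "\<lambda>n. u n y"]) (auto simp: u_Suc)
  have u_1: "u n y = 1" if "y \<in> ball (x j) (e (x j) / 2)" "j < n" for n j y
    using u_mono[of "Suc j" n y] that u_le[of n y] \<theta>_1[OF that(1)] by (simp add: u_Suc)
  define \<phi> where "\<phi> i y = u (Suc i) y - u i y" for i y
  have loc: "\<exists>k V. open V \<and> y \<in> V \<and> (\<forall>z\<in>V. \<forall>i\<ge>k. u i z = 1)" for y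
  proof -
    obtain j where "y \<in> ball (x j) (e (x j) / 2)" using x by blast
    with u_1 show ?thesis
      by (intro exI[of _ "Suc j"] exI[of _ "ball (x j) (e (x j) / 2)"]) (auto simp del: mem_ball)
  qed
  show thesis
  proof (rule that[of \<phi> x])
    show "continuous_on UNIV (\<phi> i)" for i
      unfolding \<phi>_def by (intro continuous_intros u_cont)
    show "0 \<le> \<phi> i y" for i y by (simp add: \<phi>_def u_Suc)
    show "y \<in> U (x i)" if "\<phi> i y \<noteq> 0" for i y
    proof (rule \<theta>_supp)
      from that have "u i y < \<theta> i y" by (simp add: \<phi>_def u_Suc max_def split: if_splits)
      with u_ge[of i y] show "0 < \<theta> i y" by linarith
    qed
    show "\<exists>k V. open V \<and> y \<in> V \<and> (\<forall>z\<in>V. \<forall>i\<ge>k. \<phi> i z = 0)" for y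
      using loc[of y] unfolding \<phi>_def by (metis cancel_comm_monoid_add_class.diff_cancel le_SucI)
    show "(\<lambda>i. \<phi> i y) sums 1" for y
    proof -
      obtain k where k: "\<And>i. i \<ge> k \<Longrightarrow> u i y = 1" using loc[of y] by blast
      have "(\<lambda>n. u n y) \<longlonglongrightarrow> 1"
        by (rule tendsto_eventually) (auto intro!: eventually_sequentiallyI[of k] k)
      from telescope_sums[OF this] show ?thesis by (simp add: \<phi>_def u_0)
    qed
  qed
qed

section \<open>Approximation by functionals of observations\<close>

text \<open>Approximate representability with the size of \<open>g\<close> kept visible:
  observability provides some \<open>B\<close> for each \<open>f\<close> and \<epsilon>, and the aim
  is a \<open>B\<close> common to many functions.\<close>

definition reach :: "('x \<Rightarrow> 'b measure) \<Rightarrow> 'b measure \<Rightarrow> real \<Rightarrow> real \<Rightarrow> ('x \<Rightarrow> real) \<Rightarrow> bool" where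
  "reach \<kappa> R B \<epsilon> f \<longleftrightarrow> (\<exists>g\<in>borel_measurable R. (\<forall>y\<in>space R. \<bar>g y\<bar> \<le> B) \<and>
     (\<forall>x. \<bar>f x - (\<integral>y. g y \<partial>\<kappa> x)\<bar> \<le> \<epsilon>))"

lemma kernel_integrable_bounded:
  fixes g :: "'b \<Rightarrow> real"
  assumes \<kappa>: "\<kappa> \<in> M \<rightarrow>\<^sub>M prob_algebra R" "x \<in> space M"
    and g: "g \<in> borel_measurable R" "\<And>y. y \<in> space R \<Longrightarrow> \<bar>g y\<bar> \<le> B"
  shows "integrable (\<kappa> x) g"
proof -
  have p: "prob_space (\<kappa> x)" and s: "sets (\<kappa> x) = sets R"
    using measurable_space[OF \<kappa>] by (auto simp: space_prob_algebra)
  interpret prob_space "\<kappa> x" by (rule p)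
  show ?thesis
    using g s sets_eq_imp_space_eq[OF s]
    by (intro integrable_const_bound[of _ B]) (auto cong: measurable_cong_sets)
qed

lemma reach_linear:
  assumes \<kappa>: "\<kappa> \<in> borel \<rightarrow>\<^sub>M prob_algebra R"
    and 1: "reach \<kappa> R B1 \<epsilon>1 f1" and 2: "reach \<kappa> R B2 \<epsilon>2 f2"
  shows "reach \<kappa> R (\<bar>a\<bar> * B1 + \<bar>b\<bar> * B2) (\<bar>a\<bar> * \<epsilon>1 + \<bar>b\<bar> * \<epsilon>2) (\<lambda>x. a * f1 x + b * f2 x)"
proof -
  obtain g1 g2 where g: "g1 \<in> borel_measurable R" "g2 \<in> borel_measurable R"
    and B: "\<And>y. y \<in> space R \<Longrightarrow> \<bar>g1 y\<bar> \<le> B1" "\<And>y. y \<in> space R \<Longrightarrow> \<bar>g2 y\<bar> \<le> B2"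
    and e: "\<And>x. \<bar>f1 x - (\<integral>y. g1 y \<partial>\<kappa> x)\<bar> \<le> \<epsilon>1" "\<And>x. \<bar>f2 x - (\<integral>y. g2 y \<partial>\<kappa> x)\<bar> \<le> \<epsilon>2"
    using 1 2 unfolding reach_def by blast
  note int = kernel_integrable_bounded[OF \<kappa> _ g(1) B(1), simplified]
    kernel_integrable_bounded[OF \<kappa> _ g(2) B(2), simplified]
  have tri: "\<bar>a * s + b * t\<bar> \<le> \<bar>a\<bar> * S + \<bar>b\<bar> * T" if "\<bar>s\<bar> \<le> S" "\<bar>t\<bar> \<le> T" for s t S T :: real
  proof -
    have "\<bar>a * s + b * t\<bar> \<le> \<bar>a\<bar> * \<bar>s\<bar> + \<bar>b\<bar> * \<bar>t\<bar>"
      by (metis abs_mult abs_triangle_ineq)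
    also have "\<dots> \<le> \<bar>a\<bar> * S + \<bar>b\<bar> * T" by (intro add_mono mult_left_mono that) auto
    finally show ?thesis .
  qed
  show ?thesis unfolding reach_def
  proof (intro bexI[of _ "\<lambda>y. a * g1 y + b * g2 y"] conjI ballI allI)
    show "\<bar>a * g1 y + b * g2 y\<bar> \<le> \<bar>a\<bar> * B1 + \<bar>b\<bar> * B2" if "y \<in> space R" for y
      by (intro tri B that)
    show "\<bar>a * f1 x + b * f2 x - (\<integral>y. a * g1 y + b * g2 y \<partial>\<kappa> x)\<bar> \<le> \<bar>a\<bar> * \<epsilon>1 + \<bar>b\<bar> * \<epsilon>2" for x
      using tri[OF e, of x x] int by (simp add: algebra_simps)
  qed (use g in measurable)
qed

lemma reach_sum:
  fixes k :: nat
  assumes \<kappa>: "\<kappa> \<in> borel \<rightarrow>\<^sub>M prob_algebra R"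
    and r: "\<And>i. i < k \<Longrightarrow> reach \<kappa> R (B i) (\<epsilon> i) (f i)"
  shows "reach \<kappa> R (\<Sum>i<k. \<bar>a i\<bar> * B i) (\<Sum>i<k. \<bar>a i\<bar> * \<epsilon> i) (\<lambda>x. \<Sum>i<k. a i * f i x)"
  using r
proof (induction k)
  case 0
  then show ?case by (auto simp: reach_def intro!: bexI[of _ "\<lambda>_. 0"])
next
  case (Suc k)
  have "reach \<kappa> R (\<Sum>i<k. \<bar>a i\<bar> * B i) (\<Sum>i<k. \<bar>a i\<bar> * \<epsilon> i) (\<lambda>x. \<Sum>i<k. a i * f i x)"
    by (rule Suc.IH) (simp add: Suc.prems)
  from reach_linear[OF \<kappa> this Suc.prems[of k], of 1 "a k"] show ?case by simp
qed

lemma reach_mono: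
  "reach \<kappa> R B \<epsilon> f \<Longrightarrow> B \<le> B' \<Longrightarrow> \<epsilon> \<le> \<epsilon>' \<Longrightarrow> reach \<kappa> R B' \<epsilon>' f"
  unfolding reach_def by (meson order_trans)

section \<open>Mixtures of a partition of unity\<close>

locale partition_of_unity =
  fixes \<phi> :: "nat \<Rightarrow> 'x::polish_space \<Rightarrow> real"
  assumes cont: "\<And>i. continuous_on UNIV (\<phi> i)"
    and nonneg: "\<And>i x. 0 \<le> \<phi> i x"
    and locally_finite: "\<And>x. \<exists>k V. open V \<and> x \<in> V \<and> (\<forall>z\<in>V. \<forall>i\<ge>k. \<phi> i z = 0)"
    and sums_1: "\<And>x. (\<lambda>i. \<phi> i x) sums 1"
begin

text \<open>Near each point only finitely many terms are nonzero, so arbitrary coefficients give a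
  continuous function, and bounded coefficients one with the same bound. Bounded sequences thus code
  bounded continuous functions, which brings the category argument to bear on them.\<close>

definition mix :: "(nat \<Rightarrow> real) \<Rightarrow> 'x \<Rightarrow> real" where
  "mix c x = (\<Sum>i. c i * \<phi> i x)"

lemma mix_eq_sum: "(\<And>i. i \<ge> k \<Longrightarrow> \<phi> i x = 0) \<Longrightarrow> mix c x = (\<Sum>i<k. c i * \<phi> i x)"
  unfolding mix_def by (rule suminf_finite) (auto simp: not_less)

lemma sum_eq_1: "(\<And>i. i \<ge> k \<Longrightarrow> \<phi> i x = 0) \<Longrightarrow> (\<Sum>i<k. \<phi> i x) = 1"
  using mix_eq_sum[of k x "\<lambda>_. 1"] sums_unique[OF sums_1[of x]] by (simp add: mix_def)

lemma sum_le_1: "(\<Sum>i<k. \<phi> i x) \<le> 1"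
  using sum_le_suminf[of "\<lambda>i. \<phi> i x" "{..<k}"] sums_1[of x] nonneg
  by (auto simp: sums_iff)

lemma support_bound: obtains k where "k \<ge> m" "\<And>i. i \<ge> k \<Longrightarrow> \<phi> i x = 0"
proof -
  obtain k where "\<And>i. i \<ge> k \<Longrightarrow> \<phi> i x = 0" using locally_finite[of x] by blast
  then show thesis using that[of "max m k"] by auto
qed

lemma mix_linear: "mix (\<lambda>i. a * c i + b * d i) x = a * mix c x + b * mix d x"
proof -
  obtain k where k: "\<And>i. i \<ge> k \<Longrightarrow> \<phi> i x = 0" using support_bound[of 0 x] by blast
  show ?thesis
    by (simp add: mix_eq_sum[OF k] algebra_simps sum.distrib sum_distrib_left)
qed

lemma mix_truncated: "mix (\<lambda>i. if i < k then p i else 0) x = (\<Sum>i<k. p i * \<phi> i x)"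
  unfolding mix_def by (subst suminf_finite[of "{..<k}"]) auto

lemma mix_bounded:
  assumes "\<And>i. \<bar>c i\<bar> \<le> C"
  shows "\<bar>mix c x\<bar> \<le> C"
proof -
  obtain k where k: "\<And>i. i \<ge> k \<Longrightarrow> \<phi> i x = 0" using support_bound[of 0 x] by blast
  have "\<bar>mix c x\<bar> \<le> (\<Sum>i<k. \<bar>c i * \<phi> i x\<bar>)" by (simp add: mix_eq_sum[OF k] sum_abs)
  also have "\<dots> \<le> (\<Sum>i<k. C * \<phi> i x)"
    by (intro sum_mono) (simp add: abs_mult nonneg mult_right_mono assms)
  also have "\<dots> = C" by (simp add: sum_distrib_left[symmetric] sum_eq_1[OF k])
  finally show ?thesis .
qed

lemma continuous_mix: "continuous_on UNIV (mix c)"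
proof -
  have "isCont (mix c) x" for x
  proof -
    obtain k V where V: "open V" "x \<in> V" "\<And>z i. z \<in> V \<Longrightarrow> i \<ge> k \<Longrightarrow> \<phi> i z = 0"
      using locally_finite[of x] by blast
    have "\<forall>\<^sub>F z in nhds x. mix c z = (\<Sum>i<k. c i * \<phi> i z)"
      unfolding eventually_nhds using V by (intro exI[of _ V] conjI ballI mix_eq_sum) auto
    moreover have "isCont (\<lambda>z. \<Sum>i<k. c i * \<phi> i z) x"
      using cont by (intro continuous_intros) (simp add: continuous_on_eq_continuous_at)
    ultimately show ?thesis by (simp add: isCont_cong)
  qed
  then show ?thesis by (simp add: continuous_on_eq_continuous_at)
qed

text \<open>The coordinates of \<open>p\<close> beyond the cylinder are attained by half the difference of two elements
  that agree on it; the finitely many others are treated one by one.\<close>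

lemma reach_uniform:
  assumes \<kappa>: "\<kappa> \<in> borel \<rightarrow>\<^sub>M prob_algebra R"
    and dense: "\<And>f \<epsilon>. continuous_on UNIV f \<Longrightarrow> bounded (range f) \<Longrightarrow> 0 < \<epsilon> \<Longrightarrow> \<exists>B. reach \<kappa> R B \<epsilon> f"
    and C: "0 \<le> C" and \<epsilon>: "0 < \<epsilon>"
  obtains B where "\<And>p M. (\<And>i. \<bar>p i\<bar> \<le> C) \<Longrightarrow>
    \<exists>q. (\<forall>i. \<bar>q i\<bar> \<le> C) \<and> (\<forall>i<M. q i = p i) \<and> reach \<kappa> R B \<epsilon> (mix q)"
proof -
  \<comment> \<open>The other half of \<epsilon> is reserved for the first \<open>k\<close>
    coordinates, which are repaired separately.\<close>
  define S where "S B = {c. (\<forall>i. \<bar>c i\<bar> \<le> C) \<and> reach \<kappa> R B (\<epsilon> / 2) (mix c)}" for B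
  have cover: "\<exists>B::nat. c \<in> S (real B)" if c: "\<And>i. c i \<in> {-C..C}" for c
  proof -
    have c': "\<bar>c i\<bar> \<le> C" for i using c[of i] by auto
    have "bounded (range (mix c))"
      using mix_bounded[of c C, OF c'] by (auto simp: bounded_iff)
    then obtain B where "reach \<kappa> R B (\<epsilon> / 2) (mix c)"
      using dense[OF continuous_mix] \<epsilon> by (metis half_gt_zero)
    moreover obtain n :: nat where "B \<le> real n" using real_arch_simple by blast
    ultimately have "reach \<kappa> R (real n) (\<epsilon> / 2) (mix c)" using reach_mono by blast
    then show ?thesis using c' by (auto simp: S_def)
  qed
  obtain B0 :: nat and k c where c: "\<And>i. c i \<in> {-C..C}"
    and cyl: "\<And>p M. (\<And>i. p i \<in> {-C..C}) \<Longrightarrow> (\<And>i. i < k \<Longrightarrow> p i = c i) \<Longrightarrow> \<exists>q\<in>S (real B0). \<forall>i<M. q i = p i"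
    by (rule cylinder_category[of "{-C..C}" "\<lambda>B::nat. S (real B)"]) (use cover C in auto)
  \<comment> \<open>Since \<open>\<bar>p i\<bar> \<le> C\<close>, the \<open>k\<close> repaired
    coordinates contribute at most \<open>k * C * \<delta> \<le> \<epsilon> / 2\<close>;
    \<open>C + 1\<close> and \<open>Suc k\<close> keep the denominator positive.\<close>
  define \<delta> where "\<delta> = \<epsilon> / (2 * (C + 1) * real (Suc k))"
  have \<delta>: "0 < \<delta>" using C \<epsilon> by (simp add: \<delta>_def)
  have "\<exists>B. reach \<kappa> R B \<delta> (\<phi> i)" for i
  proof (rule dense[OF cont _ \<delta>])
    have "\<phi> i x \<le> 1" for x
      using sum_le_1[where k="Suc i" and x=x] sum_nonneg[of "{..<i}" "\<lambda>j. \<phi> j x"] nonneg by simp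
    then show "bounded (range (\<phi> i))" using nonneg by (auto simp: bounded_iff intro!: exI[of _ 1])
  qed
  then obtain b where b: "\<And>i. reach \<kappa> R (b i) \<delta> (\<phi> i)" by metis
  define B where "B = real B0 + (\<Sum>i<k. C * \<bar>b i\<bar>)"
  show thesis
  proof (rule that)
    fix p :: "nat \<Rightarrow> real" and M assume p: "\<And>i. \<bar>p i\<bar> \<le> C"
    have p': "p i \<in> {-C..C}" "- p i \<in> {-C..C}" for i using p[of i] by auto
    obtain q1 where q1: "q1 \<in> S (real B0)" "\<And>i. i < max M k \<Longrightarrow> q1 i = (if i < k then c i else p i)"
    proof -
      have "\<exists>q\<in>S (real B0). \<forall>i<max M k. q i = (if i < k then c i else p i)"
        by (rule cyl) (use c p' in simp_all)
      then show thesis using that by blast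
    qed
    obtain q2 where q2: "q2 \<in> S (real B0)" "\<And>i. i < max M k \<Longrightarrow> q2 i = (if i < k then c i else - p i)"
    proof -
      have "\<exists>q\<in>S (real B0). \<forall>i<max M k. q i = (if i < k then c i else - p i)"
        by (rule cyl) (use c p' in simp_all)
      then show thesis using that by blast
    qed
    \<comment> \<open>Below \<open>k\<close> both \<open>q1\<close> and \<open>q2\<close> equal
      \<open>c\<close>, so their half difference contributes nothing there and the terms
      \<open>p i * \<phi> i x\<close> are added by hand. From \<open>k\<close> up to
      \<open>M\<close> half of \<open>p i - (- p i)\<close> is \<open>p i\<close>. Further out
      \<open>q\<close> is not prescribed, but still bounded by \<open>C\<close>.\<close>
    define q where "q i = (if i < k then p i else (q1 i - q2 i) / 2)" for i
    have "\<bar>q i\<bar> \<le> C" for i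
    proof (cases "i < k")
      case False
      have "\<bar>q1 i\<bar> \<le> C" "\<bar>q2 i\<bar> \<le> C" using q1(1) q2(1) by (auto simp: S_def)
      then show ?thesis using False by (simp add: q_def)
    qed (simp add: q_def p)
    moreover have "q i = p i" if "i < M" for i
      using q1(2)[of i] q2(2)[of i] that by (simp add: q_def)
    moreover have "reach \<kappa> R B \<epsilon> (mix q)"
    proof -
      have r12: "reach \<kappa> R (real B0) (\<epsilon> / 2) (\<lambda>x. 1/2 * mix q1 x + (-1/2) * mix q2 x)"
        using reach_linear[OF \<kappa>, of B0 "\<epsilon>/2" "mix q1" B0 "\<epsilon>/2" "mix q2" "1/2" "-1/2"] q1(1) q2(1)
        by (simp add: S_def)
      have rs: "reach \<kappa> R (\<Sum>i<k. \<bar>p i\<bar> * b i) (\<Sum>i<k. \<bar>p i\<bar> * \<delta>) (\<lambda>x. \<Sum>i<k. p i * \<phi> i x)"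
        by (rule reach_sum[OF \<kappa>]) (rule b)
      have "mix q x = 1 * (1/2 * mix q1 x + (-1/2) * mix q2 x) + 1 * (\<Sum>i<k. p i * \<phi> i x)" for x
      proof -
        have "q i = 1 * (1/2 * q1 i + (-1/2) * q2 i) + 1 * (if i < k then p i else 0)" for i
          using q1(2)[of i] q2(2)[of i] by (simp add: q_def)
        then have "mix q x = mix (\<lambda>i. 1 * (1/2 * q1 i + (-1/2) * q2 i) + 1 * (if i < k then p i else 0)) x"
          by presburger
        then show ?thesis by (simp only: mix_linear mix_truncated)
      qed
      then have "mix q = (\<lambda>x. 1 * (1/2 * mix q1 x + (-1/2) * mix q2 x) + 1 * (\<Sum>i<k. p i * \<phi> i x))"
        by blast
      moreover have "(\<Sum>i<k. \<bar>p i\<bar> * \<delta>) \<le> \<epsilon> / 2"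
      proof -
        have "(\<Sum>i<k. \<bar>p i\<bar> * \<delta>) \<le> (\<Sum>i<k. C * \<delta>)"
          using p \<delta> by (intro sum_mono mult_right_mono) auto
        also have "\<dots> = real k * C * \<delta>" by simp
        also have "\<dots> \<le> real (Suc k) * (C + 1) * \<delta>" using C \<delta> by (intro mult_right_mono mult_mono) auto
        also have "\<dots> = \<epsilon> / 2"
        proof -
          define D where "D = real (Suc k) * (C + 1)"
          have "D > 0" using C by (simp add: D_def)
          moreover have "\<delta> = \<epsilon> / (2 * D)" by (simp only: \<delta>_def D_def mult.assoc mult.commute[of "real (Suc k)"])
          ultimately show ?thesis unfolding D_def[symmetric] by simp
        qed
        finally show ?thesis .
      qed
      moreover have "(\<Sum>i<k. \<bar>p i\<bar> * b i) \<le> (\<Sum>i<k. C * \<bar>b i\<bar>)"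
        using p by (intro sum_mono order_trans[OF mult_left_mono[OF abs_ge_self] mult_right_mono]) auto
      ultimately show ?thesis
        by (simp only:) (rule reach_mono[OF reach_linear[OF \<kappa> r12 rs]], simp_all add: B_def)
    qed
    ultimately show "\<exists>q. (\<forall>i. \<bar>q i\<bar> \<le> C) \<and> (\<forall>i<M. q i = p i) \<and> reach \<kappa> R B \<epsilon> (mix q)"
      by blast
  qed
qed

text \<open>This decides how many coefficients have to be right for a given law of the state. The
  bound of \<open>reach_uniform\<close> serves every such number, hence every law.\<close>

lemma partial_sums_converge:
  assumes "prob_space \<eta>" and \<eta>: "sets \<eta> = sets borel"
  shows "(\<lambda>M. \<integral>x. 1 - (\<Sum>i<M. \<phi> i x) \<partial>\<eta>) \<longlonglongrightarrow> 0"
proof -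
  interpret prob_space \<eta> by fact
  have [measurable]: "\<phi> i \<in> borel_measurable \<eta>" for i
    using borel_measurable_continuous_onI[OF cont] \<eta> by (simp cong: measurable_cong_sets)
  have "(\<lambda>M. \<integral>x. 1 - (\<Sum>i<M. \<phi> i x) \<partial>\<eta>) \<longlonglongrightarrow> (\<integral>x. 0 \<partial>\<eta>)"
  proof (rule integral_dominated_convergence[where w="\<lambda>_. 1"])
    show "AE x in \<eta>. (\<lambda>M. 1 - (\<Sum>i<M. \<phi> i x)) \<longlonglongrightarrow> 0"
      using sums_1 by (intro AE_I2) (auto simp: sums_def intro!: tendsto_eq_intros)
    show "AE x in \<eta>. norm (1 - (\<Sum>i<M. \<phi> i x)) \<le> 1" for M
      using sum_le_1 by (intro AE_I2) (auto simp: abs_le_iff sum_nonneg nonneg)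
  qed auto
  then show ?thesis by simp
qed

end

section \<open>Equicontinuous families\<close>

definition equicontinuous_family :: "('x::topological_space \<Rightarrow> real) set \<Rightarrow> bool" where
  "equicontinuous_family \<F> \<longleftrightarrow>
     (\<forall>a. \<forall>\<epsilon>>0. \<exists>U. open U \<and> a \<in> U \<and> (\<forall>x\<in>U. \<forall>\<psi>\<in>\<F>. \<bar>\<psi> x - \<psi> a\<bar> \<le> \<epsilon>))"

text \<open>The order of the quantifiers is the content: \<open>B\<close> precedes the space
  \<open>A\<close>, the random function \<open>F\<close> and the law \<open>\<eta>\<close>. In the
  error, one \<epsilon> is the oscillation of \<open>F y\<close> on \<open>U (a i)\<close>, one
  comes from rounding its values at the nodes \<open>a i\<close>, and one from representing the
  mixture by \<open>G\<close>. Past the first \<open>M\<close> nodes the coefficients are known only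
  to be at most \<open>C\<close> in absolute value; this costs \<open>2 * C\<close> times the tail
  \<open>t\<close> of the partition, which is small in mean under \<eta>, not pointwise.\<close>

proposition equicontinuous_approximation:
  fixes \<kappa> :: "'x::polish_space \<Rightarrow> 'b measure"
  assumes \<kappa>: "\<kappa> \<in> borel \<rightarrow>\<^sub>M prob_algebra R"
    and dense: "\<And>f \<epsilon>. continuous_on UNIV f \<Longrightarrow> bounded (range f) \<Longrightarrow> 0 < \<epsilon> \<Longrightarrow> \<exists>B. reach \<kappa> R B \<epsilon> f"
    and bdd: "\<And>\<psi> x. \<psi> \<in> \<F> \<Longrightarrow> \<bar>\<psi> x\<bar> \<le> C" and C: "0 \<le> C"
    and equi: "equicontinuous_family \<F>" and \<epsilon>: "0 < \<epsilon>"
  obtains B where "\<And>(A :: 'a measure) F (\<eta> :: 'x measure). (\<And>y. y \<in> space A \<Longrightarrow> F y \<in> \<F>) \<Longrightarrow>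
      (\<And>x. (\<lambda>y. F y x) \<in> borel_measurable A) \<Longrightarrow> prob_space \<eta> \<Longrightarrow> sets \<eta> = sets borel \<Longrightarrow>
      \<exists>G t. (\<lambda>(y, z). G y z) \<in> borel_measurable (A \<Otimes>\<^sub>M R) \<and> (\<forall>y. \<forall>z\<in>space R. \<bar>G y z\<bar> \<le> B) \<and>
        t \<in> borel_measurable borel \<and> (\<forall>x. 0 \<le> t x \<and> t x \<le> 1) \<and> (\<integral>x. t x \<partial>\<eta>) \<le> \<epsilon> \<and>
        (\<forall>y\<in>space A. \<forall>x. \<bar>F y x - (\<integral>z. G y z \<partial>\<kappa> x)\<bar> \<le> 3 * \<epsilon> + 2 * C * t x)"
proof -
  obtain U where U: "\<And>a. open (U a)" "\<And>a. a \<in> U a"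
    and U_eq: "\<And>a x \<psi>. x \<in> U a \<Longrightarrow> \<psi> \<in> \<F> \<Longrightarrow> \<bar>\<psi> x - \<psi> a\<bar> \<le> \<epsilon>"
  proof -
    have "\<forall>a. \<exists>U. open U \<and> a \<in> U \<and> (\<forall>x\<in>U. \<forall>\<psi>\<in>\<F>. \<bar>\<psi> x - \<psi> a\<bar> \<le> \<epsilon>)"
      using equi \<epsilon> unfolding equicontinuous_family_def by blast
    from choice[OF this] show thesis using that by blast
  qed
  obtain a :: "nat \<Rightarrow> 'x" and \<phi> :: "nat \<Rightarrow> 'x \<Rightarrow> real"
    where \<phi>: "\<And>i. continuous_on UNIV (\<phi> i)" "\<And>i y. 0 \<le> \<phi> i y"
    "\<And>y. \<exists>k V. open V \<and> y \<in> V \<and> (\<forall>z\<in>V. \<forall>i\<ge>k. \<phi> i z = 0)" "\<And>y. (\<lambda>i. \<phi> i y) sums 1"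
    and supp: "\<And>i y. \<phi> i y \<noteq> 0 \<Longrightarrow> y \<in> U (a i)"
    by (rule countable_partition_of_unity[OF U]) blast
  interpret partition_of_unity \<phi> using \<phi> by unfold_locales
  obtain B where B: "\<And>p M. (\<And>i. \<bar>p i\<bar> \<le> C) \<Longrightarrow>
    \<exists>q. (\<forall>i. \<bar>q i\<bar> \<le> C) \<and> (\<forall>i<M. q i = p i) \<and> reach \<kappa> R B \<epsilon> (mix q)"
    using reach_uniform[OF \<kappa> dense C \<epsilon>] by blast
  show thesis
  proof (rule that)
    fix A :: "'a measure" and F :: "'a \<Rightarrow> 'x \<Rightarrow> real" and \<eta> :: "'x measure"
    assume F: "\<And>y. y \<in> space A \<Longrightarrow> F y \<in> \<F>" and F_meas: "\<And>x. (\<lambda>y. F y x) \<in> borel_measurable A"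
      and \<eta>: "prob_space \<eta>" "sets \<eta> = sets borel"
    obtain M where M: "(\<integral>x. 1 - (\<Sum>i<M. \<phi> i x) \<partial>\<eta>) \<le> \<epsilon>"
      using LIMSEQ_D[OF partial_sums_converge[OF \<eta>] \<epsilon>] by (auto simp: abs_less_iff intro: less_imp_le)
    define t where "t x = 1 - (\<Sum>i<M. \<phi> i x)" for x
    \<comment> \<open>An integer list codes values on a grid of mesh \<epsilon>. Clipping to [-C, C]
      makes them admissible and does not move them away from \<open>F y (a i)\<close>, which lies in
      that interval. The value 0 from \<open>M\<close> on is a filler, since \<open>q l\<close> has
      to match \<open>p l\<close> only below \<open>M\<close>.\<close>
    define p where "p l i = (if i < M then min C (max (- C) (\<epsilon> * real_of_int (l ! i))) else 0)" for l i
    have "\<bar>p l i\<bar> \<le> C" for l i using C by (auto simp: p_def)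
    then have "\<forall>l. \<exists>q. (\<forall>i. \<bar>q i\<bar> \<le> C) \<and> (\<forall>i<M. q i = p l i) \<and> reach \<kappa> R B \<epsilon> (mix q)"
      by (intro allI B)
    from choice[OF this] obtain q where q: "\<And>l i. \<bar>q l i\<bar> \<le> C" "\<And>l i. i < M \<Longrightarrow> q l i = p l i"
      "\<And>l. reach \<kappa> R B \<epsilon> (mix (q l))" by blast
    have "\<forall>l. \<exists>g. g \<in> borel_measurable R \<and> (\<forall>z\<in>space R. \<bar>g z\<bar> \<le> B) \<and>
        (\<forall>x. \<bar>mix (q l) x - (\<integral>z. g z \<partial>\<kappa> x)\<bar> \<le> \<epsilon>)"
      using q(3) unfolding reach_def by blast
    from choice[OF this] obtain g where g: "\<And>l. g l \<in> borel_measurable R" "\<And>l z. z \<in> space R \<Longrightarrow> \<bar>g l z\<bar> \<le> B"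
      "\<And>l x. \<bar>mix (q l) x - (\<integral>z. g l z \<partial>\<kappa> x)\<bar> \<le> \<epsilon>"
      by blast
    \<comment> \<open>There are only countably many lists, so one \<open>g\<close> may be chosen for
      each list and \<open>G\<close> is still jointly measurable. An arbitrary choice of one
      \<open>g\<close> for each \<open>y\<close> would not ensure this.\<close>
    define L where "L y = map (\<lambda>i. \<lfloor>F y (a i) / \<epsilon>\<rfloor>) [0..<M]" for y
    have L[measurable]: "L \<in> A \<rightarrow>\<^sub>M count_space UNIV"
    proof (subst measurable_count_space_eq2_countable, intro conjI ballI)
      fix l :: "int list"
      have iff: "L y = l \<longleftrightarrow> length l = M \<and> (\<forall>i<M. \<lfloor>F y (a i) / \<epsilon>\<rfloor> = l ! i)" for y
        unfolding L_def list_eq_iff_nth_eq by (simp only: length_map length_upt nth_map nth_upt) force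
      have "L -` {l} \<inter> space A = {y\<in>space A. \<forall>i\<in>{..<M}. length l = M \<and> \<lfloor>F y (a i) / \<epsilon>\<rfloor> = l ! i} \<inter>
          (if length l = M then space A else {})"
        unfolding vimage_def using iff by (cases "length l = M") (simp_all add: Int_def conj_commute Ball_def)
      also have "\<dots> \<in> sets A"
      proof (intro sets.Int sets.sets_Collect_finite_All sets.sets_Collect_conj)
        fix i
        have [measurable]: "(\<lambda>y. F y (a i)) \<in> borel_measurable A" by (rule F_meas)
        show "{y\<in>space A. \<lfloor>F y (a i) / \<epsilon>\<rfloor> = l ! i} \<in> sets A" by measurable
      qed auto
      finally show "L -` {l} \<inter> space A \<in> sets A" .
    qed auto
    define G where "G y = g (L y)" for y
    have "(\<lambda>(y, z). G y z) \<in> borel_measurable (A \<Otimes>\<^sub>M R)"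
      unfolding G_def split_beta'
      by (rule measurable_compose_countable[where g="\<lambda>w. L (fst w)"]) (use g(1) in measurable)
    moreover have "t \<in> borel_measurable borel"
      unfolding t_def using borel_measurable_continuous_onI[OF cont] by measurable
    moreover have "0 \<le> t x \<and> t x \<le> 1" for x
      using sum_le_1[where k=M and x=x] by (auto simp: t_def sum_nonneg nonneg)
    moreover have "\<bar>F y x - (\<integral>z. G y z \<partial>\<kappa> x)\<bar> \<le> 3 * \<epsilon> + 2 * C * t x" if y: "y \<in> space A" for y x
    proof -
      obtain k where k: "k \<ge> M" "\<And>i. i \<ge> k \<Longrightarrow> \<phi> i x = 0" using support_bound by blast
      have split: "(\<Sum>i<k. u i) = (\<Sum>i<M. u i) + (\<Sum>i\<in>{M..<k}. u i)" for u :: "nat \<Rightarrow> real"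
        using sum.atLeastLessThan_concat[of 0 M k u] k(1) by (simp add: lessThan_atLeast0)
      have t_eq: "t x = (\<Sum>i\<in>{M..<k}. \<phi> i x)"
        using split[of "\<lambda>i. \<phi> i x"] sum_eq_1[of k x, OF k(2)] by (simp add: t_def)
      have F_le: "\<bar>F y z\<bar> \<le> C" for z using bdd F y by blast
      have le2: "\<bar>F y x - q (L y) i\<bar> * \<phi> i x \<le> 2 * \<epsilon> * \<phi> i x" if i: "i < M" for i
      proof (cases "\<phi> i x = 0")
        case False
        have "\<bar>F y x - F y (a i)\<bar> \<le> \<epsilon>" using U_eq[OF supp[OF False] F[OF y]] .
        moreover have "\<bar>F y (a i) - q (L y) i\<bar> \<le> \<epsilon>"
        proof -
          define r where "r = \<epsilon> * real_of_int \<lfloor>F y (a i) / \<epsilon>\<rfloor>"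
          have "r = \<epsilon> * (F y (a i) / \<epsilon>) - \<epsilon> * frac (F y (a i) / \<epsilon>)"
            by (simp add: r_def frac_def algebra_simps)
          then have "r = F y (a i) - \<epsilon> * frac (F y (a i) / \<epsilon>)" using \<epsilon> by simp
          moreover have "0 \<le> \<epsilon> * frac (F y (a i) / \<epsilon>)" "\<epsilon> * frac (F y (a i) / \<epsilon>) \<le> \<epsilon> * 1"
            using \<epsilon> frac_lt_1[of "F y (a i) / \<epsilon>"] by (auto intro!: mult_left_mono)
          ultimately have "r \<le> F y (a i)" "F y (a i) - r \<le> \<epsilon>" by linarith+
          moreover have "q (L y) i = min C (max (- C) r)"
            using i by (simp add: q(2) p_def L_def r_def)
          ultimately show ?thesis using F_le[of "a i"] by (auto simp: min_def max_def)
        qed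
        ultimately have "\<bar>F y x - q (L y) i\<bar> \<le> 2 * \<epsilon>" by linarith
        then show ?thesis by (intro mult_right_mono nonneg)
      qed simp
      have "F y x - mix (q (L y)) x = (\<Sum>i<k. (F y x - q (L y) i) * \<phi> i x)"
        by (simp add: mix_eq_sum[of k x, OF k(2)] left_diff_distrib sum_subtractf
            sum_distrib_left[symmetric] sum_eq_1[of k x, OF k(2)])
      then have "\<bar>F y x - mix (q (L y)) x\<bar> \<le> (\<Sum>i<k. \<bar>(F y x - q (L y) i) * \<phi> i x\<bar>)"
        by (simp add: sum_abs)
      also have "\<dots> = (\<Sum>i<M. \<bar>F y x - q (L y) i\<bar> * \<phi> i x) + (\<Sum>i\<in>{M..<k}. \<bar>F y x - q (L y) i\<bar> * \<phi> i x)"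
        by (simp add: split abs_mult nonneg)
      also have "\<dots> \<le> (\<Sum>i<M. 2 * \<epsilon> * \<phi> i x) + (\<Sum>i\<in>{M..<k}. 2 * C * \<phi> i x)"
      proof (intro add_mono sum_mono)
        show "\<bar>F y x - q (L y) i\<bar> * \<phi> i x \<le> 2 * C * \<phi> i x" for i
        proof (rule mult_right_mono[OF _ nonneg])
          show "\<bar>F y x - q (L y) i\<bar> \<le> 2 * C" using F_le[of x] q(1)[of "L y" i] by linarith
        qed
      qed (rule le2, simp)
      also have "\<dots> \<le> 2 * \<epsilon> + 2 * C * t x"
        using mult_left_mono[OF sum_le_1[where k=M and x=x], of "2 * \<epsilon>"] \<epsilon>
        by (simp add: t_eq sum_distrib_left[symmetric])
      finally show ?thesis using g(3)[of "L y" x] unfolding G_def by linarith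
    qed
    ultimately show "\<exists>G t. (\<lambda>(y, z). G y z) \<in> borel_measurable (A \<Otimes>\<^sub>M R) \<and> (\<forall>y. \<forall>z\<in>space R. \<bar>G y z\<bar> \<le> B) \<and>
        t \<in> borel_measurable borel \<and> (\<forall>x. 0 \<le> t x \<and> t x \<le> 1) \<and> (\<integral>x. t x \<partial>\<eta>) \<le> \<epsilon> \<and>
        (\<forall>y\<in>space A. \<forall>x. \<bar>F y x - (\<integral>z. G y z \<partial>\<kappa> x)\<bar> \<le> 3 * \<epsilon> + 2 * C * t x)"
      using M g(2) by (intro exI[of _ G] exI[of _ t]) (auto simp: t_def G_def)
  qed
qed

section \<open>Joint laws of states and observations\<close>

text \<open>Turns the iterated form of the definitions, in which the noise is drawn after the
  states, into a product measure with noise independent of the states.\<close>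

lemma distr_pair_eq_bind:
  assumes M: "prob_space M" and N: "prob_space N" and f[measurable]: "f \<in> M \<Otimes>\<^sub>M N \<rightarrow>\<^sub>M R"
  shows "distr (M \<Otimes>\<^sub>M N) R f = M \<bind> (\<lambda>x. distr N R (\<lambda>y. f (x, y)))"
proof -
  interpret M: prob_space M by fact
  interpret N: prob_space N by fact
  have "N \<in> space (prob_algebra N)" using N by (simp add: space_prob_algebra)
  then have K[measurable]: "(\<lambda>x. distr N R (\<lambda>y. f (x, y))) \<in> M \<rightarrow>\<^sub>M prob_algebra R"
    by (intro measurable_distr_prob_space2[where M=N]) simp_all
  show ?thesis
  proof (rule measure_eqI)
    have sets: "sets (M \<bind> (\<lambda>x. distr N R (\<lambda>y. f (x, y)))) = sets R"
      using M.not_empty by (intro sets_bind) auto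
    then show "sets (distr (M \<Otimes>\<^sub>M N) R f) = sets (M \<bind> (\<lambda>x. distr N R (\<lambda>y. f (x, y))))" by simp
    fix A assume "A \<in> sets (distr (M \<Otimes>\<^sub>M N) R f)"
    then have A[measurable]: "A \<in> sets R" by simp
    have "emeasure (distr (M \<Otimes>\<^sub>M N) R f) A = (\<integral>\<^sup>+p. indicator A (f p) \<partial>(M \<Otimes>\<^sub>M N))"
      by (subst nn_integral_indicator[symmetric], simp, subst nn_integral_distr) auto
    also have "\<dots> = (\<integral>\<^sup>+x. \<integral>\<^sup>+y. indicator A (f (x, y)) \<partial>N \<partial>M)"
      by (subst N.nn_integral_fst[symmetric]) auto
    also have "\<dots> = (\<integral>\<^sup>+x. emeasure (distr N R (\<lambda>y. f (x, y))) A \<partial>M)"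
      by (intro nn_integral_cong) (subst nn_integral_indicator[symmetric], simp, subst nn_integral_distr, auto)
    also have "\<dots> = emeasure (M \<bind> (\<lambda>x. distr N R (\<lambda>y. f (x, y)))) A"
      by (rule emeasure_bind[symmetric, OF M.not_empty measurable_prob_algebraD[OF K] A])
    finally show "emeasure (distr (M \<Otimes>\<^sub>M N) R f) A = emeasure (M \<bind> (\<lambda>x. distr N R (\<lambda>y. f (x, y)))) A" .
  qed
qed

text \<open>The Markov property is first proved for nonnegative functions, where Fubini's theorem
  asks for no integrability. Applied to indicators, such an identity says that the law of
  \<open>a\<close> is the mixture \<open>P \<bind> K\<close>, and bounded functions follow.\<close>

lemma integral_kernel_transfer:
  fixes F :: "'b \<Rightarrow> real"
  assumes P: "prob_space P" and a[measurable]: "a \<in> P \<rightarrow>\<^sub>M N" and K: "K \<in> P \<rightarrow>\<^sub>M prob_algebra N"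
    and eq: "\<And>f. f \<in> borel_measurable N \<Longrightarrow> (\<integral>\<^sup>+\<omega>. f (a \<omega>) \<partial>P) = (\<integral>\<^sup>+\<omega>. \<integral>\<^sup>+y. f y \<partial>K \<omega> \<partial>P)"
    and F[measurable]: "F \<in> borel_measurable N" and bdd: "\<And>y. y \<in> space N \<Longrightarrow> \<bar>F y\<bar> \<le> B"
  shows "(\<integral>\<omega>. F (a \<omega>) \<partial>P) = (\<integral>\<omega>. \<integral>y. F y \<partial>K \<omega> \<partial>P)"
proof -
  interpret prob_space P by fact
  note K' = measurable_prob_algebraD[OF K]
  have "distr P N a = P \<bind> K"
  proof (rule measure_eqI)
    show "sets (distr P N a) = sets (P \<bind> K)"
      by (simp add: sets_bind[OF sets_kernel[OF K'] not_empty])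
    fix A assume "A \<in> sets (distr P N a)"
    then have A[measurable]: "A \<in> sets N" by simp
    have "emeasure (distr P N a) A = (\<integral>\<^sup>+\<omega>. indicator A (a \<omega>) \<partial>P)"
      by (subst nn_integral_indicator[symmetric], simp, subst nn_integral_distr) auto
    also have "\<dots> = (\<integral>\<^sup>+\<omega>. emeasure (K \<omega>) A \<partial>P)"
      by (subst eq) (auto intro!: nn_integral_cong nn_integral_indicator simp: sets_kernel[OF K'])
    also have "\<dots> = emeasure (P \<bind> K) A"
      by (rule emeasure_bind[symmetric, OF not_empty K' A])
    finally show "emeasure (distr P N a) A = emeasure (P \<bind> K) A" .
  qed
  then have "(\<integral>\<omega>. F (a \<omega>) \<partial>P) = (\<integral>y. F y \<partial>(P \<bind> K))"
    by (subst integral_distr[symmetric, OF a F]) simp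
  also have "\<dots> = (\<integral>\<omega>. \<integral>y. F y \<partial>K \<omega> \<partial>P)"
    using bdd measurable_space[OF K]
    by (intro integral_bind[where K=N and B=B and B'=1] F K')
      (auto simp: space_prob_algebra prob_space.emeasure_space_1 finite_measure_axioms)
  finally show ?thesis .
qed

text \<open>Pushing \<open>L x\<close> forward to the law of \<open>(x, y)\<close> moves the
  parameter from the integrand into the measure, in which the integral is measurable.\<close>

lemma kernel_integral_measurable:
  fixes f :: "'a \<Rightarrow> 'b \<Rightarrow> real"
  assumes f: "(\<lambda>(x, y). f x y) \<in> borel_measurable (M \<Otimes>\<^sub>M N)" and L: "L \<in> M \<rightarrow>\<^sub>M prob_algebra N"
  shows "(\<lambda>x. \<integral>y. f x y \<partial>L x) \<in> borel_measurable M"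
proof -
  have K: "(\<lambda>x. distr (L x) (M \<Otimes>\<^sub>M N) (\<lambda>y. (x, y))) \<in> M \<rightarrow>\<^sub>M prob_algebra (M \<Otimes>\<^sub>M N)"
    by (rule measurable_distr_prob_space2[OF L]) simp
  have "(\<lambda>x. \<integral>w. (\<lambda>(x, y). f x y) w \<partial>distr (L x) (M \<Otimes>\<^sub>M N) (\<lambda>y. (x, y))) \<in> borel_measurable M"
    by (rule measurable_compose[OF measurable_prob_algebraD[OF K] integral_measurable_subprob_algebra[OF f]])
  also have "?this \<longleftrightarrow> ?thesis"
  proof (rule measurable_cong)
    fix x assume x: "x \<in> space M"
    have s: "sets (L x) = sets N" using measurable_space[OF L x] by (simp add: space_prob_algebra)
    have "Pair x \<in> L x \<rightarrow>\<^sub>M M \<Otimes>\<^sub>M N"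
      using measurable_Pair1'[OF x, of N] by (simp only: measurable_cong_sets[OF s refl])
    then show "(\<integral>w. (\<lambda>(x, y). f x y) w \<partial>distr (L x) (M \<Otimes>\<^sub>M N) (\<lambda>y. (x, y))) = (\<integral>y. f x y \<partial>L x)"
      by (subst integral_distr[OF _ f]) simp_all
  qed
  finally show ?thesis .
qed

section \<open>Kernels and noise of the model\<close>

locale hidden_markov =
  fixes T :: "'x::polish_space \<Rightarrow> 'x measure" and Q :: "'z::polish_space measure"
    and h :: "'x \<Rightarrow> 'z \<Rightarrow> 'y::polish_space"
  assumes T_kernel[measurable]: "T \<in> borel \<rightarrow>\<^sub>M prob_algebra borel"
    and Q_prob: "prob_space Q" and Q_sets[measurable_cong]: "sets Q = sets borel"
    and h_meas: "(\<lambda>(x, z). h x z) \<in> borel \<Otimes>\<^sub>M borel \<rightarrow>\<^sub>M borel"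
begin

text \<open>A single infinite sequence serves all horizons and both starting times, whereas
  \<open>joint_law\<close> takes a new finite product each time.\<close>

abbreviation noise :: "(nat \<Rightarrow> 'z) measure" where
  "noise \<equiv> PiM UNIV (\<lambda>_. Q)"

lemma prob_space_noise: "prob_space noise"
  by (intro prob_space_PiM Q_prob)

lemma h_comp[measurable (raw)]:
  "f \<in> M \<rightarrow>\<^sub>M borel \<Longrightarrow> g \<in> M \<rightarrow>\<^sub>M borel \<Longrightarrow> (\<lambda>w. h (f w) (g w)) \<in> M \<rightarrow>\<^sub>M borel"
  using measurable_compose[OF measurable_Pair h_meas, of f M g] by simp

lemma noise_component:
  assumes "f \<in> M \<rightarrow>\<^sub>M PiM I (\<lambda>_. Q)" "i \<in> I"
  shows "(\<lambda>w. f w i) \<in> M \<rightarrow>\<^sub>M borel"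
proof -
  have "(\<lambda>w. f w i) \<in> M \<rightarrow>\<^sub>M Q"
    by (rule measurable_compose[OF assms(1) measurable_component_singleton[OF assms(2)]])
  then show ?thesis using Q_sets by (simp cong: measurable_cong_sets)
qed

section \<open>Laws of finite paths\<close>

lemma state_step:
  "(\<lambda>\<omega>. distr (T (\<omega> (s + k))) (PiM {s..s + Suc k} (\<lambda>_. borel))
        (\<lambda>x'. \<lambda>i\<in>{s..s + Suc k}. if i = s + Suc k then x' else \<omega> i))
     \<in> PiM {s..s + k} (\<lambda>_. borel) \<rightarrow>\<^sub>M prob_algebra (PiM {s..s + Suc k} (\<lambda>_. borel))"
proof (rule measurable_distr_prob_space2[where M=borel])
  show "(\<lambda>\<omega>. T (\<omega> (s + k))) \<in> PiM {s..s + k} (\<lambda>_. borel) \<rightarrow>\<^sub>M prob_algebra borel"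
    by (rule measurable_compose[OF _ T_kernel]) (rule measurable_component_singleton, simp)
  show "(\<lambda>(\<omega>, x'). \<lambda>i\<in>{s..s + Suc k}. if i = s + Suc k then x' else \<omega> i)
     \<in> PiM {s..s + k} (\<lambda>_. borel) \<Otimes>\<^sub>M borel \<rightarrow>\<^sub>M PiM {s..s + Suc k} (\<lambda>_. borel)"
    unfolding split_beta'
  proof (rule measurable_restrict)
    fix i assume i: "i \<in> {s..s + Suc k}"
    show "(\<lambda>w. if i = s + Suc k then snd w else fst w i) \<in> PiM {s..s + k} (\<lambda>_. borel) \<Otimes>\<^sub>M borel \<rightarrow>\<^sub>M borel"
      using i by (cases "i = s + Suc k")
        (auto intro!: measurable_compose[OF measurable_fst measurable_component_singleton])
  qed
qed

lemma state_law_kernel[measurable]: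
  "(\<lambda>\<mu>. state_law T s \<mu> k) \<in> prob_algebra borel \<rightarrow>\<^sub>M prob_algebra (PiM {s..s + k} (\<lambda>_. borel))"
proof (induction k)
  case 0
  have "(\<lambda>x::'x. \<lambda>i\<in>{s..s}. x) \<in> borel \<rightarrow>\<^sub>M PiM {s..s} (\<lambda>_. borel)"
    by (rule measurable_restrict) simp
  then show ?case by (simp add: measurable_distr_prob_space)
next
  case (Suc k)
  from measurable_bind_prob_space[OF Suc state_step] show ?case by simp
qed

lemma state_law_prob:
  assumes "\<nu> \<in> space (prob_algebra borel)"
  shows "prob_space (state_law T s \<nu> k)" "sets (state_law T s \<nu> k) = sets (PiM {s..s + k} (\<lambda>_. borel))"
    "space (state_law T s \<nu> k) = space (PiM {s..s + k} (\<lambda>_. borel))"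
    "state_law T s \<nu> k \<in> space (prob_algebra (PiM {s..s + k} (\<lambda>_. borel)))"
proof -
  show *: "state_law T s \<nu> k \<in> space (prob_algebra (PiM {s..s + k} (\<lambda>_. borel)))"
    using measurable_space[OF state_law_kernel assms] .
  then show "prob_space (state_law T s \<nu> k)" "sets (state_law T s \<nu> k) = sets (PiM {s..s + k} (\<lambda>_. borel))"
    by (auto simp: space_prob_algebra)
  then show "space (state_law T s \<nu> k) = space (PiM {s..s + k} (\<lambda>_. borel))"
    by (rule_tac sets_eq_imp_space_eq)
qed

lemma return_in_prob_algebra: "return borel (x::'x) \<in> space (prob_algebra borel)"
  by (simp add: space_prob_algebra prob_space_return)

text \<open>The noise is i.i.d., so a finite product of \<open>Q\<close> can be read off the
  infinite sequence after any injective change of index. The shift by \<open>s\<close> lets the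
  noise start at coordinate 0 also for paths that start at time 1, which fits the fresh sequence
  left after a split in time.\<close>

lemma joint_law_eq:
  assumes "\<nu> \<in> space (prob_algebra borel)"
  shows "joint_law T Q h s \<nu> k = distr (state_law T s \<nu> k \<Otimes>\<^sub>M noise)
     (PiM {s..s + k} (\<lambda>_. borel) \<Otimes>\<^sub>M PiM {s..s + k} (\<lambda>_. borel))
     (\<lambda>(\<omega>, z). (\<omega>, \<lambda>i\<in>{s..s + k}. h (\<omega> i) (z (i - s))))"
proof -
  note S = state_law_prob[OF assms, of s k]
  have m: "(\<lambda>(\<omega>, z). (\<omega>, \<lambda>i\<in>{s..s + k}. h (\<omega> i) (z (i - s)))) \<in> state_law T s \<nu> k \<Otimes>\<^sub>M noise \<rightarrow>\<^sub>M
      PiM {s..s + k} (\<lambda>_. borel) \<Otimes>\<^sub>M PiM {s..s + k} (\<lambda>_. borel)"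
    unfolding split_beta' using S(2)
    by (intro measurable_Pair measurable_restrict h_comp noise_component[OF measurable_snd])
      (auto cong: measurable_cong_sets intro!: measurable_compose[OF measurable_fst measurable_component_singleton])
  have "distr (PiM {s..s + k} (\<lambda>_. Q)) (PiM {s..s + k} (\<lambda>_. borel) \<Otimes>\<^sub>M PiM {s..s + k} (\<lambda>_. borel))
               (\<lambda>z. (\<omega>, \<lambda>i\<in>{s..s + k}. h (\<omega> i) (z i))) =
      distr noise (PiM {s..s + k} (\<lambda>_. borel) \<Otimes>\<^sub>M PiM {s..s + k} (\<lambda>_. borel))
               (\<lambda>z. (\<omega>, \<lambda>i\<in>{s..s + k}. h (\<omega> i) (z (i - s))))"
    if \<omega>: "\<omega> \<in> space (state_law T s \<nu> k)" for \<omega>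
  proof -
    have inj: "inj_on (\<lambda>i. i - s) {s..s + k}" by (auto simp: inj_on_def)
    have m1: "(\<lambda>z. (\<omega>, \<lambda>i\<in>{s..s + k}. h (\<omega> i) (z i))) \<in> PiM {s..s + k} (\<lambda>_. Q) \<rightarrow>\<^sub>M
      PiM {s..s + k} (\<lambda>_. borel) \<Otimes>\<^sub>M PiM {s..s + k} (\<lambda>_. borel)"
      using \<omega> S(3) by (intro measurable_Pair measurable_const measurable_restrict h_comp)
        (auto intro!: noise_component[OF measurable_ident_sets])
    have m2: "(\<lambda>z. \<lambda>i\<in>{s..s + k}. z (i - s)) \<in> noise \<rightarrow>\<^sub>M PiM {s..s + k} (\<lambda>_. Q)"
      by (intro measurable_restrict measurable_component_singleton) simp
    have "distr noise (PiM {s..s + k} (\<lambda>_. Q)) (\<lambda>z. \<lambda>i\<in>{s..s + k}. z (i - s)) = PiM {s..s + k} (\<lambda>_. Q)"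
      using distr_PiM_reindex[where M="\<lambda>_. Q", OF Q_prob inj, of UNIV] by simp
    then have "distr (PiM {s..s + k} (\<lambda>_. Q)) (PiM {s..s + k} (\<lambda>_. borel) \<Otimes>\<^sub>M PiM {s..s + k} (\<lambda>_. borel))
               (\<lambda>z. (\<omega>, \<lambda>i\<in>{s..s + k}. h (\<omega> i) (z i))) =
       distr (distr noise (PiM {s..s + k} (\<lambda>_. Q)) (\<lambda>z. \<lambda>i\<in>{s..s + k}. z (i - s)))
         (PiM {s..s + k} (\<lambda>_. borel) \<Otimes>\<^sub>M PiM {s..s + k} (\<lambda>_. borel))
               (\<lambda>z. (\<omega>, \<lambda>i\<in>{s..s + k}. h (\<omega> i) (z i)))" by simp
    also have "\<dots> = distr noise (PiM {s..s + k} (\<lambda>_. borel) \<Otimes>\<^sub>M PiM {s..s + k} (\<lambda>_. borel))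
               (\<lambda>z. (\<omega>, \<lambda>i\<in>{s..s + k}. h (\<omega> i) (z (i - s))))"
      by (subst distr_distr[OF m1 m2]) (auto intro!: distr_cong simp: comp_def)
    finally show ?thesis .
  qed
  then show ?thesis unfolding joint_law_def
    by (subst distr_pair_eq_bind[OF S(1) prob_space_noise m]) (auto intro!: bind_cong)
qed

lemma obs_law_map_measurable:
  assumes N: "1 \<le> N" and M: "sets M = sets (PiM {1..1 + (N - 1)} (\<lambda>_. borel :: 'x measure))"
  shows "(\<lambda>(\<omega>, z). \<lambda>i\<in>{1..N}. h (\<omega> i) (z (i - 1))) \<in> M \<Otimes>\<^sub>M noise \<rightarrow>\<^sub>M PiM {1..N} (\<lambda>_. borel)"
proof -
  have "(\<lambda>w. fst w i) \<in> M \<Otimes>\<^sub>M noise \<rightarrow>\<^sub>M borel" if "i \<in> {1..N}" for i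
  proof (rule measurable_compose[OF measurable_fst])
    show "(\<lambda>w. w i) \<in> M \<rightarrow>\<^sub>M borel"
      using that N by (subst measurable_cong_sets[OF M refl]) (auto intro: measurable_component_singleton)
  qed
  then show ?thesis unfolding split_beta'
    by (intro measurable_restrict h_comp noise_component[OF measurable_snd]) auto
qed

lemma obs_law_eq:
  assumes N: "1 \<le> N"
  shows "obs_law_given_X1 T Q h N x = distr (state_law T 1 (return borel x) (N - 1) \<Otimes>\<^sub>M noise)
     (PiM {1..N} (\<lambda>_. borel)) (\<lambda>(\<omega>, z). \<lambda>i\<in>{1..N}. h (\<omega> i) (z (i - 1)))"
proof -
  note S = state_law_prob[OF return_in_prob_algebra, of 1 x "N - 1"]
  have N': "1 + (N - 1) = N" using N by simp
  have "(\<lambda>(\<omega>, z). (\<omega>, \<lambda>i\<in>{1..N}. h (\<omega> i) (z (i - 1)))) \<in>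
      state_law T 1 (return borel x) (N - 1) \<Otimes>\<^sub>M noise \<rightarrow>\<^sub>M PiM {1..N} (\<lambda>_. borel) \<Otimes>\<^sub>M PiM {1..N} (\<lambda>_. borel)"
    using obs_law_map_measurable[OF N S(2)] measurable_ident_sets[OF S(2)] N'
    unfolding split_beta' by (intro measurable_Pair) (auto intro: measurable_compose[OF measurable_fst])
  then show ?thesis
    unfolding obs_law_given_X1_def joint_law_eq[OF return_in_prob_algebra] N'
    by (subst distr_distr) (auto simp: comp_def split_beta' intro!: distr_cong)
qed

lemma obs_law_kernel:
  assumes N: "1 \<le> N"
  shows "obs_law_given_X1 T Q h N \<in> borel \<rightarrow>\<^sub>M prob_algebra (PiM {1..N} (\<lambda>_. borel))"
proof -
  have "noise \<in> space (prob_algebra noise)" by (simp add: space_prob_algebra prob_space_noise)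
  then have "(\<lambda>x. state_law T 1 (return borel x) (N - 1) \<Otimes>\<^sub>M noise)
      \<in> borel \<rightarrow>\<^sub>M prob_algebra (PiM {1..1 + (N - 1)} (\<lambda>_. borel) \<Otimes>\<^sub>M noise)"
    by (intro measurable_pair_prob measurable_compose[OF measurable_return_prob_space state_law_kernel]) simp
  from measurable_compose[OF this measurable_distr_prob_space[OF obs_law_map_measurable[OF N refl]]]
  show ?thesis using obs_law_eq[OF N] by (simp cong: measurable_cong)
qed

lemma nn_integral_obs_law:
  assumes N: "1 \<le> N" and F: "F \<in> borel_measurable (PiM {1..N} (\<lambda>_. borel))"
  shows "(\<integral>\<^sup>+y. F y \<partial>obs_law_given_X1 T Q h N x) =
    (\<integral>\<^sup>+\<omega>. \<integral>\<^sup>+z. F (\<lambda>i\<in>{1..N}. h (\<omega> i) (z (i - 1))) \<partial>noise \<partial>state_law T 1 (return borel x) (N - 1))"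
proof -
  interpret noise: prob_space noise by (rule prob_space_noise)
  note S = state_law_prob[OF return_in_prob_algebra, of 1 x "N - 1"]
  note m = obs_law_map_measurable[OF N S(2)]
  show ?thesis unfolding obs_law_eq[OF N]
    by (simp only: nn_integral_distr[OF m] F measurable_distr_eq1
        noise.nn_integral_fst[OF measurable_compose[OF m F], symmetric] split)
qed

text \<open>The future is indexed from \<open>1\<close>, so that its entry \<open>1\<close> takes the place of \<open>\<omega> m\<close>, with which it agrees
  almost surely.\<close>

definition continuation :: "nat \<Rightarrow> nat \<Rightarrow> (nat \<Rightarrow> 'x) \<Rightarrow> (nat \<Rightarrow> 'x) measure" where
  "continuation m k \<omega> = distr (state_law T 1 (return borel (\<omega> m)) k) (PiM {0..m + k} (\<lambda>_. borel))
     (\<lambda>\<omega>'. \<lambda>i\<in>{0..m + k}. if i < m then \<omega> i else \<omega>' (Suc i - m))"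

text \<open>Chapman-Kolmogorov for path laws, by induction on \<open>k\<close>. A future without
  transitions has the single entry \<open>\<omega> m\<close>, and gluing it on gives back \<omega>.
  Gluing commutes with one further transition because the last state of the glued path is the last
  state \<open>\<omega>' (1 + k)\<close> of the future, so that both extensions draw from the same
  \<open>T\<close>.\<close>

lemma state_law_split:
  assumes \<nu>: "\<nu> \<in> space (prob_algebra borel)"
  shows "state_law T 0 \<nu> (m + k) = state_law T 0 \<nu> m \<bind> continuation m k"
    and continuation_kernel:
      "continuation m k \<in> PiM {0..m} (\<lambda>_. borel) \<rightarrow>\<^sub>M prob_algebra (PiM {0..m + k} (\<lambda>_. borel))"
    and glue_measurable: "\<omega> \<in> space (PiM {0..m} (\<lambda>_. borel :: 'x measure)) \<Longrightarrow>
      (\<lambda>\<omega>'. \<lambda>i\<in>{0..m + k}. if i < m then \<omega> i else \<omega>' (Suc i - m))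
      \<in> PiM {1..1 + k} (\<lambda>_. borel) \<rightarrow>\<^sub>M PiM {0..m + k} (\<lambda>_. borel)"
proof -
  let ?G = "continuation m"
  have glue: "(\<lambda>(\<omega>, \<omega>'). \<lambda>i\<in>{0..m + k}. if i < m then \<omega> i else \<omega>' (Suc i - m))
      \<in> PiM {0..m} (\<lambda>_. borel::'x measure) \<Otimes>\<^sub>M PiM {1..1 + k} (\<lambda>_. borel) \<rightarrow>\<^sub>M PiM {0..m + k} (\<lambda>_. borel)" for k
    unfolding split_beta'
  proof (rule measurable_restrict)
    fix i assume i: "i \<in> {0..m + k}"
    show "(\<lambda>w. if i < m then fst w i else snd w (Suc i - m))
      \<in> PiM {0..m} (\<lambda>_. borel::'x measure) \<Otimes>\<^sub>M PiM {1..1 + k} (\<lambda>_. borel) \<rightarrow>\<^sub>M borel"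
      using i by (cases "i < m")
        (auto intro!: measurable_compose[OF measurable_fst measurable_component_singleton]
          measurable_compose[OF measurable_snd measurable_component_singleton])
  qed
  have law1: "(\<lambda>\<omega>. state_law T 1 (return borel (\<omega> m)) k)
      \<in> PiM {0..m} (\<lambda>_. borel) \<rightarrow>\<^sub>M prob_algebra (PiM {1..1 + k} (\<lambda>_. borel))" for k
    by (rule measurable_compose[OF _ state_law_kernel], rule measurable_compose[OF _ measurable_return_prob_space])
      (rule measurable_component_singleton, simp)
  have G: "?G k \<in> PiM {0..m} (\<lambda>_. borel) \<rightarrow>\<^sub>M prob_algebra (PiM {0..m + k} (\<lambda>_. borel))" for k
    unfolding continuation_def by (rule measurable_distr_prob_space2[OF law1 glue])
  then show "?G k \<in> PiM {0..m} (\<lambda>_. borel) \<rightarrow>\<^sub>M prob_algebra (PiM {0..m + k} (\<lambda>_. borel))" .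
  show "\<omega> \<in> space (PiM {0..m} (\<lambda>_. borel :: 'x measure)) \<Longrightarrow>
      (\<lambda>\<omega>'. \<lambda>i\<in>{0..m + k}. if i < m then \<omega> i else \<omega>' (Suc i - m))
      \<in> PiM {1..1 + k} (\<lambda>_. borel) \<rightarrow>\<^sub>M PiM {0..m + k} (\<lambda>_. borel)"
    using measurable_compose[OF measurable_Pair1' glue[of k]] by simp
  note S = state_law_prob[OF \<nu>, of 0 m, simplified]
  note L = state_law_prob[OF return_in_prob_algebra, of 1]
  have glue1: "(\<lambda>\<omega>'. \<lambda>i\<in>{0..m + k}. if i < m then \<omega> i else \<omega>' (Suc i - m))
      \<in> PiM {1..1 + k} (\<lambda>_. borel) \<rightarrow>\<^sub>M PiM {0..m + k} (\<lambda>_. borel)"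
    if "\<omega> \<in> space (PiM {0..m} (\<lambda>_. borel::'x measure))" for \<omega> k
    using measurable_compose[OF measurable_Pair1'[OF that] glue[of k]] by simp
  show "state_law T 0 \<nu> (m + k) = state_law T 0 \<nu> m \<bind> ?G k"
  proof (induction k)
    case 0
    have "?G 0 \<omega> = return (PiM {0..m} (\<lambda>_. borel)) \<omega>" if \<omega>: "\<omega> \<in> space (PiM {0..m} (\<lambda>_. borel))" for \<omega>
    proof -
      have c: "(\<lambda>x::'x. \<lambda>i\<in>{1..1::nat}. x) \<in> borel \<rightarrow>\<^sub>M PiM {1..1} (\<lambda>_. borel)"
        by (rule measurable_restrict) simp
      let ?c = "\<lambda>i\<in>{1..1::nat}. \<omega> m"
      let ?g = "\<lambda>\<omega>'. \<lambda>i\<in>{0..m + 0}. if i < m then \<omega> i else \<omega>' (Suc i - m)"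
      have e1: "state_law T 1 (return borel (\<omega> m)) 0 = return (PiM {1..1 + 0} (\<lambda>_. borel)) ?c"
        unfolding state_law.simps add_0_right by (rule distr_return[OF c]) simp
      have e2: "?c \<in> space (PiM {1..1 + 0} (\<lambda>_. borel))" by (auto simp: space_PiM)
      have e3: "?g ?c = \<omega>"
        using \<omega> by (auto simp: space_PiM fun_eq_iff PiE_def extensional_def)
      show ?thesis
        unfolding continuation_def e1
        using distr_return[OF glue1[OF \<omega>, of 0] e2] unfolding e3 by (simp only: add_0_right)
    qed
    then have "state_law T 0 \<nu> m \<bind> ?G 0 = state_law T 0 \<nu> m \<bind> return (PiM {0..m} (\<lambda>_. borel))"
      using S(3) by (intro bind_cong) auto
    then show ?case using bind_return''[OF S(2)] by simp
  next
    case (Suc k)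
    let ?step = "\<lambda>s k \<omega>. distr (T (\<omega> (s + k))) (PiM {s..s + Suc k} (\<lambda>_. borel))
        (\<lambda>x'. \<lambda>i\<in>{s..s + Suc k}. if i = s + Suc k then x' else \<omega> i)"
    have ne: "space (PiM I (\<lambda>_. borel::'x measure)) \<noteq> {}" for I :: "nat set"
      by (simp add: space_PiM PiE_eq_empty_iff)
    have "state_law T 0 \<nu> (m + Suc k) = (state_law T 0 \<nu> m \<bind> ?G k) \<bind> ?step 0 (m + k)"
      by (simp add: Suc)
    also have "\<dots> = state_law T 0 \<nu> m \<bind> (\<lambda>\<omega>. ?G k \<omega> \<bind> ?step 0 (m + k))"
    proof (rule bind_assoc)
      show "?G k \<in> state_law T 0 \<nu> m \<rightarrow>\<^sub>M subprob_algebra (PiM {0..m + k} (\<lambda>_. borel))"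
        using measurable_prob_algebraD[OF G[of k]] by (simp only: measurable_cong_sets[OF S(2) refl])
      show "?step 0 (m + k) \<in> PiM {0..m + k} (\<lambda>_. borel) \<rightarrow>\<^sub>M subprob_algebra (PiM {0..m + Suc k} (\<lambda>_. borel))"
        using measurable_prob_algebraD[OF state_step[of 0 "m + k"]] by simp
    qed
    also have "\<dots> = state_law T 0 \<nu> m \<bind> ?G (Suc k)"
    proof (rule bind_cong[OF refl])
      fix \<omega> assume "\<omega> \<in> space (state_law T 0 \<nu> m)"
      then have \<omega>: "\<omega> \<in> space (PiM {0..m} (\<lambda>_. borel))" using S(3) by simp
      let ?A = "state_law T 1 (return borel (\<omega> m)) k"
      let ?g = "\<lambda>k \<omega>'. \<lambda>i\<in>{0..m + k}. if i < m then \<omega> i else \<omega>' (Suc i - m)"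
      have neA: "space ?A \<noteq> {}" using L(3) ne by simp
      have gA: "?g k \<in> ?A \<rightarrow>\<^sub>M PiM {0..m + k} (\<lambda>_. borel)"
        using glue1[OF \<omega>, of k] measurable_cong_sets[OF L(2) refl] by blast
      have "?G k \<omega> \<bind> ?step 0 (m + k) = ?A \<bind> (\<lambda>\<omega>'. ?step 0 (m + k) (?g k \<omega>'))"
        unfolding continuation_def
        by (rule bind_distr[OF gA _ neA, where K="PiM {0..m + Suc k} (\<lambda>_. borel)"])
          (use measurable_prob_algebraD[OF state_step[of 0 "m + k"]] in simp)
      also have "\<dots> = ?A \<bind> (\<lambda>\<omega>'. distr (?step 1 k \<omega>') (PiM {0..m + Suc k} (\<lambda>_. borel)) (?g (Suc k)))"
      proof (rule bind_cong[OF refl])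
        fix \<omega>' assume "\<omega>' \<in> space ?A"
        then have \<omega>': "\<omega>' \<in> space (PiM {1..1 + k} (\<lambda>_. borel))" using L(3) by simp
        have T: "sets (T x) = sets borel" for x
          using measurable_space[OF T_kernel, of x] by (simp add: space_prob_algebra)
        have m1: "(\<lambda>x'. \<lambda>i\<in>{1..1 + Suc k}. if i = 1 + Suc k then x' else \<omega>' i)
            \<in> T (\<omega>' (1 + k)) \<rightarrow>\<^sub>M PiM {1..1 + Suc k} (\<lambda>_. borel)"
        proof (rule measurable_restrict)
          show "(\<lambda>x'. if i = 1 + Suc k then x' else \<omega>' i) \<in> T (\<omega>' (1 + k)) \<rightarrow>\<^sub>M borel" for i
            by (cases "i = 1 + Suc k") (auto intro!: measurable_ident_sets T)
        qed
        show "?step 0 (m + k) (?g k \<omega>') = distr (?step 1 k \<omega>') (PiM {0..m + Suc k} (\<lambda>_. borel)) (?g (Suc k))"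
          by (subst distr_distr[OF glue1[OF \<omega>] m1])
            (auto intro!: distr_cong simp: fun_eq_iff Suc_diff_le)
      qed
      also have "\<dots> = distr (?A \<bind> ?step 1 k) (PiM {0..m + Suc k} (\<lambda>_. borel)) (?g (Suc k))"
      proof (rule distr_bind[symmetric, OF _ neA glue1[OF \<omega>]])
        show "?step 1 k \<in> ?A \<rightarrow>\<^sub>M subprob_algebra (PiM {1..1 + Suc k} (\<lambda>_. borel))"
          using measurable_prob_algebraD[OF state_step[of 1 k]] by (simp only: measurable_cong_sets[OF L(2) refl])
      qed
      finally show "?G k \<omega> \<bind> ?step 0 (m + k) = ?G (Suc k) \<omega>" by (simp add: continuation_def)
    qed
    finally show ?case .
  qed
qed

section \<open>The state process at all times\<close>

text \<open>The Ionescu-Tulcea construction, with \<nu> as the kernel at time 0. On a common space,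
  posterior densities at different times become random variables that can be subtracted.\<close>

lemma chain_exists:
  assumes \<nu>: "\<nu> \<in> space (prob_algebra borel)"
  obtains S where "prob_space S" "sets S = sets (PiM UNIV (\<lambda>_. borel))"
    "\<And>n. distr S (PiM {0..n} (\<lambda>_. borel)) (\<lambda>\<omega>. restrict \<omega> {0..n}) = state_law T 0 \<nu> n"
proof -
  define P where "P i \<omega> = (if i = 0 then \<nu> else T (\<omega> (i - 1)))" for i :: nat and \<omega> :: "nat \<Rightarrow> 'x"
  have P: "P i \<in> PiM {0..<i} (\<lambda>_. borel) \<rightarrow>\<^sub>M prob_algebra borel" for i
  proof (cases i)
    case 0
    then show ?thesis unfolding P_def using \<nu> by simp
  next
    case (Suc j)
    have "(\<lambda>\<omega>. T (\<omega> j)) \<in> PiM {0..<i} (\<lambda>_. borel) \<rightarrow>\<^sub>M prob_algebra borel"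
      by (rule measurable_compose[OF _ T_kernel], rule measurable_component_singleton) (simp add: Suc)
    then show ?thesis unfolding P_def using Suc by simp
  qed
  interpret IT: Ionescu_Tulcea P "\<lambda>_. borel"
  proof (rule Ionescu_Tulcea.intro)
    show "P i \<in> PiM {0..<i} (\<lambda>_. borel) \<rightarrow>\<^sub>M subprob_algebra borel" for i
      by (rule measurable_prob_algebraD[OF P])
    show "x \<in> space (PiM {0..<i} (\<lambda>_. borel)) \<Longrightarrow> prob_space (P i x)" for i x
      using measurable_space[OF P, of x i] by (simp add: space_prob_algebra)
  qed
  \<comment> \<open>\<open>\<lambda>_. undefined\<close> is the only point of the product over the
    empty index set, that is, the empty history; \<open>Suc n\<close> draws produce the times 0,
    ..., n.\<close>
  have C: "IT.C 0 (Suc n) (\<lambda>_. undefined) = state_law T 0 \<nu> n" for n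
  proof (induction n)
    case 0
    have u: "(\<lambda>_. undefined) \<in> space (PiM {0..<0::nat} (\<lambda>_. borel :: 'x measure))" by (simp add: space_PiM)
    have "IT.C 0 (Suc 0) (\<lambda>_. undefined) = IT.eP 0 (\<lambda>_. undefined)"
      using bind_return[OF IT.measurable_eP[of 0] u] by simp
    also have "\<dots> = state_law T 0 \<nu> 0"
      unfolding IT.eP_def state_law.simps P_def
      by (intro distr_cong) (auto simp: fun_eq_iff atLeastLessThanSuc_atLeastAtMost)
    finally show ?case .
  next
    case (Suc n)
    show ?case
      unfolding IT.C.simps(2)[of 0 "Suc n"] state_law.simps
    proof (rule bind_cong[OF Suc])
      fix \<omega> assume "\<omega> \<in> space (IT.C 0 (Suc n) (\<lambda>_. undefined))"
      then have \<omega>: "\<omega> \<in> space (PiM {0..n} (\<lambda>_. borel))"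
        unfolding Suc using state_law_prob(3)[OF \<nu>, of 0 n] by simp
      show "IT.eP (0 + Suc n) \<omega> = distr (T (\<omega> (0 + n))) (PiM {0..0 + Suc n} (\<lambda>_. borel))
          (\<lambda>x'. \<lambda>i\<in>{0..0 + Suc n}. if i = 0 + Suc n then x' else \<omega> i)"
        unfolding IT.eP_def P_def using \<omega>
        by (intro distr_cong) (auto simp: fun_eq_iff atLeastLessThanSuc_atLeastAtMost space_PiM PiE_def extensional_def)
    qed
  qed
  have up: "IT.up_to {0..n} = Suc n" for n
    by (rule antisym) (auto simp: IT.up_to_iff Suc_le_eq intro!: IT.up_to_less)
  have "distr (state_law T 0 \<nu> n) (PiM {0..n} (\<lambda>_. borel)) (\<lambda>\<omega>. restrict \<omega> {0..n}) = state_law T 0 \<nu> n" for n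
  proof -
    note S = state_law_prob[OF \<nu>, of 0 n]
    have "distr (state_law T 0 \<nu> n) (PiM {0..n} (\<lambda>_. borel)) (\<lambda>\<omega>. restrict \<omega> {0..n}) =
        distr (state_law T 0 \<nu> n) (state_law T 0 \<nu> n) (\<lambda>\<omega>. \<omega>)"
      using S by (intro distr_cong) (auto simp: space_PiM PiE_def extensional_restrict)
    then show ?thesis by (simp add: distr_id2)
  qed
  then have lim: "distr IT.PF.lim (PiM {0..n} (\<lambda>_. borel)) (\<lambda>\<omega>. restrict \<omega> {0..n}) = state_law T 0 \<nu> n" for n
    using IT.distr_lim[OF finite_atLeastAtMost[of 0 n]] by (simp only: IT.CI_def up C)
  \<comment> \<open>The total mass of the limit is read off from its marginal at time 0.\<close>
  have "(\<lambda>\<omega>. restrict \<omega> {0..0}) \<in> IT.PF.lim \<rightarrow>\<^sub>M PiM {0..0} (\<lambda>_. borel)"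
    by (subst measurable_cong_sets[OF IT.PF.sets_lim refl]) (simp add: measurable_restrict_subset)
  then have "prob_space IT.PF.lim"
    by (rule prob_space_distrD) (simp only: lim state_law_prob[OF \<nu>])
  then show thesis
    by (rule that[OF _ IT.PF.sets_lim lim])
qed

lemma obs_restrict_measurable:
  assumes "f \<in> M \<rightarrow>\<^sub>M PiM J (\<lambda>_. borel)" "g \<in> M \<rightarrow>\<^sub>M noise" "\<And>i. i \<in> I \<Longrightarrow> a i \<in> J"
  shows "(\<lambda>w. \<lambda>i\<in>I. h (f w (a i)) (g w (b i))) \<in> M \<rightarrow>\<^sub>M PiM I (\<lambda>_. borel)"
  using assms
  by (intro measurable_restrict h_comp noise_component[OF assms(2)])
    (auto intro: measurable_compose[OF assms(1) measurable_component_singleton])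

text \<open>The noise before time \<open>m\<close> and the noise from \<open>m\<close> on are
  independent: \<open>comb_seq m\<close> keeps \<open>z\<close> below \<open>m\<close> and continues
  with \<open>z'\<close>, restarted at coordinate 0.\<close>

lemma nn_integral_comb_seq:
  assumes f: "f \<in> borel_measurable noise"
  shows "(\<integral>\<^sup>+z. f z \<partial>noise) = (\<integral>\<^sup>+z. \<integral>\<^sup>+z'. f (comb_seq m z z') \<partial>noise \<partial>noise)"
proof -
  interpret noise: prob_space noise by (rule prob_space_noise)
  interpret Q: prob_space Q by (rule Q_prob)
  interpret seq: sequence_space Q by unfold_locales
  have "(\<integral>\<^sup>+z. f z \<partial>noise) = (\<integral>\<^sup>+z. f z \<partial>distr (noise \<Otimes>\<^sub>M noise) noise (\<lambda>(z, z'). comb_seq m z z'))"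
    by (simp only: seq.PiM_comb_seq)
  also have "\<dots> = (\<integral>\<^sup>+w. f (comb_seq m (fst w) (snd w)) \<partial>(noise \<Otimes>\<^sub>M noise))"
    by (subst nn_integral_distr[OF measurable_comb_seq]) (auto simp: f split_beta')
  also have "\<dots> = (\<integral>\<^sup>+z. \<integral>\<^sup>+z'. f (comb_seq m z z') \<partial>noise \<partial>noise)"
    by (subst noise.nn_integral_fst[symmetric])
      (auto intro!: measurable_compose[OF _ f] measurable_comb_seq')
  finally show ?thesis .
qed

lemma nn_integral_noise_component:
  assumes f: "f \<in> borel_measurable borel"
  shows "(\<integral>\<^sup>+z. f (z i) \<partial>noise) = (\<integral>\<^sup>+z. f z \<partial>Q)"
proof -
  have "f \<in> borel_measurable Q" using f Q_sets by (simp cong: measurable_cong_sets)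
  then have "(\<integral>\<^sup>+z. f z \<partial>distr noise Q (\<lambda>z. z i)) = (\<integral>\<^sup>+z. f (z i) \<partial>noise)"
    by (intro nn_integral_distr measurable_component_singleton) auto
  then show ?thesis using distr_PiM_component[of UNIV "\<lambda>_. Q" i] Q_prob by simp
qed

end

section \<open>States and noise on one probability space\<close>

locale hidden_markov_chain = hidden_markov T Q h
  for T :: "'x::polish_space \<Rightarrow> 'x measure" and Q :: "'z::polish_space measure"
    and h :: "'x \<Rightarrow> 'z \<Rightarrow> 'y::polish_space" +
  fixes \<nu> :: "'x measure" and S :: "(nat \<Rightarrow> 'x) measure"
  assumes \<nu>: "\<nu> \<in> space (prob_algebra borel)"
    and S_prob: "prob_space S" and S_sets[measurable_cong]: "sets S = sets (PiM UNIV (\<lambda>_. borel))"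
    and S_law: "\<And>n. distr S (PiM {0..n} (\<lambda>_. borel)) (\<lambda>\<omega>. restrict \<omega> {0..n}) = state_law T 0 \<nu> n"
begin

sublocale S: prob_space S by (rule S_prob)
sublocale noise: prob_space noise by (rule prob_space_noise)

abbreviation P :: "((nat \<Rightarrow> 'x) \<times> (nat \<Rightarrow> 'z)) measure" where "P \<equiv> S \<Otimes>\<^sub>M noise"

sublocale P: prob_space P by (intro prob_space_pair S_prob prob_space_noise)

definition Y :: "nat \<Rightarrow> (nat \<Rightarrow> 'x) \<times> (nat \<Rightarrow> 'z) \<Rightarrow> nat \<Rightarrow> 'y" where
  "Y n p = (\<lambda>i\<in>{0..n}. h (fst p i) (snd p i))"

lemma restrict_measurable: "(\<lambda>\<omega>. restrict \<omega> {0..n}) \<in> S \<rightarrow>\<^sub>M PiM {0..n} (\<lambda>_. borel)"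
  by (intro measurable_restrict measurable_compose[OF measurable_ident_sets[OF S_sets] measurable_component_singleton]) simp

lemma state_measurable[measurable]: "(\<lambda>p. fst p i) \<in> P \<rightarrow>\<^sub>M borel"
  by (intro measurable_compose[OF measurable_fst] measurable_compose[OF measurable_ident_sets[OF S_sets] measurable_component_singleton]) simp

lemma Y_measurable[measurable]: "Y n \<in> P \<rightarrow>\<^sub>M PiM {0..n} (\<lambda>_. borel)"
  unfolding Y_def
  by (rule obs_restrict_measurable[OF measurable_compose[OF measurable_fst measurable_ident_sets[OF S_sets]] measurable_snd]) simp

lemma nn_integral_S:
  assumes "f \<in> borel_measurable (PiM {0..n} (\<lambda>_. borel))"
  shows "(\<integral>\<^sup>+\<omega>. f (restrict \<omega> {0..n}) \<partial>S) = (\<integral>\<^sup>+\<omega>. f \<omega> \<partial>state_law T 0 \<nu> n)"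
  unfolding S_law[symmetric] using assms by (subst nn_integral_distr[OF restrict_measurable]) auto

lemma path_law_eq:
  "path_law T Q h \<nu> n = distr P (PiM {0..n} (\<lambda>_. borel) \<Otimes>\<^sub>M PiM {0..n} (\<lambda>_. borel))
     (\<lambda>p. (restrict (fst p) {0..n}, Y n p))"
proof -
  have id: "(\<lambda>z. z) \<in> noise \<rightarrow>\<^sub>M noise" by simp
  have "state_law T 0 \<nu> n \<Otimes>\<^sub>M noise = distr S (PiM {0..n} (\<lambda>_. borel)) (\<lambda>\<omega>. restrict \<omega> {0..n}) \<Otimes>\<^sub>M distr noise noise (\<lambda>z. z)"
    by (simp add: S_law distr_id2)
  also have "\<dots> = distr P (PiM {0..n} (\<lambda>_. borel) \<Otimes>\<^sub>M noise) (\<lambda>(\<omega>, z). (restrict \<omega> {0..n}, z))"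
    using restrict_measurable id
    by (rule pair_measure_distr) (simp add: distr_id2 noise.sigma_finite_measure_axioms)
  finally have eq: "state_law T 0 \<nu> n \<Otimes>\<^sub>M noise = distr P (PiM {0..n} (\<lambda>_. borel) \<Otimes>\<^sub>M noise) (\<lambda>(\<omega>, z). (restrict \<omega> {0..n}, z))" .
  have m1: "(\<lambda>(\<omega>, z). (restrict \<omega> {0..n}, z)) \<in> P \<rightarrow>\<^sub>M PiM {0..n} (\<lambda>_. borel) \<Otimes>\<^sub>M noise"
    unfolding split_beta' by (intro measurable_Pair measurable_compose[OF measurable_fst restrict_measurable] measurable_snd)
  have m2: "(\<lambda>(\<omega>, z). (\<omega>, \<lambda>i\<in>{0..n}. h (\<omega> i) (z (i - 0)))) \<in> PiM {0..n} (\<lambda>_. borel) \<Otimes>\<^sub>M noise \<rightarrow>\<^sub>M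
      PiM {0..n} (\<lambda>_. borel) \<Otimes>\<^sub>M PiM {0..n} (\<lambda>_. borel)"
    unfolding split_beta' by (intro measurable_Pair measurable_fst obs_restrict_measurable[OF measurable_fst measurable_snd]) simp
  show ?thesis
    unfolding path_law_def joint_law_eq[OF \<nu>] add_0 eq
    by (subst distr_distr[OF m2 m1]) (auto simp: Y_def comp_def split_beta' fun_eq_iff intro!: distr_cong)
qed

lemma nn_integral_P:
  assumes "f \<in> borel_measurable P"
  shows "(\<integral>\<^sup>+p. f p \<partial>P) = (\<integral>\<^sup>+\<omega>. \<integral>\<^sup>+z. f (\<omega>, z) \<partial>noise \<partial>S)"
  by (rule noise.nn_integral_fst[OF assms, symmetric])

lemma nn_integral_continuation:
  assumes \<omega>: "\<omega> \<in> space (PiM {0..m} (\<lambda>_. borel))" and f: "f \<in> borel_measurable (PiM {0..m + k} (\<lambda>_. borel))"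
  shows "(\<integral>\<^sup>+\<omega>'. f \<omega>' \<partial>continuation m k \<omega>) =
    (\<integral>\<^sup>+\<omega>'. f (\<lambda>i\<in>{0..m + k}. if i < m then \<omega> i else \<omega>' (Suc i - m)) \<partial>state_law T 1 (return borel (\<omega> m)) k)"
proof -
  have "(\<lambda>\<omega>'. \<lambda>i\<in>{0..m + k}. if i < m then \<omega> i else \<omega>' (Suc i - m))
      \<in> state_law T 1 (return borel (\<omega> m)) k \<rightarrow>\<^sub>M PiM {0..m + k} (\<lambda>_. borel)"
    using glue_measurable[OF \<nu> \<omega>]
    by (simp only: measurable_cong_sets[OF state_law_prob(2)[OF return_in_prob_algebra] refl])
  then show ?thesis unfolding continuation_def by (rule nn_integral_distr) (simp add: f)
qed

lemma nn_integral_state_split: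
  assumes f: "f \<in> borel_measurable (PiM {0..m + k} (\<lambda>_. borel))"
  shows "(\<integral>\<^sup>+\<omega>. f (restrict \<omega> {0..m + k}) \<partial>S) = (\<integral>\<^sup>+\<omega>. \<integral>\<^sup>+\<omega>'.
    f (\<lambda>i\<in>{0..m + k}. if i < m then \<omega> i else \<omega>' (Suc i - m)) \<partial>state_law T 1 (return borel (\<omega> m)) k
      \<partial>state_law T 0 \<nu> m)"
proof -
  have K: "continuation m k \<in> state_law T 0 \<nu> m \<rightarrow>\<^sub>M subprob_algebra (PiM {0..m + k} (\<lambda>_. borel))"
    using measurable_prob_algebraD[OF continuation_kernel[OF \<nu>]] state_law_prob(2)[OF \<nu>, of 0 m]
    by (simp cong: measurable_cong_sets)
  have sp: "space (state_law T 0 \<nu> m) = space (PiM {0..m} (\<lambda>_. borel))"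
    using state_law_prob(3)[OF \<nu>, of 0 m] by simp
  show ?thesis
    unfolding nn_integral_S[OF f] state_law_split(1)[OF \<nu>] nn_integral_bind[OF f K]
    by (rule nn_integral_cong) (rule nn_integral_continuation, simp_all add: sp f)
qed

section \<open>Markov property and fresh noise\<close>

text \<open>Given X_(n+1), the observations at times n + 1, ..., n + N are independent of X_0, Y_0,
  ..., Y_n, and by time homogeneity X_(n+1) plays the role of X_1 in their law. States and noise are
  both split at \<open>m = Suc n\<close>; then the past noise is moved outermost, so that for a
  fixed past the integrals over future states and future noise combine to
  \<open>obs_law_given_X1\<close>.\<close>

lemma markov_nn_integral:
  assumes N: "1 \<le> N"
    and F: "F \<in> borel_measurable (borel \<Otimes>\<^sub>M PiM {0..n} (\<lambda>_. borel) \<Otimes>\<^sub>M PiM {1..N} (\<lambda>_. borel))"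
  shows "(\<integral>\<^sup>+p. F (fst p 0, Y n p, \<lambda>i\<in>{1..N}. h (fst p (n + i)) (snd p (n + i))) \<partial>P) =
    (\<integral>\<^sup>+p. \<integral>\<^sup>+y. F (fst p 0, Y n p, y) \<partial>obs_law_given_X1 T Q h N (fst p (Suc n)) \<partial>P)"
proof -
  \<comment> \<open>Entry \<open>i\<close> of the future belongs to time \<open>n + i\<close>, so
    its entries 1, ..., \<open>N\<close> involve \<open>N - 1\<close> transitions, starting from the
    state at time \<open>m\<close>.\<close>
  define m k where "m = Suc n" and "k = N - 1"
  have mk: "m + k = n + N" using N by (simp add: m_def k_def)
  have Nk: "N = Suc k" using N by (simp add: k_def)
  define past where "past \<omega> z = (\<lambda>i\<in>{0..n}. h (\<omega> i) (z i))" for \<omega> z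
  define A where "A \<omega> = (\<integral>\<^sup>+z. F (\<omega> 0, past \<omega> z, \<lambda>i\<in>{1..N}. h (\<omega> (n + i)) (z (n + i))) \<partial>noise)" for \<omega>
  define R where "R \<omega> = (\<integral>\<^sup>+z. \<integral>\<^sup>+y. F (\<omega> 0, past \<omega> z, y) \<partial>obs_law_given_X1 T Q h N (\<omega> m) \<partial>noise)" for \<omega>
  have past_m: "(\<lambda>w. past (f w) (g w)) \<in> M \<rightarrow>\<^sub>M PiM {0..n} (\<lambda>_. borel)"
    if "f \<in> M \<rightarrow>\<^sub>M PiM J (\<lambda>_. borel)" "g \<in> M \<rightarrow>\<^sub>M noise" "{0..n} \<subseteq> J"
    for f :: "'w \<Rightarrow> nat \<Rightarrow> 'x" and g M J
    unfolding past_def using that by (intro obs_restrict_measurable[OF that(1,2)]) auto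
  have comp: "(\<lambda>w. f w i) \<in> M \<rightarrow>\<^sub>M borel" if "f \<in> M \<rightarrow>\<^sub>M PiM J (\<lambda>_. borel)" "i \<in> J"
    for f :: "'w \<Rightarrow> nat \<Rightarrow> 'x" and M J i
    by (rule measurable_compose[OF that(1) measurable_component_singleton[OF that(2)]])
  have F_m: "(\<lambda>w. F (f w 0, past (f w) (g w), \<lambda>i\<in>{1..N}. h (f w (n + i)) (g w (n + i)))) \<in> borel_measurable M"
    if "f \<in> M \<rightarrow>\<^sub>M PiM J (\<lambda>_. borel)" "g \<in> M \<rightarrow>\<^sub>M noise" "{0..n + N} \<subseteq> J" for f :: "'w \<Rightarrow> nat \<Rightarrow> 'x" and g M J
  proof (rule measurable_compose[OF _ F], intro measurable_Pair)
    show "(\<lambda>w. f w 0) \<in> borel_measurable M" using that(3) by (intro comp[OF that(1)]) auto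
    show "(\<lambda>w. past (f w) (g w)) \<in> M \<rightarrow>\<^sub>M PiM {0..n} (\<lambda>_. borel)"
      using that by (intro past_m[OF that(1,2)]) auto
    show "(\<lambda>w. \<lambda>i\<in>{1..N}. h (f w (n + i)) (g w (n + i))) \<in> M \<rightarrow>\<^sub>M PiM {1..N} (\<lambda>_. borel)"
      using that(3) by (intro obs_restrict_measurable[OF that(1,2)]) auto
  qed
  have A_m: "A \<in> borel_measurable (PiM {0..m + k} (\<lambda>_. borel))"
    unfolding A_def mk
    by (rule noise.borel_measurable_nn_integral, unfold split_beta', rule F_m[OF measurable_fst measurable_snd order_refl])
  have obs_m: "(\<lambda>w. obs_law_given_X1 T Q h N (f w)) \<in> M \<rightarrow>\<^sub>M subprob_algebra (PiM {1..N} (\<lambda>_. borel))"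
    if "f \<in> M \<rightarrow>\<^sub>M borel" for f :: "'w \<Rightarrow> 'x" and M
    by (rule measurable_compose[OF that measurable_prob_algebraD[OF obs_law_kernel[OF N]]])
  have R_m': "(\<lambda>w. \<integral>\<^sup>+y. F (f w 0, past (f w) (g w), y) \<partial>obs_law_given_X1 T Q h N (f w m)) \<in> borel_measurable M"
    if "f \<in> M \<rightarrow>\<^sub>M PiM J (\<lambda>_. borel)" "g \<in> M \<rightarrow>\<^sub>M noise" "{0..m} \<subseteq> J" for f :: "'w \<Rightarrow> nat \<Rightarrow> 'x" and g M J
  proof (rule nn_integral_measurable_subprob_algebra2[where N="PiM {1..N} (\<lambda>_. borel)"])
    have J: "{0..n} \<subseteq> J" "0 \<in> J" "m \<in> J" using that(3) by (auto simp: m_def)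
    show "(\<lambda>w. obs_law_given_X1 T Q h N (f w m)) \<in> M \<rightarrow>\<^sub>M subprob_algebra (PiM {1..N} (\<lambda>_. borel))"
      by (rule obs_m[OF comp[OF that(1) J(3)]])
    show "(\<lambda>(w, y). F (f w 0, past (f w) (g w), y)) \<in> borel_measurable (M \<Otimes>\<^sub>M PiM {1..N} (\<lambda>_. borel))"
      unfolding split_beta'
      by (intro measurable_compose[OF _ F] measurable_Pair measurable_snd
        measurable_compose[OF measurable_fst comp[OF that(1) J(2)]]
        measurable_compose[OF measurable_fst past_m[OF that(1,2) J(1)]])
  qed
  have R_m: "R \<in> borel_measurable (PiM {0..m} (\<lambda>_. borel))"
    unfolding R_def
    by (rule noise.borel_measurable_nn_integral, unfold split_beta', rule R_m'[OF measurable_fst measurable_snd order_refl])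
  have idS: "fst \<in> P \<rightarrow>\<^sub>M PiM UNIV (\<lambda>_. borel)"
    by (rule measurable_compose[OF measurable_fst measurable_ident_sets[OF S_sets]])
  have "(\<integral>\<^sup>+p. F (fst p 0, Y n p, \<lambda>i\<in>{1..N}. h (fst p (n + i)) (snd p (n + i))) \<partial>P) = (\<integral>\<^sup>+\<omega>. A \<omega> \<partial>S)"
    using F_m[OF idS measurable_snd] unfolding Y_def past_def A_def
    by (subst nn_integral_P) (auto simp: past_def)
  also have "\<dots> = (\<integral>\<^sup>+\<omega>. A (restrict \<omega> {0..m + k}) \<partial>S)"
    by (intro nn_integral_cong) (auto simp: A_def past_def mk cong: restrict_cong)
  also have "\<dots> = (\<integral>\<^sup>+\<omega>. \<integral>\<^sup>+\<omega>'.
    A (\<lambda>i\<in>{0..m + k}. if i < m then \<omega> i else \<omega>' (Suc i - m)) \<partial>state_law T 1 (return borel (\<omega> m)) k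
      \<partial>state_law T 0 \<nu> m)"
    by (rule nn_integral_state_split[OF A_m])
  also have "\<dots> = (\<integral>\<^sup>+\<omega>. R \<omega> \<partial>state_law T 0 \<nu> m)"
  proof (rule nn_integral_cong)
    fix \<omega> assume "\<omega> \<in> space (state_law T 0 \<nu> m)"
    then have \<omega>: "\<omega> \<in> space (PiM {0..m} (\<lambda>_. borel))" using state_law_prob(3)[OF \<nu>, of 0 m] by simp
    let ?L = "state_law T 1 (return borel (\<omega> m)) k"
    interpret L: prob_space ?L by (rule state_law_prob[OF return_in_prob_algebra])
    interpret LN: pair_sigma_finite ?L noise by unfold_locales
    have L_id: "(\<lambda>\<omega>'. \<omega>') \<in> ?L \<rightarrow>\<^sub>M PiM {1..N} (\<lambda>_. borel)"
      using N measurable_ident_sets[OF state_law_prob(2)[OF return_in_prob_algebra, of 1 "\<omega> m" k]] by (simp add: k_def)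
    have past_\<omega>: "past \<omega> \<in> noise \<rightarrow>\<^sub>M PiM {0..n} (\<lambda>_. borel)"
      using past_m[OF measurable_const[OF \<omega>] measurable_ident] by (simp add: m_def)
    have F\<omega>: "(\<lambda>w. F (\<omega> 0, past \<omega> (a w), \<lambda>i\<in>{1..N}. h (b w i) (c w (d i)))) \<in> borel_measurable M"
      if "a \<in> M \<rightarrow>\<^sub>M noise" "b \<in> M \<rightarrow>\<^sub>M PiM {1..N} (\<lambda>_. borel)" "c \<in> M \<rightarrow>\<^sub>M noise" 
      for a b c M and d :: "nat \<Rightarrow> nat"
      by (intro measurable_compose[OF _ F] measurable_Pair measurable_const
          measurable_compose[OF that(1) past_\<omega>] obs_restrict_measurable[OF that(2,3)]) auto
    have "(\<integral>\<^sup>+\<omega>'. A (\<lambda>i\<in>{0..m + k}. if i < m then \<omega> i else \<omega>' (Suc i - m)) \<partial>?L) =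
        (\<integral>\<^sup>+\<omega>'. \<integral>\<^sup>+z. F (\<omega> 0, past \<omega> z, \<lambda>i\<in>{1..N}. h (\<omega>' i) (z (i + n))) \<partial>noise \<partial>?L)"
      by (intro nn_integral_cong) (auto simp: A_def past_def m_def Nk fun_eq_iff add.commute intro!: nn_integral_cong arg_cong[where f=F])
    \<comment> \<open>Splitting the noise at \<open>m = Suc n\<close> sends coordinate
      \<open>i + n\<close> with \<open>i \<ge> 1\<close> to coordinate \<open>i - 1\<close> of the
      fresh sequence, while the past uses coordinates up to \<open>n\<close> only.\<close>
    also have "\<dots> = (\<integral>\<^sup>+\<omega>'. \<integral>\<^sup>+z. \<integral>\<^sup>+z'. F (\<omega> 0, past \<omega> z, \<lambda>i\<in>{1..N}. h (\<omega>' i) (z' (i - 1))) \<partial>noise \<partial>noise \<partial>?L)"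
    proof (rule nn_integral_cong)
      fix \<omega>' assume "\<omega>' \<in> space ?L"
      then have \<omega>': "\<omega>' \<in> space (PiM {1..N} (\<lambda>_. borel))" by (rule measurable_space[OF L_id])
      have m0: "(\<lambda>z. F (\<omega> 0, past \<omega> z, \<lambda>i\<in>{1..N}. h (\<omega>' i) (z (i + n)))) \<in> borel_measurable noise"
        by (rule F\<omega>[OF measurable_ident_sets[OF refl] measurable_const[OF \<omega>'] measurable_ident_sets[OF refl]])
      show "(\<integral>\<^sup>+z. F (\<omega> 0, past \<omega> z, \<lambda>i\<in>{1..N}. h (\<omega>' i) (z (i + n))) \<partial>noise) =
          (\<integral>\<^sup>+z. \<integral>\<^sup>+z'. F (\<omega> 0, past \<omega> z, \<lambda>i\<in>{1..N}. h (\<omega>' i) (z' (i - 1))) \<partial>noise \<partial>noise)"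
        by (subst nn_integral_comb_seq[OF m0, of m])
          (auto simp: past_def m_def comb_seq_def fun_eq_iff intro!: nn_integral_cong arg_cong[where f=F])
    qed
    also have "\<dots> = (\<integral>\<^sup>+z. \<integral>\<^sup>+\<omega>'. \<integral>\<^sup>+z'. F (\<omega> 0, past \<omega> z, \<lambda>i\<in>{1..N}. h (\<omega>' i) (z' (i - 1))) \<partial>noise \<partial>?L \<partial>noise)"
    proof (rule LN.Fubini'[symmetric])
      show "(\<lambda>(\<omega>', z). \<integral>\<^sup>+z'. F (\<omega> 0, past \<omega> z, \<lambda>i\<in>{1..N}. h (\<omega>' i) (z' (i - 1))) \<partial>noise)
          \<in> borel_measurable (?L \<Otimes>\<^sub>M noise)"
        unfolding split_beta'
        by (rule noise.borel_measurable_nn_integral, unfold split_beta')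
          (rule F\<omega>[OF measurable_compose[OF measurable_fst measurable_snd]
            measurable_compose[OF measurable_compose[OF measurable_fst measurable_fst] L_id] measurable_snd])
    qed
    also have "\<dots> = R \<omega>"
      unfolding R_def
    proof (rule nn_integral_cong)
      fix z assume z: "z \<in> space noise"
      have "(\<lambda>y. F (\<omega> 0, past \<omega> z, y)) \<in> borel_measurable (PiM {1..N} (\<lambda>_. borel))"
        by (intro measurable_compose[OF _ F] measurable_Pair measurable_const measurable_ident_sets
            measurable_space[OF past_\<omega> z]) simp_all
      from nn_integral_obs_law[OF N this, of "\<omega> m"]
      show "(\<integral>\<^sup>+\<omega>'. \<integral>\<^sup>+z'. F (\<omega> 0, past \<omega> z, \<lambda>i\<in>{1..N}. h (\<omega>' i) (z' (i - 1))) \<partial>noise \<partial>?L) =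
          (\<integral>\<^sup>+y. F (\<omega> 0, past \<omega> z, y) \<partial>obs_law_given_X1 T Q h N (\<omega> m))"
        by (simp only: k_def)
    qed
    finally show "(\<integral>\<^sup>+\<omega>'. A (\<lambda>i\<in>{0..m + k}. if i < m then \<omega> i else \<omega>' (Suc i - m)) \<partial>?L) = R \<omega>" .
  qed
  also have "\<dots> = (\<integral>\<^sup>+\<omega>. R (restrict \<omega> {0..m}) \<partial>S)" by (rule nn_integral_S[OF R_m, symmetric])
  also have "\<dots> = (\<integral>\<^sup>+\<omega>. R \<omega> \<partial>S)"
    by (intro nn_integral_cong) (auto simp: R_def past_def m_def cong: restrict_cong)
  also have "\<dots> = (\<integral>\<^sup>+p. \<integral>\<^sup>+y. F (fst p 0, Y n p, y) \<partial>obs_law_given_X1 T Q h N (fst p (Suc n)) \<partial>P)"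
    using R_m'[OF idS measurable_snd] unfolding Y_def past_def R_def m_def
    by (subst nn_integral_P) (auto simp: past_def)
  finally show ?thesis .
qed

text \<open>Z_(n+1) is independent of X_0, X_(n+1) and Y_0, ..., Y_n. Splitting the noise at
  \<open>Suc n\<close> leaves the past observations unchanged and makes Z_(n+1) coordinate 0 of the
  fresh sequence.\<close>

lemma noise_nn_integral:
  assumes F: "F \<in> borel_measurable (borel \<Otimes>\<^sub>M PiM {0..n} (\<lambda>_. borel) \<Otimes>\<^sub>M borel \<Otimes>\<^sub>M borel)"
  shows "(\<integral>\<^sup>+p. F (fst p 0, Y n p, fst p (Suc n), h (fst p (Suc n)) (snd p (Suc n))) \<partial>P) =
    (\<integral>\<^sup>+p. \<integral>\<^sup>+z. F (fst p 0, Y n p, fst p (Suc n), h (fst p (Suc n)) z) \<partial>Q \<partial>P)"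
proof -
  interpret Q: prob_space Q by (rule Q_prob)
  have Q_id: "(\<lambda>z. z) \<in> Q \<rightarrow>\<^sub>M borel" by (rule measurable_ident_sets[OF Q_sets])
  have l: "(\<lambda>p. F (fst p 0, Y n p, fst p (Suc n), h (fst p (Suc n)) (snd p (Suc n)))) \<in> borel_measurable P"
    by (intro measurable_compose[OF _ F] measurable_Pair h_comp state_measurable Y_measurable
        noise_component[OF measurable_snd]) simp
  have "(\<lambda>(p, z). F (fst p 0, Y n p, fst p (Suc n), h (fst p (Suc n)) z)) \<in> borel_measurable (P \<Otimes>\<^sub>M Q)"
    unfolding split_beta'
    by (intro measurable_compose[OF _ F] measurable_Pair h_comp measurable_compose[OF measurable_fst state_measurable]
        measurable_compose[OF measurable_fst Y_measurable] measurable_compose[OF measurable_snd Q_id])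
  then have r: "(\<lambda>p. \<integral>\<^sup>+z. F (fst p 0, Y n p, fst p (Suc n), h (fst p (Suc n)) z) \<partial>Q) \<in> borel_measurable P"
    by (rule Q.borel_measurable_nn_integral)
  show ?thesis
    unfolding nn_integral_P[OF l] nn_integral_P[OF r]
  proof (rule nn_integral_cong)
    fix \<omega> assume \<omega>: "\<omega> \<in> space S"
    have m: "(\<lambda>z. F (\<omega> 0, Y n (\<omega>, z), \<omega> (Suc n), h (\<omega> (Suc n)) (z (Suc n)))) \<in> borel_measurable noise"
      using measurable_compose[OF measurable_Pair1'[OF \<omega>] l] by simp
    have m': "(\<lambda>x. F (\<omega> 0, Y n (\<omega>, z), \<omega> (Suc n), h (\<omega> (Suc n)) x)) \<in> borel_measurable borel"
      if "z \<in> space noise" for z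
      using that \<omega> by (intro measurable_compose[OF _ F] measurable_Pair h_comp measurable_const measurable_ident
          measurable_space[OF Y_measurable]) (auto simp: space_pair_measure)
    show "(\<integral>\<^sup>+z. F (fst (\<omega>, z) 0, Y n (\<omega>, z), fst (\<omega>, z) (Suc n), h (fst (\<omega>, z) (Suc n)) (snd (\<omega>, z) (Suc n))) \<partial>noise) =
      (\<integral>\<^sup>+z. \<integral>\<^sup>+x. F (fst (\<omega>, z) 0, Y n (\<omega>, z), fst (\<omega>, z) (Suc n), h (fst (\<omega>, z) (Suc n)) x) \<partial>Q \<partial>noise)"
      unfolding fst_conv snd_conv nn_integral_comb_seq[OF m, of "Suc n"]
    proof (rule nn_integral_cong)
      fix z assume z: "z \<in> space noise"
      have "Y n (\<omega>, comb_seq (Suc n) z z') = Y n (\<omega>, z)" for z'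
        by (auto simp: Y_def comb_seq_def)
      moreover have "comb_seq (Suc n) z z' (Suc n) = z' 0" for z'
        by (simp add: comb_seq_def)
      ultimately show "(\<integral>\<^sup>+z'. F (\<omega> 0, Y n (\<omega>, comb_seq (Suc n) z z'), \<omega> (Suc n), h (\<omega> (Suc n)) (comb_seq (Suc n) z z' (Suc n))) \<partial>noise) =
        (\<integral>\<^sup>+x. F (\<omega> 0, Y n (\<omega>, z), \<omega> (Suc n), h (\<omega> (Suc n)) x) \<partial>Q)"
        by (simp only: nn_integral_noise_component[OF m'[OF z]])
    qed
  qed
qed

lemma markov_integral:
  fixes F :: "'x \<times> (nat \<Rightarrow> 'y) \<times> (nat \<Rightarrow> 'y) \<Rightarrow> real"
  assumes N: "1 \<le> N"
    and F: "F \<in> borel_measurable (borel \<Otimes>\<^sub>M PiM {0..n} (\<lambda>_. borel) \<Otimes>\<^sub>M PiM {1..N} (\<lambda>_. borel))"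
    and bdd: "\<And>w. w \<in> space (borel \<Otimes>\<^sub>M PiM {0..n} (\<lambda>_. borel) \<Otimes>\<^sub>M PiM {1..N} (\<lambda>_. borel)) \<Longrightarrow> \<bar>F w\<bar> \<le> B"
  shows "(\<integral>p. F (fst p 0, Y n p, \<lambda>i\<in>{1..N}. h (fst p (n + i)) (snd p (n + i))) \<partial>P) =
    (\<integral>p. \<integral>y. F (fst p 0, Y n p, y) \<partial>obs_law_given_X1 T Q h N (fst p (Suc n)) \<partial>P)"
proof -
  let ?N = "borel \<Otimes>\<^sub>M PiM {0..n} (\<lambda>_. borel) \<Otimes>\<^sub>M PiM {1..N} (\<lambda>_. borel) :: ('x \<times> (nat \<Rightarrow> 'y) \<times> (nat \<Rightarrow> 'y)) measure"
  let ?O = "\<lambda>p. obs_law_given_X1 T Q h N (fst p (Suc n))"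
  let ?K = "\<lambda>p. distr (?O p) ?N (\<lambda>y. (fst p 0, Y n p, y))"
  have sets_O: "sets (obs_law_given_X1 T Q h N x) = sets (PiM {1..N} (\<lambda>_. borel))" for x
    using measurable_space[OF obs_law_kernel[OF N], of x] by (simp add: space_prob_algebra)
  have tup: "(\<lambda>y. (fst p 0, Y n p, y)) \<in> ?O p \<rightarrow>\<^sub>M ?N" if "p \<in> space P" for p
    using that by (intro measurable_Pair measurable_const measurable_ident_sets[OF sets_O] measurable_space[OF Y_measurable]) auto
  have K: "?K \<in> P \<rightarrow>\<^sub>M prob_algebra ?N"
  proof (rule measurable_distr_prob_space2)
    show "?O \<in> P \<rightarrow>\<^sub>M prob_algebra (PiM {1..N} (\<lambda>_. borel))"
      by (rule measurable_compose[OF state_measurable obs_law_kernel[OF N]])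
    show "(\<lambda>(p, y). (fst p 0, Y n p, y)) \<in> P \<Otimes>\<^sub>M PiM {1..N} (\<lambda>_. borel) \<rightarrow>\<^sub>M ?N"
      unfolding split_beta'
      by (intro measurable_Pair measurable_compose[OF measurable_fst state_measurable]
        measurable_compose[OF measurable_fst Y_measurable] measurable_snd)
  qed
  have a: "(\<lambda>p. (fst p 0, Y n p, \<lambda>i\<in>{1..N}. h (fst p (n + i)) (snd p (n + i)))) \<in> P \<rightarrow>\<^sub>M ?N"
    by (intro measurable_Pair state_measurable Y_measurable measurable_restrict h_comp noise_component[OF measurable_snd]) simp
  have "(\<integral>p. F (fst p 0, Y n p, \<lambda>i\<in>{1..N}. h (fst p (n + i)) (snd p (n + i))) \<partial>P) = (\<integral>p. \<integral>w. F w \<partial>?K p \<partial>P)"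
  proof (rule integral_kernel_transfer[OF P.prob_space_axioms a K _ F bdd])
    fix f :: "'x \<times> (nat \<Rightarrow> 'y) \<times> (nat \<Rightarrow> 'y) \<Rightarrow> ennreal" assume f: "f \<in> borel_measurable ?N"
    have "(\<integral>\<^sup>+p. f (fst p 0, Y n p, \<lambda>i\<in>{1..N}. h (fst p (n + i)) (snd p (n + i))) \<partial>P) =
      (\<integral>\<^sup>+p. \<integral>\<^sup>+y. f (fst p 0, Y n p, y) \<partial>?O p \<partial>P)"
      by (rule markov_nn_integral[OF N f])
    also have "\<dots> = (\<integral>\<^sup>+p. \<integral>\<^sup>+w. f w \<partial>?K p \<partial>P)"
      by (rule nn_integral_cong, rule nn_integral_distr[OF tup, symmetric]) (simp_all only: measurable_distr_eq1 f)
    finally show "(\<integral>\<^sup>+p. f (fst p 0, Y n p, \<lambda>i\<in>{1..N}. h (fst p (n + i)) (snd p (n + i))) \<partial>P) =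
      (\<integral>\<^sup>+p. \<integral>\<^sup>+w. f w \<partial>?K p \<partial>P)" .
  qed
  also have "\<dots> = (\<integral>p. \<integral>y. F (fst p 0, Y n p, y) \<partial>?O p \<partial>P)"
    by (rule Bochner_Integration.integral_cong[OF refl]) (rule integral_distr[OF tup F])
  finally show ?thesis .
qed

lemma noise_integral:
  fixes F :: "'x \<times> (nat \<Rightarrow> 'y) \<times> 'x \<times> 'y \<Rightarrow> real"
  assumes F: "F \<in> borel_measurable (borel \<Otimes>\<^sub>M PiM {0..n} (\<lambda>_. borel) \<Otimes>\<^sub>M borel \<Otimes>\<^sub>M borel)"
    and bdd: "\<And>w. w \<in> space (borel \<Otimes>\<^sub>M PiM {0..n} (\<lambda>_. borel) \<Otimes>\<^sub>M borel \<Otimes>\<^sub>M borel) \<Longrightarrow> \<bar>F w\<bar> \<le> B"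
  shows "(\<integral>p. F (fst p 0, Y n p, fst p (Suc n), h (fst p (Suc n)) (snd p (Suc n))) \<partial>P) =
    (\<integral>p. \<integral>z. F (fst p 0, Y n p, fst p (Suc n), h (fst p (Suc n)) z) \<partial>Q \<partial>P)"
proof -
  let ?N = "borel \<Otimes>\<^sub>M PiM {0..n} (\<lambda>_. borel) \<Otimes>\<^sub>M borel \<Otimes>\<^sub>M borel :: ('x \<times> (nat \<Rightarrow> 'y) \<times> 'x \<times> 'y) measure"
  let ?t = "\<lambda>p z. (fst p 0, Y n p, fst p (Suc n), h (fst p (Suc n)) z)"
  let ?K = "\<lambda>p. distr Q ?N (?t p)"
  have Q_id: "(\<lambda>z. z) \<in> Q \<rightarrow>\<^sub>M borel" by (rule measurable_ident_sets[OF Q_sets])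
  have tup: "?t p \<in> Q \<rightarrow>\<^sub>M ?N" if "p \<in> space P" for p
    using that by (intro measurable_Pair measurable_const h_comp Q_id measurable_space[OF Y_measurable]) auto
  have K: "?K \<in> P \<rightarrow>\<^sub>M prob_algebra ?N"
  proof (rule measurable_distr_prob_space2)
    show "(\<lambda>p. Q) \<in> P \<rightarrow>\<^sub>M prob_algebra Q"
      using Q_prob by (intro measurable_const) (simp add: space_prob_algebra)
    show "(\<lambda>(p, z). ?t p z) \<in> P \<Otimes>\<^sub>M Q \<rightarrow>\<^sub>M ?N"
      unfolding split_beta'
      by (intro measurable_Pair h_comp measurable_compose[OF measurable_fst state_measurable]
        measurable_compose[OF measurable_fst Y_measurable] measurable_compose[OF measurable_snd Q_id])
  qed
  have a: "(\<lambda>p. ?t p (snd p (Suc n))) \<in> P \<rightarrow>\<^sub>M ?N"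
    by (intro measurable_Pair state_measurable Y_measurable h_comp noise_component[OF measurable_snd]) simp
  have "(\<integral>p. F (?t p (snd p (Suc n))) \<partial>P) = (\<integral>p. \<integral>w. F w \<partial>?K p \<partial>P)"
  proof (rule integral_kernel_transfer[OF P.prob_space_axioms a K _ F bdd])
    fix f :: "'x \<times> (nat \<Rightarrow> 'y) \<times> 'x \<times> 'y \<Rightarrow> ennreal" assume f: "f \<in> borel_measurable ?N"
    have "(\<integral>\<^sup>+p. f (?t p (snd p (Suc n))) \<partial>P) = (\<integral>\<^sup>+p. \<integral>\<^sup>+z. f (?t p z) \<partial>Q \<partial>P)"
      by (rule noise_nn_integral[OF f])
    also have "\<dots> = (\<integral>\<^sup>+p. \<integral>\<^sup>+w. f w \<partial>?K p \<partial>P)"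
      by (rule nn_integral_cong, rule nn_integral_distr[OF tup, symmetric]) (simp_all only: measurable_distr_eq1 f)
    finally show "(\<integral>\<^sup>+p. f (?t p (snd p (Suc n))) \<partial>P) = (\<integral>\<^sup>+p. \<integral>\<^sup>+w. f w \<partial>?K p \<partial>P)" .
  qed
  also have "\<dots> = (\<integral>p. \<integral>z. F (?t p z) \<partial>Q \<partial>P)"
    by (rule Bochner_Integration.integral_cong[OF refl]) (rule integral_distr[OF tup F])
  finally show ?thesis .
qed

end

section \<open>Posterior densities of the initial state\<close>

text \<open>A version of E[R | Y] realized on the observation space, as the density of the image of
  \<open>R dM\<close> with respect to the law of \<open>Y\<close>. As a function of the observations
  it can be evaluated under different laws and at restricted tuples, and bounds valid everywhere
  spare exceptional sets.\<close>

lemma (in prob_space) conditional_density: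
  fixes R :: "'a \<Rightarrow> real"
  assumes Y[measurable]: "Y \<in> M \<rightarrow>\<^sub>M N" and R[measurable]: "R \<in> borel_measurable M"
    and bdd: "\<And>\<omega>. 0 \<le> R \<omega>" "\<And>\<omega>. R \<omega> \<le> K"
  obtains D where "D \<in> borel_measurable N" "\<And>y. 0 \<le> D y" "\<And>y. D y \<le> K"
    "\<And>g :: 'b \<Rightarrow> real. g \<in> borel_measurable N \<Longrightarrow> (\<integral>\<omega>. R \<omega> * g (Y \<omega>) \<partial>M) = (\<integral>\<omega>. D (Y \<omega>) * g (Y \<omega>) \<partial>M)"
proof -
  define L where "L = distr M N Y"
  define V where "V = distr (density M (\<lambda>\<omega>. ennreal (R \<omega>))) N Y"
  have K: "0 \<le> K" using bdd[of undefined] by linarith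
  interpret L: prob_space L unfolding L_def by (rule prob_space_distr[OF Y])
  have [simp, measurable_cong]: "sets L = sets N" "sets V = sets N" by (auto simp: L_def V_def)
  have Yd: "Y \<in> density M (\<lambda>\<omega>. ennreal (R \<omega>)) \<rightarrow>\<^sub>M N" by simp
  have V_eq: "emeasure V A = (\<integral>\<^sup>+\<omega>. ennreal (R \<omega>) * indicator A (Y \<omega>) \<partial>M)" if [measurable]: "A \<in> sets N" for A
  proof -
    have "emeasure V A = (\<integral>\<^sup>+\<omega>. ennreal (R \<omega>) * indicator (Y -` A \<inter> space M) \<omega> \<partial>M)"
      unfolding V_def by (subst emeasure_distr[OF Yd that]) (auto simp: emeasure_density)
    also have "\<dots> = (\<integral>\<^sup>+\<omega>. ennreal (R \<omega>) * indicator A (Y \<omega>) \<partial>M)"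
      by (intro nn_integral_cong) (auto split: split_indicator)
    finally show ?thesis .
  qed
  have L_eq: "emeasure L A = (\<integral>\<^sup>+\<omega>. indicator A (Y \<omega>) \<partial>M)" if [measurable]: "A \<in> sets N" for A
  proof -
    have "emeasure L A = (\<integral>\<^sup>+y. indicator A y \<partial>L)" by simp
    then show ?thesis unfolding L_def by (subst (asm) nn_integral_distr) auto
  qed
  have V_le: "emeasure V A \<le> ennreal K * emeasure L A" if A[measurable]: "A \<in> sets N" for A
    unfolding V_eq[OF A] L_eq[OF A]
    by (subst nn_integral_cmult[symmetric], measurable, rule nn_integral_mono)
      (auto intro!: mult_right_mono ennreal_leI bdd)
  have "absolutely_continuous L V"
    unfolding absolutely_continuous_def
  proof
    fix A assume A: "A \<in> null_sets L"
    then have "emeasure V A \<le> 0" using V_le[of A] by (auto simp: null_sets_def)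
    then show "A \<in> null_sets V" using A by (auto simp: null_sets_def)
  qed
  then obtain D0 where D0[measurable]: "D0 \<in> borel_measurable L" and D0_eq: "density L D0 = V"
    using L.Radon_Nikodym[of V] by auto
  \<comment> \<open>On the set \<open>A\<close> where \<open>D0\<close> exceeds \<open>K\<close>,
    the domination of \<open>V\<close> by \<open>K\<close> times \<open>L\<close> leaves no room for
    the excess: cancelling the finite mass \<open>K * L(A)\<close> shows that its integral
    vanishes.\<close>
  have AE_le: "AE y in L. D0 y \<le> ennreal K"
  proof -
    define A where "A = {y\<in>space L. ennreal K < D0 y}"
    have A: "A \<in> sets L" unfolding A_def by measurable
    have "ennreal K * emeasure L A + (\<integral>\<^sup>+y. (D0 y - ennreal K) * indicator A y \<partial>L) =
        (\<integral>\<^sup>+y. ennreal K * indicator A y + (D0 y - ennreal K) * indicator A y \<partial>L)"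
      using A by (subst nn_integral_add) (auto simp: nn_integral_cmult_indicator)
    also have "\<dots> = (\<integral>\<^sup>+y. D0 y * indicator A y \<partial>L)"
      by (intro nn_integral_cong) (auto simp: A_def distrib_right[symmetric] split: split_indicator intro!: diff_add_cancel_ennreal add.commute)
    also have "\<dots> = emeasure V A" using A by (simp add: D0_eq[symmetric] emeasure_density)
    also have "\<dots> \<le> ennreal K * emeasure L A + 0" using V_le[of A] A by simp
    finally have "(\<integral>\<^sup>+y. (D0 y - ennreal K) * indicator A y \<partial>L) \<le> 0"
      by (rule ennreal_add_left_cancel_le[THEN iffD1, THEN disjE]) 
        (auto simp: ennreal_mult_eq_top_iff L.emeasure_eq_measure)
    then have "AE y in L. (D0 y - ennreal K) * indicator A y = 0"
      using A by (subst (asm) le_zero_eq, subst (asm) nn_integral_0_iff_AE) auto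
    with AE_space show ?thesis
    proof eventually_elim
      fix y assume "y \<in> space L" "(D0 y - ennreal K) * indicator A y = 0"
      then show "D0 y \<le> ennreal K"
        by (cases "y \<in> A") (auto simp: A_def not_less intro: ennreal_minus_eq_0)
    qed
  qed
  \<comment> \<open>A change on a null set only, which makes the upper bound hold at every
    point.\<close>
  define D where "D y = min K (enn2real (D0 y))" for y
  have D[measurable]: "D \<in> borel_measurable N" unfolding D_def using D0 by simp
  have D_nonneg: "0 \<le> D y" for y using K by (simp add: D_def)
  have "density L (\<lambda>y. ennreal (D y)) = V"
    unfolding D0_eq[symmetric]
  proof (rule density_cong)
    show "AE y in L. ennreal (D y) = D0 y"
      using AE_le
    proof eventually_elim
      fix y assume le: "D0 y \<le> ennreal K"
      then have "D0 y < top" using le_less_trans ennreal_less_top by blast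
      then show "ennreal (D y) = D0 y" using le K
        by (cases "D0 y") (auto simp: D_def min_def)
    qed
  qed auto
  then have V: "V = density L (\<lambda>y. ennreal (D y))" by simp
  show thesis
  proof (rule that[of D])
    fix g :: "'b \<Rightarrow> real" assume g[measurable]: "g \<in> borel_measurable N"
    have "(\<integral>\<omega>. R \<omega> * g (Y \<omega>) \<partial>M) = (\<integral>\<omega>. g (Y \<omega>) \<partial>density M (\<lambda>\<omega>. ennreal (R \<omega>)))"
      by (subst integral_density) (auto simp: bdd)
    also have "\<dots> = (\<integral>y. g y \<partial>V)" unfolding V_def by (rule integral_distr[OF Yd g, symmetric])
    also have "\<dots> = (\<integral>y. D y * g y \<partial>L)" unfolding V by (subst integral_density) (auto simp: D_nonneg)
    also have "\<dots> = (\<integral>\<omega>. D (Y \<omega>) * g (Y \<omega>) \<partial>M)" unfolding L_def by (rule integral_distr) auto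
    finally show "(\<integral>\<omega>. R \<omega> * g (Y \<omega>) \<partial>M) = (\<integral>\<omega>. D (Y \<omega>) * g (Y \<omega>) \<partial>M)" .
  qed (auto simp: D_nonneg, simp add: D_def)
qed

text \<open>Nonnegativity of the variance of \<open>\<bar>X\<bar>\<close>.\<close>

lemma (in prob_space) expectation_abs_le_sqrt:
  assumes [measurable]: "X \<in> borel_measurable M" and bdd: "\<And>\<omega>. \<bar>X \<omega>\<bar> \<le> (K::real)"
  shows "expectation (\<lambda>\<omega>. \<bar>X \<omega>\<bar>) \<le> sqrt (expectation (\<lambda>\<omega>. (X \<omega>)\<^sup>2))"
proof (rule real_le_rsqrt)
  have i: "integrable M (\<lambda>\<omega>. \<bar>X \<omega>\<bar>)" using bdd by (intro integrable_const_bound[of _ K]) auto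
  have "\<bar>(X \<omega>)\<^sup>2\<bar> \<le> K\<^sup>2" for \<omega> using bdd[of \<omega>] abs_le_square_iff[of "X \<omega>" K] by auto
  then have i2: "integrable M (\<lambda>\<omega>. \<bar>X \<omega>\<bar>\<^sup>2)" by (intro integrable_const_bound[of _ "K\<^sup>2"]) auto
  show "(expectation (\<lambda>\<omega>. \<bar>X \<omega>\<bar>))\<^sup>2 \<le> expectation (\<lambda>\<omega>. (X \<omega>)\<^sup>2)"
    using variance_eq[OF i i2] variance_positive[of "\<lambda>\<omega>. \<bar>X \<omega>\<bar>"] by simp
qed

context hidden_markov_chain begin

text \<open>\<open>D n (Y n p)\<close> is a version of E^\<nu>[r(X_0) | Y_0, ..., Y_n]. If
  \<open>r\<close> were the density of \<mu> itself, \<open>D n\<close> would be the likelihood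
  ratio of the observation laws under \<mu> and \<nu>.\<close>

definition posterior_density :: "('x \<Rightarrow> real) \<Rightarrow> real \<Rightarrow> (nat \<Rightarrow> (nat \<Rightarrow> 'y) \<Rightarrow> real) \<Rightarrow> bool" where
  "posterior_density r K D \<longleftrightarrow> (\<forall>n. D n \<in> borel_measurable (PiM {0..n} (\<lambda>_. borel)) \<and>
     (\<forall>y. 0 \<le> D n y \<and> D n y \<le> K) \<and>
     (\<forall>g\<in>borel_measurable (PiM {0..n} (\<lambda>_. borel)).
        (\<integral>p. r (fst p 0) * g (Y n p) \<partial>P) = (\<integral>p. D n (Y n p) * g (Y n p) \<partial>P)))"

lemma posterior_densityD:
  assumes "posterior_density r K D"
  shows "D n \<in> borel_measurable (PiM {0..n} (\<lambda>_. borel))" "0 \<le> D n y" "D n y \<le> K"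
    "g \<in> borel_measurable (PiM {0..n} (\<lambda>_. borel)) \<Longrightarrow>
      (\<integral>p. r (fst p 0) * g (Y n p) \<partial>P) = (\<integral>p. D n (Y n p) * g (Y n p) \<partial>P)"
  using assms unfolding posterior_density_def by blast+

lemma posterior_density_exists:
  assumes r[measurable]: "r \<in> borel_measurable borel" and bdd: "\<And>x. 0 \<le> r x" "\<And>x. r x \<le> K"
  obtains D where "posterior_density r K D"
proof -
  have "\<exists>D. D \<in> borel_measurable (PiM {0..n} (\<lambda>_. borel)) \<and> (\<forall>y. 0 \<le> D y \<and> D y \<le> K) \<and>
     (\<forall>g\<in>borel_measurable (PiM {0..n} (\<lambda>_. borel)).
        (\<integral>p. r (fst p 0) * g (Y n p) \<partial>P) = (\<integral>p. D (Y n p) * g (Y n p) \<partial>P))" for n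
  proof -
    have "(\<lambda>p. r (fst p 0)) \<in> borel_measurable P" by (rule measurable_compose[OF state_measurable r])
    then show ?thesis by (rule P.conditional_density[OF Y_measurable _ bdd]) blast
  qed
  then have "\<forall>n. \<exists>D. D \<in> borel_measurable (PiM {0..n} (\<lambda>_. borel)) \<and> (\<forall>y. 0 \<le> D y \<and> D y \<le> K) \<and>
     (\<forall>g\<in>borel_measurable (PiM {0..n} (\<lambda>_. borel)).
        (\<integral>p. r (fst p 0) * g (Y n p) \<partial>P) = (\<integral>p. D (Y n p) * g (Y n p) \<partial>P))" by blast
  from choice[OF this] show thesis using that unfolding posterior_density_def by blast
qed

lemma restrict_Y: "n \<le> m \<Longrightarrow> restrict (Y m p) {0..n} = Y n p"
  by (auto simp: Y_def)

lemma restrict_obs_measurable: "(n::nat) \<le> m \<Longrightarrow> (\<lambda>y. restrict y {0..n}) \<in> PiM {0..m} (\<lambda>_. borel) \<rightarrow>\<^sub>M PiM {0..n} (\<lambda>_. borel)"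
  by (intro measurable_restrict_subset) auto

text \<open>Martingale increments are orthogonal, so the second moments increase, and their differences are
  the squared \<open>L\<^sup>2\<close> distances.\<close>

lemma posterior_density_increments:
  assumes D: "posterior_density r K D"
  shows "(\<lambda>n. \<integral>p. \<bar>D (n + k) (Y (n + k) p) - D n (Y n p)\<bar> \<partial>P) \<longlonglongrightarrow> 0"
proof -
  have D_m[measurable]: "(\<lambda>p. D n (Y n p)) \<in> borel_measurable P" for n
    by (rule measurable_compose[OF Y_measurable posterior_densityD(1)[OF D]])
  have D_b: "\<bar>D n y\<bar> \<le> K" for n y using posterior_densityD(2,3)[OF D, of n y] by linarith
  have K: "0 \<le> K" using D_b[of 0 undefined] by linarith
  have DD: "\<bar>D n y * D m y'\<bar> \<le> K * K" for n m y y'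
    unfolding abs_mult using D_b K by (intro mult_mono) auto
  have int: "integrable P (\<lambda>p. D n (Y n p) * D m (Y m p))" for n m
    using DD by (intro P.integrable_const_bound[of _ "K * K"]) auto
  define a where "a n = (\<integral>p. D n (Y n p) * D n (Y n p) \<partial>P)" for n
  \<comment> \<open>The tower property: \<open>D n\<close>, read as a function of the longer tuple,
    is an admissible test function at time \<open>m\<close>, and at both times the result is the
    integral of r(X_0) times \<open>D n (Y n p)\<close>.\<close>
  have cross: "(\<integral>p. D m (Y m p) * D n (Y n p) \<partial>P) = a n" if "n \<le> m" for n m
  proof -
    have "(\<lambda>y. D n (restrict y {0..n})) \<in> borel_measurable (PiM {0..m} (\<lambda>_. borel))"
      by (rule measurable_compose[OF restrict_obs_measurable[OF that] posterior_densityD(1)[OF D]])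
    from posterior_densityD(4)[OF D this] have
      "(\<integral>p. D m (Y m p) * D n (Y n p) \<partial>P) = (\<integral>p. r (fst p 0) * D n (Y n p) \<partial>P)"
      by (simp add: restrict_Y[OF that])
    also have "\<dots> = a n" unfolding a_def by (rule posterior_densityD(4)[OF D posterior_densityD(1)[OF D]])
    finally show ?thesis .
  qed
  have sq: "(\<integral>p. (D m (Y m p) - D n (Y n p))\<^sup>2 \<partial>P) = a m - a n" if "n \<le> m" for n m
  proof -
    have "(\<integral>p. (D m (Y m p) - D n (Y n p))\<^sup>2 \<partial>P) = (\<integral>p. D m (Y m p) * D m (Y m p) - 2 * (D m (Y m p) * D n (Y n p))
        + D n (Y n p) * D n (Y n p) \<partial>P)"
      by (intro Bochner_Integration.integral_cong) (auto simp: power2_eq_square algebra_simps)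
    also have "\<dots> = a m - 2 * a n + a n"
      using int cross[OF that] by (simp add: a_def)
    finally show ?thesis by simp
  qed
  have "incseq a"
  proof (rule incseq_SucI)
    fix n
    have "0 \<le> (\<integral>p. (D (Suc n) (Y (Suc n) p) - D n (Y n p))\<^sup>2 \<partial>P)" by simp
    then show "a n \<le> a (Suc n)" by (simp add: sq)
  qed
  moreover have "a n \<le> K * K" for n
  proof -
    have "a n \<le> (\<integral>p. K * K \<partial>P)" unfolding a_def
      by (intro integral_mono int) (auto intro: order_trans[OF abs_ge_self DD])
    then show ?thesis by (simp add: P.prob_space)
  qed
  ultimately obtain l where l: "a \<longlonglongrightarrow> l" using incseq_convergent[of a "K * K"] by blast
  have "(\<lambda>n. sqrt (a (n + k) - a n)) \<longlonglongrightarrow> sqrt (l - l)"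
    by (intro tendsto_intros l LIMSEQ_ignore_initial_segment)
  then have lim: "(\<lambda>n. sqrt (a (n + k) - a n)) \<longlonglongrightarrow> 0" by simp
  show ?thesis
  proof (rule tendsto_sandwich[OF _ _ tendsto_const lim])
    show "\<forall>\<^sub>F n in sequentially. 0 \<le> (\<integral>p. \<bar>D (n + k) (Y (n + k) p) - D n (Y n p)\<bar> \<partial>P)" by simp
    show "\<forall>\<^sub>F n in sequentially. (\<integral>p. \<bar>D (n + k) (Y (n + k) p) - D n (Y n p)\<bar> \<partial>P) \<le> sqrt (a (n + k) - a n)"
    proof (rule always_eventually, rule allI)
      fix n
      have "\<bar>D (n + k) (Y (n + k) p) - D n (Y n p)\<bar> \<le> K + K" for p
        using D_b[of "n + k" "Y (n + k) p"] D_b[of n "Y n p"] by linarith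
      from P.expectation_abs_le_sqrt[where X="\<lambda>p. D (n + k) (Y (n + k) p) - D n (Y n p)", OF _ this] show "(\<integral>p. \<bar>D (n + k) (Y (n + k) p) - D n (Y n p)\<bar> \<partial>P) \<le> sqrt (a (n + k) - a n)"
        by (simp add: sq)
    qed
  qed
qed

end

section \<open>Total variation continuous channels\<close>

lemma abs_integral_le_1:
  fixes s :: "'a \<Rightarrow> real"
  assumes "prob_space M" "s \<in> borel_measurable M" "\<And>y. \<bar>s y\<bar> \<le> 1"
  shows "\<bar>\<integral>y. s y \<partial>M\<bar> \<le> 1"
proof -
  interpret prob_space M by fact
  have "\<bar>\<integral>y. s y \<partial>M\<bar> \<le> (\<integral>y. \<bar>s y\<bar> \<partial>M)" by (rule integral_abs_bound)
  also have "\<dots> \<le> (\<integral>y. 1 \<partial>M)" using assms by (intro integral_mono integrable_const_bound[of _ 1]) auto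
  finally show ?thesis by (simp add: prob_space)
qed

context hidden_markov begin

lemma h_section_measurable: "h x \<in> Q \<rightarrow>\<^sub>M borel"
  by (rule h_comp[OF measurable_const measurable_ident_sets[OF Q_sets]]) simp

text \<open>Its members are the conditional expectations of s(Y) f(X) given X = x, for all bounded
  tests \<open>s\<close> at once: the sign to be treated varies with the time and with the past
  observations, so only statements uniform in \<open>s\<close> are of use.\<close>

definition channel_family :: "('x \<Rightarrow> real) \<Rightarrow> ('x \<Rightarrow> real) set" where
  "channel_family f = {\<lambda>x. f x * (\<integral>z. s (h x z) \<partial>Q) | s. s \<in> borel_measurable borel \<and> (\<forall>y. \<bar>s y\<bar> \<le> 1)}"

lemma channel_tv_bound:
  assumes s: "s \<in> borel_measurable borel" "\<And>y. \<bar>s y\<bar> \<le> 1"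
  shows "\<bar>(\<integral>z. s (h x z) \<partial>Q) - (\<integral>z. s (h a z) \<partial>Q)\<bar> \<le> tv_norm (distr Q borel (h x)) (distr Q borel (h a))"
proof -
  let ?D = "\<lambda>x. distr Q borel (h x)"
  have D: "prob_space (?D x)" for x by (rule prob_space.prob_space_distr[OF Q_prob h_section_measurable])
  have "\<bar>(\<integral>y. s y \<partial>?D x) - (\<integral>y. s y \<partial>?D a)\<bar> \<le> tv_norm (?D x) (?D a)"
    unfolding tv_norm_def
  proof (rule cSUP_upper)
    show "s \<in> {g \<in> borel_measurable (?D x). \<forall>y. \<bar>g y\<bar> \<le> 1}" using s by simp
    show "bdd_above ((\<lambda>g :: 'y \<Rightarrow> real. \<bar>(\<integral>y. g y \<partial>?D x) - (\<integral>y. g y \<partial>?D a)\<bar>) ` {g \<in> borel_measurable (?D x). \<forall>y. \<bar>g y\<bar> \<le> 1})"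
    proof (rule bdd_aboveI2)
      fix g :: "'y \<Rightarrow> real" assume "g \<in> {g \<in> borel_measurable (?D x). \<forall>y. \<bar>g y\<bar> \<le> 1}"
      then show "\<bar>(\<integral>y. g y \<partial>?D x) - (\<integral>y. g y \<partial>?D a)\<bar> \<le> 2"
        using abs_integral_le_1[OF D, of g x] abs_integral_le_1[OF D, of g a] by simp
    qed
  qed
  then show ?thesis
    by (simp add: integral_distr[OF h_section_measurable s(1)])
qed

text \<open>The tests \<open>s\<close> are those of the total variation distance, so one modulus of
  continuity serves all of them. First countability turns the hypothesis on sequences into a
  neighbourhood.\<close>

lemma channel_family_equicontinuous:
  assumes tv: "channel_tv_continuous Q h" and f: "continuous_on UNIV f" and C: "\<And>x. \<bar>f x\<bar> \<le> C"
  shows "equicontinuous_family (channel_family f)"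
  unfolding equicontinuous_family_def
proof (intro allI impI)
  fix a and \<epsilon> :: real assume \<epsilon>: "0 < \<epsilon>"
  let ?\<tau> = "\<lambda>x. tv_norm (distr Q borel (h x)) (distr Q borel (h a))"
  have C0: "0 \<le> C" using C[of a] by linarith
  \<comment> \<open>The channel term is multiplied by \<open>\<bar>f a\<bar> \<le> C\<close>; taking
    \<open>C + 1\<close> keeps the denominator positive.\<close>
  have "\<forall>\<^sub>F x in nhds a. ?\<tau> x < \<epsilon> / (2 * (C + 1))"
    unfolding eventually_nhds_iff_sequentially
  proof (intro allI impI)
    fix u assume "u \<longlonglongrightarrow> a"
    then have "(\<lambda>n. ?\<tau> (u n)) \<longlonglongrightarrow> 0" using tv unfolding channel_tv_continuous_def by blast
    then show "\<forall>\<^sub>F n in sequentially. ?\<tau> (u n) < \<epsilon> / (2 * (C + 1))"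
      using \<epsilon> C0 by (intro order_tendstoD(2)) auto
  qed
  moreover have "\<forall>\<^sub>F x in nhds a. \<bar>f x - f a\<bar> < \<epsilon> / 2"
  proof -
    have "(f \<longlongrightarrow> f a) (nhds a)"
      using f by (simp add: continuous_on_eq_continuous_at continuous_at tendsto_nhds_iff)
    then show ?thesis using \<epsilon> tendstoD[of f "f a" "nhds a" "\<epsilon> / 2"] by (simp add: dist_real_def)
  qed
  ultimately have "\<forall>\<^sub>F x in nhds a. ?\<tau> x < \<epsilon> / (2 * (C + 1)) \<and> \<bar>f x - f a\<bar> < \<epsilon> / 2"
    by (rule eventually_conj)
  then obtain U where U: "open U" "a \<in> U" "\<And>x. x \<in> U \<Longrightarrow> ?\<tau> x < \<epsilon> / (2 * (C + 1))" "\<And>x. x \<in> U \<Longrightarrow> \<bar>f x - f a\<bar> < \<epsilon> / 2"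
    unfolding eventually_nhds by blast
  have "\<bar>\<psi> x - \<psi> a\<bar> \<le> \<epsilon>" if x: "x \<in> U" and \<psi>: "\<psi> \<in> channel_family f" for x \<psi>
  proof -
    obtain s where s: "s \<in> borel_measurable borel" "\<And>y. \<bar>s y\<bar> \<le> 1" and \<psi>_eq: "\<psi> = (\<lambda>x. f x * (\<integral>z. s (h x z) \<partial>Q))"
      using \<psi> unfolding channel_family_def by blast
    define q where "q x = (\<integral>z. s (h x z) \<partial>Q)" for x
    have q1: "\<bar>q x\<bar> \<le> 1" for x unfolding q_def
      using s by (intro abs_integral_le_1 Q_prob measurable_compose[OF h_section_measurable]) auto
    have "\<bar>q x - q a\<bar> \<le> \<epsilon> / (2 * (C + 1))"
      using channel_tv_bound[OF s, of x a] U(3)[OF x] by (simp add: q_def)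
    then have "C * \<bar>q x - q a\<bar> \<le> (C + 1) * (\<epsilon> / (2 * (C + 1)))"
      using C0 by (intro mult_mono) auto
    also have "\<dots> = \<epsilon> / 2"
    proof -
      have "c * (\<epsilon> / (2 * c)) = \<epsilon> / 2" if "0 < c" for c using that by simp
      moreover have "0 < C + 1" using C0 by simp
      ultimately show ?thesis .
    qed
    finally have 2: "C * \<bar>q x - q a\<bar> \<le> \<epsilon> / 2" .
    have "\<psi> x - \<psi> a = (f x - f a) * q x + f a * (q x - q a)"
      by (simp add: \<psi>_eq q_def[symmetric] algebra_simps)
    then have "\<bar>\<psi> x - \<psi> a\<bar> \<le> \<bar>f x - f a\<bar> * \<bar>q x\<bar> + \<bar>f a\<bar> * \<bar>q x - q a\<bar>"
      by (metis abs_mult abs_triangle_ineq)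
    also have "\<dots> \<le> \<bar>f x - f a\<bar> * 1 + C * \<bar>q x - q a\<bar>"
      by (intro add_mono mult_left_mono mult_right_mono q1 C) auto
    also have "\<dots> \<le> \<epsilon>" using add_mono[OF less_imp_le[OF U(4)[OF x]] 2] by simp
    finally show ?thesis .
  qed
  with U show "\<exists>U. open U \<and> a \<in> U \<and> (\<forall>x\<in>U. \<forall>\<psi>\<in>channel_family f. \<bar>\<psi> x - \<psi> a\<bar> \<le> \<epsilon>)"
    by blast
qed

lemma channel_family_bounded:
  assumes C: "\<And>x. \<bar>f x\<bar> \<le> C" and \<psi>: "\<psi> \<in> channel_family f"
  shows "\<bar>\<psi> x\<bar> \<le> C"
proof -
  obtain s where s: "s \<in> borel_measurable borel" "\<And>y. \<bar>s y\<bar> \<le> 1" and \<psi>_eq: "\<psi> = (\<lambda>x. f x * (\<integral>z. s (h x z) \<partial>Q))"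
    using \<psi> unfolding channel_family_def by blast
  have "\<bar>\<integral>z. s (h x z) \<partial>Q\<bar> \<le> 1"
    using s by (intro abs_integral_le_1 Q_prob measurable_compose[OF h_section_measurable]) auto
  then have "\<bar>f x\<bar> * \<bar>\<integral>z. s (h x z) \<partial>Q\<bar> \<le> C * 1" using C[of x] by (intro mult_mono) auto
  then show ?thesis by (simp add: \<psi>_eq abs_mult)
qed

text \<open>The real supremum in \<open>observable\<close> controls the individual terms once these
  are known to be bounded above; this is why \<open>f\<close> and the integrals of \<open>g\<close>
  are bounded first.\<close>

lemma observable_reach:
  assumes "observable T Q h"
  obtains N where "1 \<le> N"
    "\<And>f \<epsilon>. continuous_on UNIV f \<Longrightarrow> bounded (range f) \<Longrightarrow> 0 < \<epsilon> \<Longrightarrow>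
      \<exists>B. reach (obs_law_given_X1 T Q h N) (PiM {1..N} (\<lambda>_. borel)) B \<epsilon> f"
proof -
  obtain N :: nat where N: "1 \<le> N" and ob: "\<And>(f :: 'x \<Rightarrow> real) \<epsilon>. continuous_on UNIV f \<Longrightarrow> bounded (range f) \<Longrightarrow> 0 < \<epsilon> \<Longrightarrow>
      \<exists>g :: (nat \<Rightarrow> 'y) \<Rightarrow> real. g \<in> borel_measurable (PiM {1..N} (\<lambda>_. borel)) \<and>
            (\<exists>B. \<forall>y\<in>space (PiM {1..N} (\<lambda>_. (borel::'y measure))). \<bar>g y\<bar> \<le> B) \<and>
            (SUP x. \<bar>f x - (\<integral>y. g y \<partial>obs_law_given_X1 T Q h N x)\<bar>) < \<epsilon>"
    using assms unfolding observable_def by blast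
  show thesis
  proof (rule that[OF N])
    fix f :: "'x \<Rightarrow> real" and \<epsilon> :: real
    assume f: "continuous_on UNIV f" "bounded (range f)" and \<epsilon>: "0 < \<epsilon>"
    let ?O = "obs_law_given_X1 T Q h N"
    obtain g B where g: "g \<in> borel_measurable (PiM {1..N} (\<lambda>_. borel))"
      and B: "\<And>y. y \<in> space (PiM {1..N} (\<lambda>_. (borel::'y measure))) \<Longrightarrow> \<bar>g y\<bar> \<le> B"
      and sup: "(SUP x. \<bar>f x - (\<integral>y. g y \<partial>?O x)\<bar>) < \<epsilon>"
      using ob[OF f \<epsilon>] by blast
    obtain A where A: "\<And>x. \<bar>f x\<bar> \<le> A" using f(2) by (auto simp: bounded_iff)
    have int_le: "\<bar>\<integral>y. g y \<partial>?O x\<bar> \<le> B" for x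
    proof -
      have O: "prob_space (?O x)" "sets (?O x) = sets (PiM {1..N} (\<lambda>_. borel))"
        using measurable_space[OF obs_law_kernel[OF N], of x] by (auto simp: space_prob_algebra)
      interpret O: prob_space "?O x" by (rule O(1))
      have i: "integrable (?O x) g"
        by (rule kernel_integrable_bounded[OF obs_law_kernel[OF N] _ g B]) simp_all
      have "\<bar>\<integral>y. g y \<partial>?O x\<bar> \<le> (\<integral>y. \<bar>g y\<bar> \<partial>?O x)" by (rule integral_abs_bound)
      also have "\<dots> \<le> (\<integral>y. B \<partial>?O x)"
        using i B sets_eq_imp_space_eq[OF O(2)] by (intro integral_mono integrable_abs) auto
      finally show ?thesis by (simp add: O.prob_space)
    qed
    have "\<bar>f x - (\<integral>y. g y \<partial>?O x)\<bar> \<le> A + B" for x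
      using A[of x] int_le[of x] by linarith
    then have "bdd_above (range (\<lambda>x. \<bar>f x - (\<integral>y. g y \<partial>?O x)\<bar>))" by (auto intro!: bdd_aboveI2)
    then have "\<bar>f x - (\<integral>y. g y \<partial>?O x)\<bar> \<le> \<epsilon>" for x
      using cSUP_upper[of x UNIV "\<lambda>x. \<bar>f x - (\<integral>y. g y \<partial>?O x)\<bar>"] sup by fastforce
    then show "\<exists>B. reach ?O (PiM {1..N} (\<lambda>_. borel)) B \<epsilon> f"
      unfolding reach_def using g B by (intro exI[of _ B] bexI[of _ g]) auto
  qed
qed

end

section \<open>Prior weights tested against the current state\<close>

context hidden_markov_chain begin

lemma Y_Suc: "Y (Suc n) p = (\<lambda>i\<in>{0..Suc n}. if i = Suc n then h (fst p (Suc n)) (snd p (Suc n)) else Y n p i)"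
  by (auto simp: Y_def fun_eq_iff)

lemma append_obs_measurable:
  "(\<lambda>(y, y'). \<lambda>i\<in>{0..Suc n}. if i = Suc n then y' else y i)
     \<in> PiM {0..n} (\<lambda>_. borel :: 'y measure) \<Otimes>\<^sub>M borel \<rightarrow>\<^sub>M PiM {0..Suc n} (\<lambda>_. borel)"
  unfolding split_beta'
proof (rule measurable_restrict)
  fix i assume i: "i \<in> {0..Suc n}"
  show "(\<lambda>w. if i = Suc n then snd w else fst w i) \<in> PiM {0..n} (\<lambda>_. borel :: 'y measure) \<Otimes>\<^sub>M borel \<rightarrow>\<^sub>M borel"
    using i by (cases "i = Suc n")
      (auto intro!: measurable_compose[OF measurable_fst measurable_component_singleton])
qed

text \<open>\<open>B\<close> is fixed before \<open>n\<close> and \<open>s\<close>. Once the test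
  function depends on Y_0, ..., Y_(n+N) only, conditioning on these turns r(X_0) into
  \<open>D (n + N)\<close>, so that the weight becomes an increment of the martingale. The first
  term of the bound is the size \<open>K\<close> of the weight times the approximation error, in
  which \<open>t\<close> contributes its mean, at most \<epsilon>.\<close>

proposition weighted_estimate:
  fixes f r :: "'x \<Rightarrow> real"
  assumes tv: "channel_tv_continuous Q h" and N: "1 \<le> N"
    and dense: "\<And>f \<epsilon>. continuous_on UNIV f \<Longrightarrow> bounded (range f) \<Longrightarrow> 0 < \<epsilon> \<Longrightarrow>
      \<exists>B. reach (obs_law_given_X1 T Q h N) (PiM {1..N} (\<lambda>_. borel)) B \<epsilon> f"
    and f: "continuous_on UNIV f" and C: "\<And>x. \<bar>f x\<bar> \<le> C"
    and r: "r \<in> borel_measurable borel" "\<And>x. 0 \<le> r x" "\<And>x. r x \<le> K"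
    and D: "posterior_density r K D" and \<epsilon>: "0 < \<epsilon>"
  obtains B where "\<And>n s. s \<in> borel_measurable (PiM {0..Suc n} (\<lambda>_. borel)) \<Longrightarrow> (\<And>y. \<bar>s y\<bar> \<le> 1) \<Longrightarrow>
    (\<integral>p. (r (fst p 0) - D n (Y n p)) * (s (Y (Suc n) p) * f (fst p (Suc n))) \<partial>P)
      \<le> K * (3 * \<epsilon> + 2 * C * \<epsilon>) + B * (\<integral>p. \<bar>D (n + N) (Y (n + N) p) - D n (Y n p)\<bar> \<partial>P)"
proof -
  have C0: "0 \<le> C" using C[of undefined] by linarith
  have K0: "0 \<le> K" using r(2,3)[of undefined] by linarith
  have f_meas[measurable]: "f \<in> borel_measurable borel" by (rule borel_measurable_continuous_onI[OF f])
  let ?O = "obs_law_given_X1 T Q h N"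
  have fam_le: "\<bar>\<psi> x\<bar> \<le> C" if "\<psi> \<in> channel_family f" for \<psi> x
    by (rule channel_family_bounded[OF C that])
  obtain B where B: "\<And>(A :: (nat \<Rightarrow> 'y) measure) F (\<eta> :: 'x measure). (\<And>y. y \<in> space A \<Longrightarrow> F y \<in> channel_family f) \<Longrightarrow>
      (\<And>x. (\<lambda>y. F y x) \<in> borel_measurable A) \<Longrightarrow> prob_space \<eta> \<Longrightarrow> sets \<eta> = sets borel \<Longrightarrow>
      \<exists>G t. (\<lambda>(y, z). G y z) \<in> borel_measurable (A \<Otimes>\<^sub>M PiM {1..N} (\<lambda>_. borel)) \<and>
        (\<forall>y. \<forall>z\<in>space (PiM {1..N} (\<lambda>_. borel)). \<bar>G y z\<bar> \<le> B) \<and>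
        t \<in> borel_measurable borel \<and> (\<forall>x. 0 \<le> t x \<and> t x \<le> 1) \<and> (\<integral>x. t x \<partial>\<eta>) \<le> \<epsilon> \<and>
        (\<forall>y\<in>space A. \<forall>x. \<bar>F y x - (\<integral>z. G y z \<partial>?O x)\<bar> \<le> 3 * \<epsilon> + 2 * C * t x)"
  proof (rule equicontinuous_approximation[where \<kappa>="?O" and R="PiM {1..N} (\<lambda>_. borel)" and \<F>="channel_family f" and C=C and \<epsilon>=\<epsilon>])
    show "?O \<in> borel \<rightarrow>\<^sub>M prob_algebra (PiM {1..N} (\<lambda>_. borel))" by (rule obs_law_kernel[OF N])
    show "equicontinuous_family (channel_family f)" by (rule channel_family_equicontinuous[OF tv f C])
    show "\<bar>\<psi> x\<bar> \<le> C" if "\<psi> \<in> channel_family f" for \<psi> x by (rule fam_le[OF that])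
  qed (use dense C0 \<epsilon> in blast)+
  show thesis
  proof (rule that)
    fix n and s :: "(nat \<Rightarrow> 'y) \<Rightarrow> real" assume s: "s \<in> borel_measurable (PiM {0..Suc n} (\<lambda>_. borel))" and s1: "\<And>y. \<bar>s y\<bar> \<le> (1::real)"
    let ?A = "PiM {0..n} (\<lambda>_. borel :: 'y measure)"
    define X where "X p = fst p (Suc n)" for p :: "(nat \<Rightarrow> 'x) \<times> (nat \<Rightarrow> 'z)"
    have X[measurable]: "X \<in> P \<rightarrow>\<^sub>M borel" unfolding X_def by (rule state_measurable)
    define W where "W p = r (fst p 0) - D n (Y n p)" for p
    have Dn: "D n \<in> borel_measurable ?A" by (rule posterior_densityD(1)[OF D])
    have Dm: "(\<lambda>p. D m (Y m p)) \<in> borel_measurable P" for m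
      by (rule measurable_compose[OF Y_measurable posterior_densityD(1)[OF D]])
    have rX: "(\<lambda>p. r (fst p 0)) \<in> borel_measurable P" by (rule measurable_compose[OF state_measurable r(1)])
    have W[measurable]: "W \<in> borel_measurable P" unfolding W_def using rX Dm by measurable
    have w_le: "\<bar>r x - D n y\<bar> \<le> K" for x y
      using r(2,3)[of x] posterior_densityD(2,3)[OF D, of n y] by linarith
    have W_le: "\<bar>W p\<bar> \<le> K" for p unfolding W_def by (rule w_le)
    define app where "app y y' = (\<lambda>i\<in>{0..Suc n}. if i = Suc n then y' else y i)" for y :: "nat \<Rightarrow> 'y" and y'
    have app: "(\<lambda>(y, y'). app y y') \<in> ?A \<Otimes>\<^sub>M borel \<rightarrow>\<^sub>M PiM {0..Suc n} (\<lambda>_. borel)"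
      unfolding app_def by (rule append_obs_measurable)
    have s_app: "(\<lambda>(y, y'). s (app y y')) \<in> borel_measurable (?A \<Otimes>\<^sub>M borel)"
      using measurable_compose[OF app s] by (simp add: split_beta')
    have s_app': "(\<lambda>w. s (app (a w) (b w))) \<in> borel_measurable M" if "a \<in> M \<rightarrow>\<^sub>M ?A" "b \<in> M \<rightarrow>\<^sub>M borel" for a b M
      using measurable_compose[OF measurable_Pair[OF that] s_app] by simp
    \<comment> \<open>For a frozen past \<open>y\<close> the sign is a function of the newest
      observation alone, so \<open>F y\<close> lies in the channel family; the past merely selects
      the member.\<close>
    define F where "F y x = f x * (\<integral>z. s (app y (h x z)) \<partial>Q)" for y x
    interpret Q: prob_space Q by (rule Q_prob)
    have Q_id: "(\<lambda>z. z) \<in> Q \<rightarrow>\<^sub>M borel" by (rule measurable_ident_sets[OF Q_sets])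
    have F_in: "F y \<in> channel_family f" if "y \<in> space ?A" for y
      unfolding channel_family_def F_def using s1 s_app'[OF measurable_const[OF that] measurable_ident_sets[OF refl]]
      by (intro CollectI exI[of _ "\<lambda>y'. s (app y y')"]) auto
    have F_pair: "(\<lambda>w. F (a w) (b w)) \<in> borel_measurable M" if "a \<in> M \<rightarrow>\<^sub>M ?A" "b \<in> M \<rightarrow>\<^sub>M borel"
      for a b and M :: "'w measure"
    proof -
      have "(\<lambda>w. \<integral>z. s (app (a w) (h (b w) z)) \<partial>Q) \<in> borel_measurable M"
      proof (rule Q.borel_measurable_lebesgue_integral)
        show "(\<lambda>(w, z). s (app (a w) (h (b w) z))) \<in> borel_measurable (M \<Otimes>\<^sub>M Q)"
          unfolding split_beta'
          by (intro s_app' measurable_compose[OF measurable_fst that(1)] h_comp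
              measurable_compose[OF measurable_fst that(2)] measurable_compose[OF measurable_snd Q_id])
      qed
      then show ?thesis unfolding F_def using measurable_compose[OF that(2) f_meas] by measurable
    qed
    have Xp: "prob_space (distr P borel X)" by (rule P.prob_space_distr[OF X])
    have F_x: "(\<lambda>y. F y x) \<in> borel_measurable ?A" for x
      by (rule F_pair[OF measurable_ident_sets[OF refl] measurable_const]) simp
    \<comment> \<open>The law of X_(n+1) is taken for \<open>\<eta>\<close>. Both \<open>G\<close>
      and \<open>t\<close> vary with \<open>n\<close>, but \<open>B\<close> does not.\<close>
    obtain G t where G: "(\<lambda>(y, z). G y z) \<in> borel_measurable (?A \<Otimes>\<^sub>M PiM {1..N} (\<lambda>_. borel))"
      and G_le: "\<And>y z. z \<in> space (PiM {1..N} (\<lambda>_. borel)) \<Longrightarrow> \<bar>G y z\<bar> \<le> B"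
      and t[measurable]: "t \<in> borel_measurable borel" and t01: "\<And>x. 0 \<le> t x" "\<And>x. t x \<le> 1"
      and t_int: "(\<integral>x. t x \<partial>distr P borel X) \<le> \<epsilon>"
      and FG: "\<And>y x. y \<in> space ?A \<Longrightarrow> \<bar>F y x - (\<integral>z. G y z \<partial>?O x)\<bar> \<le> 3 * \<epsilon> + 2 * C * t x"
      using B[of ?A F "distr P borel X", OF F_in F_x Xp sets_distr] by blast
    have 1: "(\<integral>p. W p * (s (Y (Suc n) p) * f (X p)) \<partial>P) = (\<integral>p. W p * F (Y n p) (X p) \<partial>P)"
    proof -
      let ?F = "\<lambda>w. (r (fst w) - D n (fst (snd w))) * (s (app (fst (snd w)) (snd (snd (snd w)))) * f (fst (snd (snd w))))"
      have "?F \<in> borel_measurable (borel \<Otimes>\<^sub>M ?A \<Otimes>\<^sub>M borel \<Otimes>\<^sub>M borel)"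
        by (intro borel_measurable_times borel_measurable_diff measurable_compose[OF measurable_fst r(1)]
            measurable_compose[OF measurable_compose[OF measurable_snd measurable_fst] Dn]
            s_app'[OF measurable_compose[OF measurable_snd measurable_fst]
              measurable_compose[OF measurable_compose[OF measurable_snd measurable_snd] measurable_snd]]
            measurable_compose[OF measurable_compose[OF measurable_compose[OF measurable_snd measurable_snd] measurable_fst] f_meas])
      moreover have "\<bar>?F w\<bar> \<le> K * (1 * C)" for w
        unfolding abs_mult using w_le s1 C K0 by (intro mult_mono) auto
      ultimately have "(\<integral>p. ?F (fst p 0, Y n p, fst p (Suc n), h (fst p (Suc n)) (snd p (Suc n))) \<partial>P) =
          (\<integral>p. \<integral>z. ?F (fst p 0, Y n p, fst p (Suc n), h (fst p (Suc n)) z) \<partial>Q \<partial>P)"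
        by (rule noise_integral)
      moreover have "s (Y (Suc n) p) = s (app (Y n p) (h (fst p (Suc n)) (snd p (Suc n))))" for p
        unfolding Y_Suc app_def ..
      ultimately show ?thesis
        by (simp add: W_def X_def F_def mult_ac)
    qed
    have WG_eq: "(\<integral>p. W p * (\<integral>z. G (Y n p) z \<partial>?O (X p)) \<partial>P) =
        (\<integral>p. W p * G (Y n p) (\<lambda>i\<in>{1..N}. h (fst p (n + i)) (snd p (n + i))) \<partial>P)"
    proof -
      let ?F = "\<lambda>w. (r (fst w) - D n (fst (snd w))) * G (fst (snd w)) (snd (snd w))"
      have "(\<lambda>w. G (fst (snd w)) (snd (snd w))) \<in> borel_measurable (borel \<Otimes>\<^sub>M ?A \<Otimes>\<^sub>M PiM {1..N} (\<lambda>_. borel))"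
        using measurable_compose[OF measurable_snd G] by (simp add: split_beta')
      then have "?F \<in> borel_measurable (borel \<Otimes>\<^sub>M ?A \<Otimes>\<^sub>M PiM {1..N} (\<lambda>_. borel))"
        by (intro borel_measurable_times borel_measurable_diff measurable_compose[OF measurable_fst r(1)]
            measurable_compose[OF measurable_compose[OF measurable_snd measurable_fst] Dn])
      moreover have "\<bar>?F w\<bar> \<le> K * B" if "w \<in> space (borel \<Otimes>\<^sub>M ?A \<Otimes>\<^sub>M PiM {1..N} (\<lambda>_. borel))" for w
        unfolding abs_mult using that w_le K0 by (intro mult_mono G_le) (auto simp: space_pair_measure)
      ultimately have "(\<integral>p. ?F (fst p 0, Y n p, \<lambda>i\<in>{1..N}. h (fst p (n + i)) (snd p (n + i))) \<partial>P) =
          (\<integral>p. \<integral>y. ?F (fst p 0, Y n p, y) \<partial>?O (fst p (Suc n)) \<partial>P)"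
        by (rule markov_integral[OF N])
      then show ?thesis by (simp add: W_def X_def)
    qed
    define future where "future p = (\<lambda>i\<in>{1..N}. h (fst p (n + i)) (snd p (n + i)))" for p :: "(nat \<Rightarrow> 'x) \<times> (nat \<Rightarrow> 'z)"
    \<comment> \<open>Past and future are two blocks of the tuple Y_0, ..., Y_(n+N), entry
      \<open>i\<close> of the future having index \<open>n + i\<close>. In this form
      \<open>G\<close> is an admissible test function for the posterior density at time n +
      N.\<close>
    define G' where "G' y = G (restrict y {0..n}) (\<lambda>i\<in>{1..N}. y (n + i))" for y
    have G'_Y: "G' (Y (n + N) p) = G (Y n p) (future p)" for p
    proof -
      have "(\<lambda>i\<in>{1..N}. Y (n + N) p (n + i)) = future p" by (auto simp: Y_def future_def)
      then show ?thesis by (simp add: G'_def restrict_Y)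
    qed
    have G': "G' \<in> borel_measurable (PiM {0..n + N} (\<lambda>_. borel))"
    proof -
      have "(\<lambda>y. (restrict y {0..n}, \<lambda>i\<in>{1..N}. y (n + i))) \<in> PiM {0..n + N} (\<lambda>_. borel) \<rightarrow>\<^sub>M ?A \<Otimes>\<^sub>M PiM {1..N} (\<lambda>_. borel)"
        by (intro measurable_Pair restrict_obs_measurable measurable_restrict measurable_component_singleton) auto
      from measurable_compose[OF this G] show ?thesis by (simp add: G'_def[abs_def])
    qed
    have fut_space: "future p \<in> space (PiM {1..N} (\<lambda>_. borel))" for p
      by (simp add: space_PiM future_def)
    have G'm: "(\<lambda>p. G (Y n p) (future p)) \<in> borel_measurable P"
      using measurable_compose[OF Y_measurable G'] by (simp add: G'_Y)
    have G'_le: "\<bar>G (Y n p) (future p)\<bar> \<le> B" for p by (rule G_le[OF fut_space])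
    have Db: "\<bar>D m y\<bar> \<le> K" for m y using posterior_densityD(2,3)[OF D, of m y] by linarith
    have intG: "integrable P (\<lambda>p. u p * G (Y n p) (future p))" if "u \<in> borel_measurable P" "\<And>p. \<bar>u p\<bar> \<le> K" for u
      using that G'm G'_le K0 by (intro P.integrable_const_bound[of _ "K * B"]) (auto simp: abs_mult intro!: mult_mono)
    have r_le: "\<bar>r x\<bar> \<le> K" for x using r(2,3)[of x] by linarith
    have "(\<integral>p. W p * G (Y n p) (future p) \<partial>P) =
        (\<integral>p. r (fst p 0) * G (Y n p) (future p) \<partial>P) - (\<integral>p. D n (Y n p) * G (Y n p) (future p) \<partial>P)"
      unfolding W_def left_diff_distrib using intG[OF rX r_le] intG[OF Dm Db] by (rule Bochner_Integration.integral_diff)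
    also have "(\<integral>p. r (fst p 0) * G (Y n p) (future p) \<partial>P) = (\<integral>p. D (n + N) (Y (n + N) p) * G (Y n p) (future p) \<partial>P)"
      using posterior_densityD(4)[OF D G'] by (simp add: G'_Y)
    also have "\<dots> - (\<integral>p. D n (Y n p) * G (Y n p) (future p) \<partial>P) =
        (\<integral>p. (D (n + N) (Y (n + N) p) - D n (Y n p)) * G (Y n p) (future p) \<partial>P)"
      unfolding left_diff_distrib using intG[OF Dm Db] intG[OF Dm Db] by (rule Bochner_Integration.integral_diff[symmetric])
    also have "\<dots> \<le> (\<integral>p. B * \<bar>D (n + N) (Y (n + N) p) - D n (Y n p)\<bar> \<partial>P)"
    proof (rule integral_mono)
      show "integrable P (\<lambda>p. (D (n + N) (Y (n + N) p) - D n (Y n p)) * G (Y n p) (future p))"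
        unfolding left_diff_distrib using intG[OF Dm Db] intG[OF Dm Db] by (rule Bochner_Integration.integrable_diff)
      have "integrable P (\<lambda>p. D m (Y m p))" for m using Dm Db by (intro P.integrable_const_bound[of _ K]) auto
      then show "integrable P (\<lambda>p. B * \<bar>D (n + N) (Y (n + N) p) - D n (Y n p)\<bar>)" by simp
      show "(D (n + N) (Y (n + N) p) - D n (Y n p)) * G (Y n p) (future p) \<le> B * \<bar>D (n + N) (Y (n + N) p) - D n (Y n p)\<bar>" for p
        using mult_left_mono[OF G'_le[of p] abs_ge_zero[of "D (n + N) (Y (n + N) p) - D n (Y n p)"]]
        unfolding abs_mult[symmetric] by (simp add: mult.commute)
    qed
    finally have 2: "(\<integral>p. W p * G (Y n p) (future p) \<partial>P) \<le> B * (\<integral>p. \<bar>D (n + N) (Y (n + N) p) - D n (Y n p)\<bar> \<partial>P)"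
      by simp
    have I_m: "(\<lambda>p. \<integral>z. G (Y n p) z \<partial>?O (X p)) \<in> borel_measurable P"
      proof (rule kernel_integral_measurable)
      show "(\<lambda>p. ?O (X p)) \<in> P \<rightarrow>\<^sub>M prob_algebra (PiM {1..N} (\<lambda>_. borel))"
        by (rule measurable_compose[OF X obs_law_kernel[OF N]])
      show "(\<lambda>(p, z). G (Y n p) z) \<in> borel_measurable (P \<Otimes>\<^sub>M PiM {1..N} (\<lambda>_. borel))"
        using measurable_compose[OF measurable_Pair[OF measurable_compose[OF measurable_fst Y_measurable] measurable_snd] G]
        by (simp add: split_beta')
    qed
    have 3: "(\<integral>p. W p * F (Y n p) (X p) \<partial>P) - (\<integral>p. W p * (\<integral>z. G (Y n p) z \<partial>?O (X p)) \<partial>P) \<le> K * (3 * \<epsilon> + 2 * C * \<epsilon>)"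
    proof -
      have FW: "integrable P (\<lambda>p. W p * F (Y n p) (X p))"
        using F_pair[OF Y_measurable X] W_le K0 C0 measurable_space[OF Y_measurable]
        by (intro P.integrable_const_bound[of _ "K * C"] AE_I2)
          (auto simp: abs_mult intro!: mult_mono fam_le F_in)
      have GW: "integrable P (\<lambda>p. W p * (\<integral>z. G (Y n p) z \<partial>?O (X p)))"
        proof (rule P.integrable_const_bound[of _ "K * (C + (3 * \<epsilon> + 2 * C))"], rule AE_I2)
        fix p assume "p \<in> space P"
        then have y: "Y n p \<in> space ?A" by (rule measurable_space[OF Y_measurable])
        have "2 * C * t (X p) \<le> 2 * C * 1" using C0 t01 by (intro mult_left_mono) auto
        then have "\<bar>\<integral>z. G (Y n p) z \<partial>?O (X p)\<bar> \<le> C + (3 * \<epsilon> + 2 * C)"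
          using fam_le[OF F_in[OF y], of "X p"] FG[OF y, of "X p"] by linarith
        then show "norm (W p * (\<integral>z. G (Y n p) z \<partial>?O (X p))) \<le> K * (C + (3 * \<epsilon> + 2 * C))"
          unfolding real_norm_def abs_mult using W_le K0 by (intro mult_mono) auto
      qed (use I_m in measurable)
      have tX: "integrable P (\<lambda>p. t (X p))"
        using t01 by (intro P.integrable_const_bound[of _ 1]) auto
      have "(\<integral>p. W p * F (Y n p) (X p) \<partial>P) - (\<integral>p. W p * (\<integral>z. G (Y n p) z \<partial>?O (X p)) \<partial>P) =
          (\<integral>p. W p * F (Y n p) (X p) - W p * (\<integral>z. G (Y n p) z \<partial>?O (X p)) \<partial>P)"
        by (rule Bochner_Integration.integral_diff[OF FW GW, symmetric])
      also have "\<dots> \<le> (\<integral>p. K * (3 * \<epsilon> + 2 * C * t (X p)) \<partial>P)"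
      proof (rule integral_mono)
        show "integrable P (\<lambda>p. W p * F (Y n p) (X p) - W p * (\<integral>z. G (Y n p) z \<partial>?O (X p)))"
          using FW GW by (rule Bochner_Integration.integrable_diff)
        show "integrable P (\<lambda>p. K * (3 * \<epsilon> + 2 * C * t (X p)))" using tX by simp
        fix p assume "p \<in> space P"
        then have y: "Y n p \<in> space ?A" by (rule measurable_space[OF Y_measurable])
        have "W p * F (Y n p) (X p) - W p * (\<integral>z. G (Y n p) z \<partial>?O (X p)) \<le> \<bar>W p\<bar> * \<bar>F (Y n p) (X p) - (\<integral>z. G (Y n p) z \<partial>?O (X p))\<bar>"
          unfolding abs_mult[symmetric] by (simp add: right_diff_distrib)
        also have "\<dots> \<le> K * (3 * \<epsilon> + 2 * C * t (X p))"
          by (intro mult_mono W_le FG[OF y] K0) simp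
        finally show "W p * F (Y n p) (X p) - W p * (\<integral>z. G (Y n p) z \<partial>?O (X p)) \<le> K * (3 * \<epsilon> + 2 * C * t (X p))" .
      qed
      also have "\<dots> = K * (3 * \<epsilon> + 2 * C * (\<integral>p. t (X p) \<partial>P))"
        using tX by (simp add: P.prob_space)
      also have "\<dots> \<le> K * (3 * \<epsilon> + 2 * C * \<epsilon>)"
        using t_int K0 C0 by (intro mult_left_mono add_left_mono) (auto simp: integral_distr)
      finally show ?thesis .
    qed
    show "(\<integral>p. (r (fst p 0) - D n (Y n p)) * (s (Y (Suc n) p) * f (fst p (Suc n))) \<partial>P)
      \<le> K * (3 * \<epsilon> + 2 * C * \<epsilon>) + B * (\<integral>p. \<bar>D (n + N) (Y (n + N) p) - D n (Y n p)\<bar> \<partial>P)"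
      using 1 2 3 WG_eq unfolding W_def X_def future_def by linarith
  qed
qed

end

section \<open>Change of the initial law\<close>

text \<open>Since \<open>s\<close> is measurable for \<open>F\<close>, \<open>U\<close> may be
  replaced by \<phi> under \<open>M\<close>, and the left side becomes the integral of \<rho> s
  (\<phi> - V) under \<open>L\<close>. Replacing \<rho> by \<open>r\<close> in both terms costs the
  constant \<open>2 * C\<close>. In the term with \<open>V\<close>, which is measurable for
  \<open>F\<close>, \<open>r\<close> may be replaced by its conditional expectation
  \<open>d\<close>, and at the cost of the last summand by \<open>d'\<close>; finally
  \<open>V\<close> is turned back into \<phi>, because \<open>d'\<close> and \<open>s\<close> are
  measurable for \<open>F\<close>.\<close>

lemma cond_exp_change_of_measure:
  fixes \<rho> r d d' \<phi> :: "'a \<Rightarrow> real"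
  assumes L: "prob_space L" and M: "prob_space M" and M_eq: "M = density L (\<lambda>w. ennreal (\<rho> w))"
    and F: "subalgebra L F"
    and \<rho>[measurable]: "\<rho> \<in> borel_measurable L" and \<rho>0: "\<And>w. 0 \<le> \<rho> w"
    and \<phi>[measurable]: "\<phi> \<in> borel_measurable L" and C: "\<And>w. \<bar>\<phi> w\<bar> \<le> C"
    and r[measurable]: "r \<in> borel_measurable L" and rK: "\<And>w. \<bar>r w\<bar> \<le> K"
    and d: "d \<in> borel_measurable F" and dK: "\<And>w. \<bar>d w\<bar> \<le> K"
    and d': "d' \<in> borel_measurable F" and dK': "\<And>w. \<bar>d' w\<bar> \<le> K"
    and d_eq: "\<And>A. A \<in> sets F \<Longrightarrow> (\<integral>w\<in>A. r w \<partial>L) = (\<integral>w\<in>A. d w \<partial>L)"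
  defines "U \<equiv> real_cond_exp M F \<phi>" and "V \<equiv> real_cond_exp L F \<phi>"
  defines "s \<equiv> \<lambda>w. if V w < U w then 1 else - 1"
  shows "(\<integral>w. \<bar>U w - V w\<bar> \<partial>M) \<le> (\<integral>w. (r w - d' w) * (s w * \<phi> w) \<partial>L)
    + 2 * C * (\<integral>w. \<bar>\<rho> w - r w\<bar> \<partial>L) + C * (\<integral>w. \<bar>d w - d' w\<bar> \<partial>L)"
proof -
  interpret L: prob_space L by (rule L)
  interpret M: prob_space M by (rule M)
  have FM: "subalgebra M F" using F by (simp add: subalgebra_def M_eq)
  interpret LF: finite_measure_subalgebra L F by unfold_locales (rule F)
  interpret MF: finite_measure_subalgebra M F by unfold_locales (rule FM)
  have [measurable_cong]: "sets M = sets L" by (simp add: M_eq)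
  have C0: "0 \<le> C" using C[of undefined] by linarith
  note d_L[measurable] = measurable_from_subalg[OF F d]
  note d'_L[measurable] = measurable_from_subalg[OF F d']
  have UF[measurable]: "U \<in> borel_measurable F" and VF[measurable]: "V \<in> borel_measurable F" by (simp_all add: U_def V_def)
  have UL[measurable]: "U \<in> borel_measurable L" and VL[measurable]: "V \<in> borel_measurable L"
    using measurable_from_subalg[OF F] UF VF by blast+
  have sF: "s \<in> borel_measurable F" unfolding s_def by measurable
  note sL[measurable] = measurable_from_subalg[OF F sF]
  have s1: "\<bar>s w\<bar> = 1" for w by (simp add: s_def)
  have \<phi>L: "integrable L \<phi>" using C by (intro L.integrable_const_bound[of _ C]) auto
  have rho_int: "integrable L \<rho>"
  proof (rule integrableI_nonneg)
    have "emeasure M (space M) = (\<integral>\<^sup>+w. ennreal (\<rho> w) \<partial>L)"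
      by (simp add: M_eq emeasure_density cong: nn_integral_cong)
    then show "(\<integral>\<^sup>+w. ennreal (\<rho> w) \<partial>L) < \<infinity>" by (simp add: M.emeasure_space_1)
  qed (auto simp: \<rho>0)
  have r_int: "integrable L r" using rK by (intro L.integrable_const_bound[of _ K]) auto
  have d_int: "integrable L d" using dK by (intro L.integrable_const_bound[of _ K]) auto
  have d'_int: "integrable L d'" using dK' by (intro L.integrable_const_bound[of _ K]) auto
  have Vb: "AE w in L. \<bar>V w\<bar> \<le> C"
  proof -
    have "AE w in L. V w \<le> C" unfolding V_def using C
      by (intro LF.real_cond_exp_le_c \<phi>L AE_I2) (auto simp: abs_le_iff)
    moreover have "AE w in L. - C \<le> V w" unfolding V_def using C
      by (intro LF.real_cond_exp_ge_c \<phi>L AE_I2) (metis abs_le_iff minus_le_iff)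
    ultimately show ?thesis by eventually_elim linarith
  qed
  then have VbM: "AE w in M. \<bar>V w\<bar> \<le> C"
    unfolding M_eq by (subst AE_density) auto
  have sub: "\<bar>\<integral>w. u w * g w \<partial>L\<bar> \<le> C * (\<integral>w. \<bar>u w\<bar> \<partial>L)" and sub_int: "integrable L (\<lambda>w. u w * g w)"
    if u: "integrable L u" and g[measurable]: "g \<in> borel_measurable L" and gC: "AE w in L. \<bar>g w\<bar> \<le> C" for u g
  proof -
    have uC: "integrable L (\<lambda>w. C * \<bar>u w\<bar>)" using u by simp
    have le: "AE w in L. \<bar>u w * g w\<bar> \<le> C * \<bar>u w\<bar>"
      using gC by eventually_elim (simp add: abs_mult mult.commute[of "\<bar>u _\<bar>"] mult_right_mono)
    show i: "integrable L (\<lambda>w. u w * g w)"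
      by (rule Bochner_Integration.integrable_bound[OF uC]) (use u le C0 in auto)
    have "\<bar>\<integral>w. u w * g w \<partial>L\<bar> \<le> (\<integral>w. \<bar>u w * g w\<bar> \<partial>L)" by (rule integral_abs_bound)
    also have "\<dots> \<le> (\<integral>w. C * \<bar>u w\<bar> \<partial>L)"
      using i uC le by (intro integral_mono_AE) auto
    finally show "\<bar>\<integral>w. u w * g w \<partial>L\<bar> \<le> C * (\<integral>w. \<bar>u w\<bar> \<partial>L)" by simp
  qed
  have s\<phi>: "(\<lambda>w. s w * \<phi> w) \<in> borel_measurable L" "AE w in L. \<bar>s w * \<phi> w\<bar> \<le> C"
    using C by (auto simp: abs_mult s1)
  have sV: "(\<lambda>w. s w * V w) \<in> borel_measurable L" "AE w in L. \<bar>s w * V w\<bar> \<le> C"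
    using Vb by (auto simp: abs_mult s1)
  have s\<phi>M: "integrable M (\<lambda>w. s w * \<phi> w)"
    using C by (intro M.integrable_const_bound[of _ C]) (auto simp: abs_mult s1)
  have sUM: "integrable M (\<lambda>w. s w * U w)" "(\<integral>w. s w * U w \<partial>M) = (\<integral>w. s w * \<phi> w \<partial>M)"
    unfolding U_def using MF.real_cond_exp_intg[OF s\<phi>M sF] by auto
  have sVM: "integrable M (\<lambda>w. s w * V w)"
    using VbM by (intro M.integrable_const_bound[of _ C]) (auto simp: abs_mult s1)
  have dens: "(\<integral>w. g w \<partial>M) = (\<integral>w. \<rho> w * g w \<partial>L)" if "g \<in> borel_measurable L" for g
    unfolding M_eq using that by (subst integral_density) (auto simp: \<rho>0)
  \<comment> \<open>At ties \<open>s\<close> is -1, which is harmless since \<open>U w - V w\<close>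
    vanishes there.\<close>
  have "(\<integral>w. \<bar>U w - V w\<bar> \<partial>M) = (\<integral>w. s w * U w - s w * V w \<partial>M)"
    by (intro Bochner_Integration.integral_cong) (auto simp: s_def)
  also have "\<dots> = (\<integral>w. s w * \<phi> w \<partial>M) - (\<integral>w. s w * V w \<partial>M)"
    using Bochner_Integration.integral_diff[OF sUM(1) sVM] sUM(2) by simp
  also have "\<dots> = (\<integral>w. \<rho> w * (s w * \<phi> w) \<partial>L) - (\<integral>w. \<rho> w * (s w * V w) \<partial>L)"
    by (simp only: dens[OF s\<phi>(1)] dens[OF sV(1)])
  finally have 1: "(\<integral>w. \<bar>U w - V w\<bar> \<partial>M) = (\<integral>w. \<rho> w * (s w * \<phi> w) \<partial>L) - (\<integral>w. \<rho> w * (s w * V w) \<partial>L)" .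
  have diff: "\<bar>(\<integral>w. u w * g w \<partial>L) - (\<integral>w. v w * g w \<partial>L)\<bar> \<le> C * (\<integral>w. \<bar>u w - v w\<bar> \<partial>L)"
    if "integrable L u" "integrable L v" "g \<in> borel_measurable L" "AE w in L. \<bar>g w\<bar> \<le> C" for u v g
  proof -
    have "(\<integral>w. u w * g w \<partial>L) - (\<integral>w. v w * g w \<partial>L) = (\<integral>w. (u w - v w) * g w \<partial>L)"
      unfolding left_diff_distrib
      by (rule Bochner_Integration.integral_diff[symmetric]) (intro sub_int that)+
    then show ?thesis using sub[of "\<lambda>w. u w - v w" g] that by simp
  qed
  note 2 = diff[OF rho_int r_int s\<phi>] and 3 = diff[OF rho_int r_int sV] and 4 = diff[OF d_int d'_int sV]
  have "AE w in L. real_cond_exp L F r w = d w"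
    by (rule LF.real_cond_exp_charact[OF d_eq r_int d_int d])
  then have "(\<integral>w. (s w * V w) * real_cond_exp L F r w \<partial>L) = (\<integral>w. d w * (s w * V w) \<partial>L)"
    by (intro integral_cong_AE) (auto simp: mult.commute)
  moreover have "(\<integral>w. (s w * V w) * real_cond_exp L F r w \<partial>L) = (\<integral>w. (s w * V w) * r w \<partial>L)"
    by (rule LF.real_cond_exp_intg(2)) (use sub_int[OF r_int sV] sF VF in \<open>auto simp: mult.commute\<close>)
  ultimately have 5: "(\<integral>w. r w * (s w * V w) \<partial>L) = (\<integral>w. d w * (s w * V w) \<partial>L)"
    by (simp add: mult.commute)
  have "(\<integral>w. (d' w * s w) * V w \<partial>L) = (\<integral>w. (d' w * s w) * \<phi> w \<partial>L)"
    unfolding V_def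
    by (rule LF.real_cond_exp_intg(2)) (use sub_int[OF d'_int s\<phi>] sF d' in \<open>auto simp: mult.assoc\<close>)
  then have 6: "(\<integral>w. d' w * (s w * V w) \<partial>L) = (\<integral>w. d' w * (s w * \<phi> w) \<partial>L)"
    by (simp add: mult.assoc)
  have 7: "(\<integral>w. (r w - d' w) * (s w * \<phi> w) \<partial>L) = (\<integral>w. r w * (s w * \<phi> w) \<partial>L) - (\<integral>w. d' w * (s w * \<phi> w) \<partial>L)"
    unfolding left_diff_distrib using sub_int[OF r_int s\<phi>] sub_int[OF d'_int s\<phi>]
    by (rule Bochner_Integration.integral_diff)
  show ?thesis using 1 2 3 4 5 6 7 by linarith
qed

section \<open>Densities of path laws\<close>

context hidden_markov begin

text \<open>The two laws share their transitions and differ in the initial state only. A transition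
  leaves entry \<open>s\<close> of the path unchanged, so the density passes through it as a
  constant factor.\<close>

lemma nn_integral_state_law_density:
  fixes \<rho> :: "'x \<Rightarrow> ennreal"
  assumes \<nu>: "\<nu> \<in> space (prob_algebra borel)" and \<mu>: "\<mu> \<in> space (prob_algebra borel)"
    and \<mu>_eq: "\<mu> = density \<nu> \<rho>" and \<rho>: "\<rho> \<in> borel_measurable borel"
    and F: "F \<in> borel_measurable (PiM {s..s + k} (\<lambda>_. borel))"
  shows "(\<integral>\<^sup>+\<omega>. F \<omega> \<partial>state_law T s \<mu> k) = (\<integral>\<^sup>+\<omega>. \<rho> (\<omega> s) * F \<omega> \<partial>state_law T s \<nu> k)"
  using F
proof (induction k arbitrary: F)
  case 0
  have sets: "sets \<nu> = sets borel" "sets \<mu> = sets borel" using \<nu> \<mu> by (auto simp: space_prob_algebra)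
  have c: "(\<lambda>x::'x. \<lambda>i\<in>{s..s}. x) \<in> borel \<rightarrow>\<^sub>M PiM {s..s} (\<lambda>_. borel)"
    by (rule measurable_restrict) simp
  have c': "(\<lambda>x::'x. \<lambda>i\<in>{s..s}. x) \<in> \<nu> \<rightarrow>\<^sub>M PiM {s..s} (\<lambda>_. borel)" "(\<lambda>x::'x. \<lambda>i\<in>{s..s}. x) \<in> \<mu> \<rightarrow>\<^sub>M PiM {s..s} (\<lambda>_. borel)"
    using c by (simp_all only: measurable_cong_sets[OF sets(1) refl] measurable_cong_sets[OF sets(2) refl])
  have F: "F \<in> borel_measurable (PiM {s..s} (\<lambda>_. borel))" using 0 by simp
  have Fc: "(\<lambda>x. F (\<lambda>i\<in>{s..s}. x)) \<in> borel_measurable \<nu>" by (rule measurable_compose[OF c'(1) F])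
  have \<rho>\<nu>: "\<rho> \<in> borel_measurable \<nu>" using \<rho> sets by (simp cong: measurable_cong_sets)
  have "(\<lambda>\<omega>. \<rho> (\<omega> s)) \<in> borel_measurable (PiM {s..s} (\<lambda>_. borel))"
    by (rule measurable_compose[OF _ \<rho>], rule measurable_component_singleton) simp
  then have \<rho>F: "(\<lambda>\<omega>. \<rho> (\<omega> s) * F \<omega>) \<in> borel_measurable (PiM {s..s} (\<lambda>_. borel))"
    using F by (rule borel_measurable_times_ennreal)
  have "(\<integral>\<^sup>+\<omega>. F \<omega> \<partial>state_law T s \<mu> 0) = (\<integral>\<^sup>+x. F (\<lambda>i\<in>{s..s}. x) \<partial>\<mu>)"
    unfolding state_law.simps by (rule nn_integral_distr[OF c'(2)]) (simp only: measurable_distr_eq1 F)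
  also have "\<dots> = (\<integral>\<^sup>+x. \<rho> x * F (\<lambda>i\<in>{s..s}. x) \<partial>\<nu>)"
    unfolding \<mu>_eq by (rule nn_integral_density[OF \<rho>\<nu> Fc])
  also have "\<dots> = (\<integral>\<^sup>+\<omega>. \<rho> (\<omega> s) * F \<omega> \<partial>state_law T s \<nu> 0)"
    unfolding state_law.simps by (subst nn_integral_distr[OF c'(1)]) (simp_all only: measurable_distr_eq1 \<rho>F, simp)
  finally show ?case .
next
  case (Suc k)
  let ?step = "\<lambda>\<omega>. distr (T (\<omega> (s + k))) (PiM {s..s + Suc k} (\<lambda>_. borel))
        (\<lambda>x'. \<lambda>i\<in>{s..s + Suc k}. if i = s + Suc k then x' else \<omega> i)"
  have step: "?step \<in> PiM {s..s + k} (\<lambda>_. borel) \<rightarrow>\<^sub>M subprob_algebra (PiM {s..s + Suc k} (\<lambda>_. borel))"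
    by (rule measurable_prob_algebraD[OF state_step])
  have step_law: "?step \<in> state_law T s \<eta> k \<rightarrow>\<^sub>M subprob_algebra (PiM {s..s + Suc k} (\<lambda>_. borel))"
    if "\<eta> \<in> space (prob_algebra borel)" for \<eta>
    using step by (simp only: measurable_cong_sets[OF state_law_prob(2)[OF that] refl])
  have F': "(\<lambda>\<omega>. \<integral>\<^sup>+w. F w \<partial>?step \<omega>) \<in> borel_measurable (PiM {s..s + k} (\<lambda>_. borel))"
    by (rule measurable_compose[OF step nn_integral_measurable_subprob_algebra[OF Suc.prems]])
  have "(\<lambda>\<omega>. \<rho> (\<omega> s)) \<in> borel_measurable (PiM {s..s + Suc k} (\<lambda>_. borel))"
    by (rule measurable_compose[OF _ \<rho>], rule measurable_component_singleton) simp
  then have \<rho>F: "(\<lambda>\<omega>. \<rho> (\<omega> s) * F \<omega>) \<in> borel_measurable (PiM {s..s + Suc k} (\<lambda>_. borel))"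
    using Suc.prems by (rule borel_measurable_times_ennreal)
  have "(\<integral>\<^sup>+\<omega>. F \<omega> \<partial>state_law T s \<mu> (Suc k)) = (\<integral>\<^sup>+\<omega>. \<integral>\<^sup>+w. F w \<partial>?step \<omega> \<partial>state_law T s \<mu> k)"
    unfolding state_law.simps by (rule nn_integral_bind[OF Suc.prems step_law[OF \<mu>]])
  also have "\<dots> = (\<integral>\<^sup>+\<omega>. \<rho> (\<omega> s) * (\<integral>\<^sup>+w. F w \<partial>?step \<omega>) \<partial>state_law T s \<nu> k)"
    by (rule Suc.IH[OF F'])
  also have "\<dots> = (\<integral>\<^sup>+\<omega>. \<integral>\<^sup>+w. \<rho> (w s) * F w \<partial>?step \<omega> \<partial>state_law T s \<nu> k)"
  proof (rule nn_integral_cong)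
    fix \<omega> assume "\<omega> \<in> space (state_law T s \<nu> k)"
    then have \<omega>: "\<omega> \<in> space (PiM {s..s + k} (\<lambda>_. borel))" using state_law_prob(3)[OF \<nu>] by simp
    have sT: "sets (T x) = sets borel" for x
      using measurable_space[OF T_kernel, of x] by (simp add: space_prob_algebra)
    have m1: "(\<lambda>x'. \<lambda>i\<in>{s..s + Suc k}. if i = s + Suc k then x' else \<omega> i)
        \<in> T (\<omega> (s + k)) \<rightarrow>\<^sub>M PiM {s..s + Suc k} (\<lambda>_. borel)"
    proof (rule measurable_restrict)
      show "(\<lambda>x'. if i = s + Suc k then x' else \<omega> i) \<in> T (\<omega> (s + k)) \<rightarrow>\<^sub>M borel" for i
        by (cases "i = s + Suc k") (auto intro!: measurable_ident_sets sT)
    qed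
    note e1 = nn_integral_distr[OF m1, unfolded measurable_distr_eq1, OF Suc.prems]
    note e2 = nn_integral_distr[OF m1, unfolded measurable_distr_eq1, OF \<rho>F]
    have Fm: "(\<lambda>x'. F (\<lambda>i\<in>{s..s + Suc k}. if i = s + Suc k then x' else \<omega> i)) \<in> borel_measurable (T (\<omega> (s + k)))"
      by (rule measurable_compose[OF m1 Suc.prems])
    show "\<rho> (\<omega> s) * (\<integral>\<^sup>+w. F w \<partial>?step \<omega>) = (\<integral>\<^sup>+w. \<rho> (w s) * F w \<partial>?step \<omega>)"
      unfolding e1 e2 nn_integral_cmult[OF Fm, symmetric] by simp
  qed
  also have "\<dots> = (\<integral>\<^sup>+\<omega>. \<rho> (\<omega> s) * F \<omega> \<partial>state_law T s \<nu> (Suc k))"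
    unfolding state_law.simps by (rule nn_integral_bind[OF \<rho>F step_law[OF \<nu>], symmetric])
  finally show ?case .
qed

lemma sets_path_law: "\<nu> \<in> space (prob_algebra borel) \<Longrightarrow>
    sets (path_law T Q h \<nu> n) = sets (PiM {0..n} (\<lambda>_. borel) \<Otimes>\<^sub>M PiM {0..n} (\<lambda>_. borel))"
  unfolding path_law_def by (simp only: joint_law_eq sets_distr add_0)

lemma
  assumes \<nu>: "\<nu> \<in> space (prob_algebra borel)"
  shows prob_space_path_law: "prob_space (path_law T Q h \<nu> n)"
    and nn_integral_path_law: "F \<in> borel_measurable (PiM {0..n} (\<lambda>_. borel) \<Otimes>\<^sub>M PiM {0..n} (\<lambda>_. borel)) \<Longrightarrow>
      (\<integral>\<^sup>+w. F w \<partial>path_law T Q h \<nu> n) =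
        (\<integral>\<^sup>+\<omega>. \<integral>\<^sup>+z. F (\<omega>, \<lambda>i\<in>{0..n}. h (\<omega> i) (z i)) \<partial>noise \<partial>state_law T 0 \<nu> n)"
proof -
  interpret noise: prob_space noise by (rule prob_space_noise)
  note S = state_law_prob[OF \<nu>, of 0 n, simplified]
  let ?f = "\<lambda>(\<omega>, z). (\<omega>, \<lambda>i\<in>{0..n}. h (\<omega> i) (z i))"
  have eq: "path_law T Q h \<nu> n = distr (state_law T 0 \<nu> n \<Otimes>\<^sub>M noise) (PiM {0..n} (\<lambda>_. borel) \<Otimes>\<^sub>M PiM {0..n} (\<lambda>_. borel)) ?f"
    unfolding path_law_def joint_law_eq[OF \<nu>] by simp
  have fst_m: "fst \<in> state_law T 0 \<nu> n \<Otimes>\<^sub>M noise \<rightarrow>\<^sub>M PiM {0..n} (\<lambda>_. borel)"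
    by (rule measurable_compose[OF measurable_fst measurable_ident_sets[OF S(2)]])
  have m: "?f \<in> state_law T 0 \<nu> n \<Otimes>\<^sub>M noise \<rightarrow>\<^sub>M PiM {0..n} (\<lambda>_. borel) \<Otimes>\<^sub>M PiM {0..n} (\<lambda>_. borel)"
    unfolding split_beta'
    by (intro measurable_Pair fst_m obs_restrict_measurable[OF fst_m measurable_snd])
  show "prob_space (path_law T Q h \<nu> n)"
    unfolding eq by (rule prob_space.prob_space_distr[OF prob_space_pair[OF S(1) prob_space_noise] m])
  assume F: "F \<in> borel_measurable (PiM {0..n} (\<lambda>_. borel) \<Otimes>\<^sub>M PiM {0..n} (\<lambda>_. borel))"
  show "(\<integral>\<^sup>+w. F w \<partial>path_law T Q h \<nu> n) =
        (\<integral>\<^sup>+\<omega>. \<integral>\<^sup>+z. F (\<omega>, \<lambda>i\<in>{0..n}. h (\<omega> i) (z i)) \<partial>noise \<partial>state_law T 0 \<nu> n)"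
    unfolding eq nn_integral_distr[OF m, unfolded measurable_distr_eq1, OF F]
    using noise.nn_integral_fst[OF measurable_compose[OF m F], symmetric] by (simp only: split)
qed

lemma path_law_density:
  fixes \<rho> :: "'x \<Rightarrow> ennreal"
  assumes \<nu>: "\<nu> \<in> space (prob_algebra borel)" and \<mu>: "\<mu> \<in> space (prob_algebra borel)"
    and \<mu>_eq: "\<mu> = density \<nu> \<rho>" and \<rho>: "\<rho> \<in> borel_measurable borel"
  shows "path_law T Q h \<mu> n = density (path_law T Q h \<nu> n) (\<lambda>w. \<rho> (fst w 0))"
proof (rule measure_eqI)
  interpret noise: prob_space noise by (rule prob_space_noise)
  let ?N = "PiM {0..n} (\<lambda>_. borel) \<Otimes>\<^sub>M PiM {0..n} (\<lambda>_. borel) :: ((nat \<Rightarrow> 'x) \<times> (nat \<Rightarrow> 'y)) measure"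
  show "sets (path_law T Q h \<mu> n) = sets (density (path_law T Q h \<nu> n) (\<lambda>w. \<rho> (fst w 0)))"
    by (simp add: sets_path_law \<mu> \<nu>)
  fix A assume "A \<in> sets (path_law T Q h \<mu> n)"
  then have A: "A \<in> sets ?N" by (simp add: sets_path_law \<mu>)
  have ind: "indicator A \<in> borel_measurable ?N" using A by simp
  have \<rho>0: "(\<lambda>w. \<rho> (fst w 0)) \<in> borel_measurable ?N"
    by (rule measurable_compose[OF _ \<rho>], rule measurable_compose[OF measurable_fst], rule measurable_component_singleton) simp
  have pair: "(\<lambda>(\<omega>, z). indicator A (\<omega>, \<lambda>i\<in>{0..n}. h (\<omega> i) (z i)) :: ennreal)
      \<in> borel_measurable (PiM {0..n} (\<lambda>_. borel) \<Otimes>\<^sub>M noise)"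
    unfolding split_beta'
    by (intro measurable_compose[OF _ ind] measurable_Pair measurable_fst obs_restrict_measurable[OF measurable_fst measurable_snd])
  have inner: "(\<lambda>\<omega>. \<integral>\<^sup>+z. indicator A (\<omega>, \<lambda>i\<in>{0..n}. h (\<omega> i) (z i)) \<partial>noise) \<in> borel_measurable (PiM {0..0 + n} (\<lambda>_. borel))"
    using noise.borel_measurable_nn_integral[OF pair] by simp
  have "emeasure (path_law T Q h \<mu> n) A = (\<integral>\<^sup>+w. indicator A w \<partial>path_law T Q h \<mu> n)"
    using A by (simp add: sets_path_law \<mu>)
  also have "\<dots> = (\<integral>\<^sup>+\<omega>. \<integral>\<^sup>+z. indicator A (\<omega>, \<lambda>i\<in>{0..n}. h (\<omega> i) (z i)) \<partial>noise \<partial>state_law T 0 \<mu> n)"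
    by (rule nn_integral_path_law[OF \<mu> ind])
  also have "\<dots> = (\<integral>\<^sup>+\<omega>. \<rho> (\<omega> 0) * (\<integral>\<^sup>+z. indicator A (\<omega>, \<lambda>i\<in>{0..n}. h (\<omega> i) (z i)) \<partial>noise) \<partial>state_law T 0 \<nu> n)"
    by (rule nn_integral_state_law_density[OF \<nu> \<mu> \<mu>_eq \<rho> inner])
  also have "\<dots> = (\<integral>\<^sup>+\<omega>. \<integral>\<^sup>+z. \<rho> (\<omega> 0) * indicator A (\<omega>, \<lambda>i\<in>{0..n}. h (\<omega> i) (z i)) \<partial>noise \<partial>state_law T 0 \<nu> n)"
  proof (rule nn_integral_cong)
    fix \<omega> assume "\<omega> \<in> space (state_law T 0 \<nu> n)"
    then have \<omega>: "\<omega> \<in> space (PiM {0..n} (\<lambda>_. borel))" using state_law_prob(3)[OF \<nu>, of 0 n] by simp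
    have "(\<lambda>z. indicator A (\<omega>, \<lambda>i\<in>{0..n}. h (\<omega> i) (z i)) :: ennreal) \<in> borel_measurable noise"
      using measurable_compose[OF measurable_Pair1'[OF \<omega>] pair] by simp
    then show "\<rho> (\<omega> 0) * (\<integral>\<^sup>+z. indicator A (\<omega>, \<lambda>i\<in>{0..n}. h (\<omega> i) (z i)) \<partial>noise) =
        (\<integral>\<^sup>+z. \<rho> (\<omega> 0) * indicator A (\<omega>, \<lambda>i\<in>{0..n}. h (\<omega> i) (z i)) \<partial>noise)"
      by (rule nn_integral_cmult[symmetric])
  qed
  also have "\<dots> = (\<integral>\<^sup>+w. \<rho> (fst w 0) * indicator A w \<partial>path_law T Q h \<nu> n)"
    using nn_integral_path_law[OF \<nu> borel_measurable_times_ennreal[OF \<rho>0 ind]] by simp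
  also have "\<dots> = emeasure (density (path_law T Q h \<nu> n) (\<lambda>w. \<rho> (fst w 0))) A"
    using A \<rho>0 measurable_cong_sets[OF sets_path_law[OF \<nu>, of n] refl]
    by (subst emeasure_density) (auto simp: sets_path_law \<nu>)
  finally show "emeasure (path_law T Q h \<mu> n) A = emeasure (density (path_law T Q h \<nu> n) (\<lambda>w. \<rho> (fst w 0))) A" .
qed

end

section \<open>Bound on the difference of the filters\<close>

context hidden_markov_chain begin

lemma initial_law: "distr P borel (\<lambda>p. fst p 0) = \<nu>"
proof -
  have \<nu>_sets: "sets \<nu> = sets borel" using \<nu> by (simp add: space_prob_algebra)
  have c: "(\<lambda>\<omega>. \<omega> 0) \<in> PiM {0..0::nat} (\<lambda>_. borel :: 'x measure) \<rightarrow>\<^sub>M borel"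
    by (rule measurable_component_singleton) simp
  have S0: "(\<lambda>\<omega>. \<omega> 0) \<in> S \<rightarrow>\<^sub>M borel"
    by (rule measurable_compose[OF measurable_ident_sets[OF S_sets]], rule measurable_component_singleton) simp
  have e: "(\<lambda>x. \<lambda>i\<in>{0..0::nat}. x) \<in> \<nu> \<rightarrow>\<^sub>M PiM {0..0} (\<lambda>_. borel)"
    by (rule measurable_restrict) (rule measurable_ident_sets[OF \<nu>_sets])
  have "distr P borel (\<lambda>p. fst p 0) = distr (distr P S fst) borel (\<lambda>\<omega>. \<omega> 0)"
    by (subst distr_distr[OF S0 measurable_fst]) (simp add: comp_def)
  also have "\<dots> = distr S borel (\<lambda>\<omega>. \<omega> 0)" by (simp only: noise.distr_pair_fst)
  also have "\<dots> = distr (distr S (PiM {0..0} (\<lambda>_. borel)) (\<lambda>\<omega>. restrict \<omega> {0..0})) borel (\<lambda>\<omega>. \<omega> 0)"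
    by (subst distr_distr[OF c restrict_measurable]) (simp add: comp_def)
  also have "\<dots> = distr (distr \<nu> (PiM {0..0} (\<lambda>_. borel)) (\<lambda>x. \<lambda>i\<in>{0..0::nat}. x)) borel (\<lambda>\<omega>. \<omega> 0)"
    by (simp only: S_law state_law.simps)
  also have "\<dots> = distr \<nu> borel (\<lambda>x. x)"
    by (subst distr_distr[OF c e]) (simp add: comp_def)
  also have "\<dots> = \<nu>" by (rule distr_id2[OF \<nu>_sets[symmetric]])
  finally show ?thesis .
qed

text \<open>\<open>cond_exp_change_of_measure\<close> with \<open>D (n + 1)\<close> for
  \<open>d\<close> and \<open>D n\<close> for \<open>d'\<close>, transported to \<open>P\<close>.
  The earlier density is free of Y_(n+1), which later permits averaging over the noise at that time;
  the last summand is the price.\<close>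

lemma filter_difference_bound:
  fixes f r \<rho> :: "'x \<Rightarrow> real"
  assumes \<mu>: "\<mu> \<in> space (prob_algebra borel)" and \<mu>_eq: "\<mu> = density \<nu> (\<lambda>x. ennreal (\<rho> x))"
    and \<rho>: "\<rho> \<in> borel_measurable borel" and \<rho>0: "\<And>x. 0 \<le> \<rho> x"
    and f: "f \<in> borel_measurable borel" and C: "\<And>x. \<bar>f x\<bar> \<le> C"
    and r: "r \<in> borel_measurable borel" "\<And>x. 0 \<le> r x" "\<And>x. r x \<le> K"
    and D: "posterior_density r K D"
  obtains s where "s \<in> borel_measurable (PiM {0..Suc n} (\<lambda>_. borel))" "\<And>y. \<bar>s y\<bar> \<le> (1::real)"
    "(\<integral>w. \<bar>filter_int T Q h \<mu> (Suc n) f w - filter_int T Q h \<nu> (Suc n) f w\<bar> \<partial>path_law T Q h \<mu> (Suc n))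
      \<le> (\<integral>p. (r (fst p 0) - D n (Y n p)) * (s (Y (Suc n) p) * f (fst p (Suc n))) \<partial>P)
        + 2 * C * (\<integral>x. \<bar>\<rho> x - r x\<bar> \<partial>\<nu>)
        + C * (\<integral>p. \<bar>D (n + 1) (Y (n + 1) p) - D n (Y n p)\<bar> \<partial>P)"
proof -
  let ?m = "Suc n"
  let ?B = "PiM {0..?m} (\<lambda>_. borel :: 'y measure)"
  let ?N = "PiM {0..?m} (\<lambda>_. borel :: 'x measure) \<Otimes>\<^sub>M ?B"
  let ?L = "path_law T Q h \<nu> ?m" and ?M = "path_law T Q h \<mu> ?m"
  let ?F = "obs_sigma ?m :: ((nat \<Rightarrow> 'x) \<times> (nat \<Rightarrow> 'y)) measure"
  define pl where "pl p = (restrict (fst p) {0..?m}, Y ?m p)" for p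
  have L_eq: "?L = distr P ?N pl" unfolding path_law_eq pl_def ..
  have pl: "pl \<in> P \<rightarrow>\<^sub>M ?N"
    unfolding pl_def by (intro measurable_Pair measurable_compose[OF measurable_fst restrict_measurable] Y_measurable)
  have L_sets: "sets ?L = sets ?N" by (rule sets_path_law[OF \<nu>])
  have L_space: "space ?L = space ?N" by (rule sets_eq_imp_space_eq[OF L_sets])
  have L_meas: "borel_measurable ?L = borel_measurable ?N" by (rule measurable_cong_sets[OF L_sets refl])
  have snd_sp: "snd \<in> space ?N \<rightarrow> space ?B" by (auto simp: space_pair_measure)
  have F_sets: "sets ?F = {snd -` A \<inter> space ?N | A. A \<in> sets ?B}"
    unfolding obs_sigma_def by (rule sets_vimage_algebra2[OF snd_sp])
  have F_space: "space ?F = space ?N" by (simp add: obs_sigma_def)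
  have snd_F: "snd \<in> ?F \<rightarrow>\<^sub>M ?B" unfolding obs_sigma_def by (rule measurable_vimage_algebra1[OF snd_sp])
  have sub: "subalgebra ?L ?F"
    unfolding subalgebra_def F_space L_space F_sets L_sets
    using measurable_sets[OF measurable_snd[of "PiM {0..?m} (\<lambda>_. borel :: 'x measure)" ?B]] by auto
  have comp: "(\<lambda>w. u (fst w i)) \<in> borel_measurable ?N" if "u \<in> borel_measurable borel" "i \<le> ?m" for u :: "'x \<Rightarrow> real" and i
    using that(2) by (intro measurable_compose[OF _ that(1)], intro measurable_compose[OF measurable_fst], intro measurable_component_singleton) simp
  have Dm: "(\<lambda>w. D ?m (snd w)) \<in> borel_measurable ?F"
    by (rule measurable_compose[OF snd_F posterior_densityD(1)[OF D]])
  have Dn: "(\<lambda>w. D n (restrict (snd w) {0..n})) \<in> borel_measurable ?F"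
    by (rule measurable_compose[OF snd_F measurable_compose[OF restrict_obs_measurable posterior_densityD(1)[OF D]]]) simp
  have Db: "\<bar>D i y\<bar> \<le> K" for i y using posterior_densityD(2,3)[OF D, of i y] by linarith
  have rb: "\<bar>r x\<bar> \<le> K" for x using r(2,3)[of x] by linarith
  have int_L: "(\<integral>w. g w \<partial>?L) = (\<integral>p. g (pl p) \<partial>P)" if "g \<in> borel_measurable ?N" for g :: "_ \<Rightarrow> real"
    unfolding L_eq by (rule integral_distr[OF pl that])
  define U where "U = filter_int T Q h \<mu> ?m f"
  define V where "V = filter_int T Q h \<nu> ?m f"
  have UF: "U \<in> borel_measurable ?F" and VF: "V \<in> borel_measurable ?F"
    unfolding U_def V_def filter_int_def by (rule borel_measurable_cond_exp)+
  \<comment> \<open>The event that decides the sign lies in the \<sigma>-algebra of the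
    observations, hence is the preimage of a set \<open>E\<close> of observation tuples. Thus the
    sign becomes a function of the tuple.\<close>
  have "{w \<in> space ?F. V w < U w} \<in> sets ?F" using UF VF by measurable
  then obtain E where E: "E \<in> sets ?B" "{w \<in> space ?F. V w < U w} = snd -` E \<inter> space ?N"
    unfolding F_sets by blast
  define s where "s y = (if y \<in> E then 1 else - 1 :: real)" for y
  have s_meas: "s \<in> borel_measurable ?B" unfolding s_def using E(1) by measurable
  have s_eq: "(if V w < U w then 1 else - 1) = s (snd w)" if "w \<in> space ?N" for w
  proof -
    have "w \<in> {w \<in> space ?F. V w < U w} \<longleftrightarrow> w \<in> snd -` E \<inter> space ?N" by (simp only: E(2))
    with that show ?thesis by (simp add: F_space s_def)
  qed
  have posterior: "(\<integral>w\<in>A. r (fst w 0) \<partial>?L) = (\<integral>w\<in>A. D ?m (snd w) \<partial>?L)" if A: "A \<in> sets ?F" for A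
  proof -
    obtain A' where A': "A' \<in> sets ?B" "A = snd -` A' \<inter> space ?N" using A unfolding F_sets by blast
    have ind: "indicator A w = (indicator A' (snd w) :: real)" if "w \<in> space ?N" for w
      unfolding A'(2) indicator_def using that by simp
    have i_m: "(\<lambda>w. indicator A' (snd w) :: real) \<in> borel_measurable ?N"
      by (rule measurable_compose[OF measurable_snd borel_measurable_indicator[OF A'(1)]])
    have "(\<integral>w\<in>A. r (fst w 0) \<partial>?L) = (\<integral>w. r (fst w 0) * indicator A' (snd w) \<partial>?L)"
      unfolding set_lebesgue_integral_def
      by (intro Bochner_Integration.integral_cong refl) (simp add: L_space ind mult.commute)
    also have "\<dots> = (\<integral>p. r (fst p 0) * indicator A' (Y ?m p) \<partial>P)"
      using int_L[OF borel_measurable_times[OF comp[OF r(1), of 0] i_m]] by (simp add: pl_def)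
    also have "\<dots> = (\<integral>p. D ?m (Y ?m p) * indicator A' (Y ?m p) \<partial>P)"
      using A'(1) by (intro posterior_densityD(4)[OF D]) simp
    also have "\<dots> = (\<integral>w. D ?m (snd w) * indicator A' (snd w) \<partial>?L)"
      using int_L[OF borel_measurable_times[OF measurable_compose[OF measurable_snd posterior_densityD(1)[OF D]] i_m]]
      by (simp add: pl_def)
    also have "\<dots> = (\<integral>w\<in>A. D ?m (snd w) \<partial>?L)"
      unfolding set_lebesgue_integral_def
      by (intro Bochner_Integration.integral_cong refl) (simp add: L_space ind mult.commute)
    finally show ?thesis .
  qed
  have dens: "?M = density ?L (\<lambda>w. ennreal (\<rho> (fst w 0)))"
    using \<rho> by (intro path_law_density[OF \<nu> \<mu> \<mu>_eq]) simp
  have main: "(\<integral>w. \<bar>U w - V w\<bar> \<partial>?M) \<le>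
      (\<integral>w. (r (fst w 0) - D n (restrict (snd w) {0..n})) * ((if V w < U w then 1 else - 1) * f (fst w ?m)) \<partial>?L)
    + 2 * C * (\<integral>w. \<bar>\<rho> (fst w 0) - r (fst w 0)\<bar> \<partial>?L)
    + C * (\<integral>w. \<bar>D ?m (snd w) - D n (restrict (snd w) {0..n})\<bar> \<partial>?L)"
    unfolding U_def V_def filter_int_def
    by (rule cond_exp_change_of_measure[where K=K, OF prob_space_path_law[OF \<nu>] prob_space_path_law[OF \<mu>] dens sub])
      (use comp[OF \<rho>, of 0] comp[OF f, of ?m] comp[OF r(1), of 0] Dm Dn Db rb C \<rho>0 posterior in \<open>simp_all add: L_meas\<close>)
  have 1: "(\<integral>w. (r (fst w 0) - D n (restrict (snd w) {0..n})) * ((if V w < U w then 1 else - 1) * f (fst w ?m)) \<partial>?L) =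
      (\<integral>p. (r (fst p 0) - D n (Y n p)) * (s (Y ?m p) * f (fst p ?m)) \<partial>P)"
  proof -
    have "(\<integral>w. (r (fst w 0) - D n (restrict (snd w) {0..n})) * ((if V w < U w then 1 else - 1) * f (fst w ?m)) \<partial>?L) =
        (\<integral>w. (r (fst w 0) - D n (restrict (snd w) {0..n})) * (s (snd w) * f (fst w ?m)) \<partial>?L)"
      by (intro Bochner_Integration.integral_cong refl) (simp only: L_space s_eq)
    also have "\<dots> = (\<integral>p. (r (fst (pl p) 0) - D n (restrict (snd (pl p)) {0..n})) * (s (snd (pl p)) * f (fst (pl p) ?m)) \<partial>P)"
      using measurable_from_subalg[OF sub Dn] measurable_compose[OF measurable_snd s_meas]
      by (intro int_L borel_measurable_times borel_measurable_diff comp r(1) f) (simp_all add: L_meas)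
    also have "\<dots> = (\<integral>p. (r (fst p 0) - D n (Y n p)) * (s (Y ?m p) * f (fst p ?m)) \<partial>P)"
      by (simp add: pl_def restrict_Y)
    finally show ?thesis .
  qed
  have 2: "(\<integral>w. \<bar>\<rho> (fst w 0) - r (fst w 0)\<bar> \<partial>?L) = (\<integral>x. \<bar>\<rho> x - r x\<bar> \<partial>\<nu>)"
  proof -
    have m: "(\<lambda>x. \<bar>\<rho> x - r x\<bar>) \<in> borel_measurable borel" using \<rho> r(1) by measurable
    have "(\<integral>w. \<bar>\<rho> (fst w 0) - r (fst w 0)\<bar> \<partial>?L) = (\<integral>p. \<bar>\<rho> (fst p 0) - r (fst p 0)\<bar> \<partial>P)"
      using int_L[OF comp[OF m, of 0]] by (simp add: pl_def)
    also have "\<dots> = (\<integral>x. \<bar>\<rho> x - r x\<bar> \<partial>distr P borel (\<lambda>p. fst p 0))"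
      by (rule integral_distr[OF state_measurable m, symmetric])
    finally show ?thesis by (simp only: initial_law)
  qed
  have 3: "(\<integral>w. \<bar>D ?m (snd w) - D n (restrict (snd w) {0..n})\<bar> \<partial>?L) =
      (\<integral>p. \<bar>D (n + 1) (Y (n + 1) p) - D n (Y n p)\<bar> \<partial>P)"
  proof -
    have "(\<lambda>w. \<bar>D ?m (snd w) - D n (restrict (snd w) {0..n})\<bar>) \<in> borel_measurable ?F"
      using Dm Dn by measurable
    from measurable_from_subalg[OF sub this] show ?thesis
      by (subst int_L) (simp_all add: L_meas pl_def restrict_Y)
  qed
  show thesis
    by (rule that[OF s_meas]) (use main[unfolded 1 2 3] in \<open>auto simp: s_def U_def V_def\<close>)
qed

end

section \<open>Passage to the limit\<close>

theorem theorem8: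
  fixes T :: "'x::polish_space \<Rightarrow> 'x measure"
    and Q :: "'z::polish_space measure"
    and h :: "'x \<Rightarrow> 'z \<Rightarrow> 'y::polish_space"
    and \<mu> \<nu> :: "'x measure"
    and f :: "'x \<Rightarrow> real"
  assumes T_kernel: "T \<in> borel \<rightarrow>\<^sub>M prob_algebra borel"
    and Q_prob: "prob_space Q" and Q_sets: "sets Q = sets borel"
    and h_meas: "(\<lambda>(x, z). h x z) \<in> borel \<Otimes>\<^sub>M borel \<rightarrow>\<^sub>M borel"
    and mu_prob: "prob_space \<mu>" and mu_sets: "sets \<mu> = sets borel"
    and nu_prob: "prob_space \<nu>" and nu_sets: "sets \<nu> = sets borel"
    and abs_cont: "absolutely_continuous \<nu> \<mu>"
    and tv_cont: "channel_tv_continuous Q h"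
    and obs: "observable T Q h"
    and f_cont: "continuous_on UNIV f" and f_bdd: "bounded (range f)"
  shows "(\<lambda>n. \<integral>\<omega>. \<bar>filter_int T Q h \<mu> n f \<omega> - filter_int T Q h \<nu> n f \<omega>\<bar>
                 \<partial>path_law T Q h \<mu> n) \<longlonglongrightarrow> 0"
proof -
  interpret hidden_markov T Q h by (rule hidden_markov.intro[OF T_kernel Q_prob Q_sets h_meas])
  have \<mu>: "\<mu> \<in> space (prob_algebra borel)" and \<nu>: "\<nu> \<in> space (prob_algebra borel)"
    using mu_prob mu_sets nu_prob nu_sets by (simp_all add: space_prob_algebra)
  \<comment> \<open>Only the chain started from \<nu> is constructed; \<mu> enters through its
    density.\<close>
  obtain S where "prob_space S" "sets S = sets (PiM UNIV (\<lambda>_. borel))"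
    "\<And>n. distr S (PiM {0..n} (\<lambda>_. borel)) (\<lambda>\<omega>. restrict \<omega> {0..n}) = state_law T 0 \<nu> n"
    using chain_exists[OF \<nu>] by blast
  then interpret hidden_markov_chain T Q h \<nu> S
    by (intro hidden_markov_chain.intro hidden_markov_chain_axioms.intro hidden_markov_axioms \<nu>)
  interpret \<mu>: prob_space \<mu> by (rule mu_prob)
  interpret \<nu>: prob_space \<nu> by (rule nu_prob)
  have sets_eq: "sets \<mu> = sets \<nu>" by (simp add: mu_sets nu_sets)
  obtain \<rho> where \<rho>\<nu>: "\<rho> \<in> borel_measurable \<nu>" and \<rho>_RN: "AE x in \<nu>. RN_deriv \<nu> \<mu> x = ennreal (\<rho> x)"
    and \<rho>0: "\<And>x. 0 \<le> \<rho> x"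
    using \<nu>.real_RN_deriv[OF \<mu>.finite_measure_axioms abs_cont sets_eq] by blast
  have \<rho>: "\<rho> \<in> borel_measurable borel" using \<rho>\<nu> nu_sets by (simp cong: measurable_cong_sets)
  have \<mu>_eq: "\<mu> = density \<nu> (\<lambda>x. ennreal (\<rho> x))"
    using \<nu>.density_RN_deriv[OF abs_cont sets_eq] \<rho>_RN \<rho>\<nu>
    by (subst (asm) density_cong[OF _ _ \<rho>_RN]) auto
  have \<rho>_int: "integrable \<nu> \<rho>"
  proof (rule integrableI_nonneg[OF \<rho>\<nu>])
    have "emeasure \<mu> (space \<mu>) = (\<integral>\<^sup>+x. ennreal (\<rho> x) \<partial>\<nu>)"
      using \<rho>\<nu> by (subst (1 2) \<mu>_eq) (simp add: emeasure_density cong: nn_integral_cong)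
    then show "(\<integral>\<^sup>+x. ennreal (\<rho> x) \<partial>\<nu>) < \<infinity>" by (simp add: \<mu>.emeasure_space_1)
  qed (simp add: \<rho>0)
  obtain C where C: "\<And>x. \<bar>f x\<bar> \<le> C" using f_bdd by (auto simp: bounded_iff)
  have C0: "0 \<le> C" using C[of undefined] by linarith
  have f_meas: "f \<in> borel_measurable borel" by (rule borel_measurable_continuous_onI[OF f_cont])
  obtain N where N: "1 \<le> N" and dense: "\<And>(f :: 'x \<Rightarrow> real) \<epsilon>. continuous_on UNIV f \<Longrightarrow> bounded (range f) \<Longrightarrow> 0 < \<epsilon> \<Longrightarrow>
      \<exists>B. reach (obs_law_given_X1 T Q h N) (PiM {1..N} (\<lambda>_. borel)) B \<epsilon> f"
    using observable_reach[OF obs] by blast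
  let ?e = "\<lambda>n. \<integral>\<omega>. \<bar>filter_int T Q h \<mu> n f \<omega> - filter_int T Q h \<nu> n f \<omega>\<bar> \<partial>path_law T Q h \<mu> n"
  \<comment> \<open>Posterior densities are set up for bounded weights. The truncation error is
    dominated by \<rho>, hence tends to 0 in mean.\<close>
  have trunc: "(\<lambda>k. \<integral>x. \<bar>\<rho> x - min (\<rho> x) (real k)\<bar> \<partial>\<nu>) \<longlonglongrightarrow> (\<integral>x. 0 \<partial>\<nu>)"
  proof (rule integral_dominated_convergence[where w=\<rho>])
    show "AE x in \<nu>. (\<lambda>k. \<bar>\<rho> x - min (\<rho> x) (real k)\<bar>) \<longlonglongrightarrow> 0"
    proof (rule AE_I2)
      fix x
      obtain k0 :: nat where "\<rho> x \<le> real k0" using real_arch_simple by blast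
      then have "\<bar>\<rho> x - min (\<rho> x) (real k)\<bar> = 0" if "k \<ge> k0" for k
        using that by (simp add: min_def)
      then show "(\<lambda>k. \<bar>\<rho> x - min (\<rho> x) (real k)\<bar>) \<longlonglongrightarrow> 0"
        by (intro tendsto_eventually eventually_sequentiallyI[of k0])
    qed
    show "AE x in \<nu>. norm \<bar>\<rho> x - min (\<rho> x) (real k)\<bar> \<le> \<rho> x" for k
      using \<rho>0 by (intro AE_I2) (auto simp: min_def)
  qed (use \<rho>\<nu> \<rho>_int in auto)
  \<comment> \<open>The estimates bound the error at time n + 1 by quantities at time n; the shift
    does not affect the limit.\<close>
  have "(\<lambda>n. ?e (Suc n)) \<longlonglongrightarrow> 0"
  proof (rule LIMSEQ_I)
    fix e :: real assume e: "0 < e"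
    \<comment> \<open>The truncation level comes first, as it determines \<open>K\<close>; then
      \<epsilon>, which depends on \<open>K\<close>; then \<open>B\<close>, which depends on both;
      and n last. The truncation error, the approximation error and the martingale increments
      receive \<open>e / 4\<close> each.\<close>
    have "\<forall>\<^sub>F k in sequentially. (\<integral>x. \<bar>\<rho> x - min (\<rho> x) (real k)\<bar> \<partial>\<nu>) < e / (4 * (2 * C + 1))"
      using e C0 order_tendstoD(2)[OF trunc, of "e / (4 * (2 * C + 1))"] by simp
    then obtain k where k: "(\<integral>x. \<bar>\<rho> x - min (\<rho> x) (real k)\<bar> \<partial>\<nu>) < e / (4 * (2 * C + 1))"
      using eventually_happens'[OF sequentially_bot] by blast
    define r where "r x = min (\<rho> x) (real k)" for x
    define K where "K = real k"
    have r: "r \<in> borel_measurable borel" "\<And>x. 0 \<le> r x" "\<And>x. r x \<le> K"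
      using borel_measurable_min[OF \<rho> measurable_const[of "real k"]] \<rho>0
      by (auto simp: r_def[abs_def] K_def min.commute)
    have K0: "0 \<le> K" by (simp add: K_def)
    obtain D where D: "posterior_density r K D" by (rule posterior_density_exists[OF r])
    \<comment> \<open>Makes \<open>K * (3 + 2 * C) * \<epsilon>\<close> at most
      \<open>e / 4\<close>; \<open>K + 1\<close> covers the truncation level 0.\<close>
    define \<epsilon> where "\<epsilon> = e / (4 * ((K + 1) * (3 + 2 * C)))"
    have pos: "0 < (K + 1) * (3 + 2 * C)" using K0 C0 by (intro mult_pos_pos) auto
    have \<epsilon>: "0 < \<epsilon>" using e pos by (simp add: \<epsilon>_def)
    obtain B where B: "\<And>n s. s \<in> borel_measurable (PiM {0..Suc n} (\<lambda>_. borel)) \<Longrightarrow> (\<And>y. \<bar>s y\<bar> \<le> 1) \<Longrightarrow>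
      (\<integral>p. (r (fst p 0) - D n (Y n p)) * (s (Y (Suc n) p) * f (fst p (Suc n))) \<partial>P)
        \<le> K * (3 * \<epsilon> + 2 * C * \<epsilon>) + B * (\<integral>p. \<bar>D (n + N) (Y (n + N) p) - D n (Y n p)\<bar> \<partial>P)"
      by (rule weighted_estimate[OF tv_cont N dense f_cont C r D \<epsilon>]) blast+
    define a where "a j n = (\<integral>p. \<bar>D (n + j) (Y (n + j) p) - D n (Y n p)\<bar> \<partial>P)" for j n
    have a: "a j \<longlonglongrightarrow> 0" for j
      unfolding a_def by (rule posterior_density_increments[OF D])
    have K\<epsilon>: "K * (3 * \<epsilon> + 2 * C * \<epsilon>) \<le> e / 4"
    proof -
      have "K * (3 * \<epsilon> + 2 * C * \<epsilon>) = K * (3 + 2 * C) * \<epsilon>" by (simp add: algebra_simps)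
      also have "\<dots> \<le> (K + 1) * (3 + 2 * C) * \<epsilon>" using K0 C0 \<epsilon> by (intro mult_right_mono) auto
      also have "\<dots> = e / 4"
      proof -
        have "c * (e / (4 * c)) = e / 4" if "0 < c" for c using that by simp
        from this[OF pos] show ?thesis by (simp only: \<epsilon>_def)
      qed
      finally show ?thesis .
    qed
    have C\<delta>: "2 * C * (\<integral>x. \<bar>\<rho> x - r x\<bar> \<partial>\<nu>) \<le> e / 4"
    proof -
      have "2 * C * (\<integral>x. \<bar>\<rho> x - r x\<bar> \<partial>\<nu>) \<le> (2 * C + 1) * (e / (4 * (2 * C + 1)))"
        using k C0 e by (intro mult_mono) (auto simp: r_def)
      also have "\<dots> = e / 4"
      proof -
        have "c * (e / (4 * c)) = e / 4" if "0 < c" for c using that by simp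
        from this[of "2 * C + 1"] show ?thesis using C0 by linarith
      qed
      finally show ?thesis .
    qed
    have "(\<lambda>n. B * a N n + C * a 1 n) \<longlonglongrightarrow> B * 0 + C * 0" by (intro tendsto_intros a)
    then have "\<forall>\<^sub>F n in sequentially. B * a N n + C * a 1 n < e / 4"
      by (rule order_tendstoD(2)) (use e in simp)
    then obtain n0 where n0: "\<And>n. n0 \<le> n \<Longrightarrow> B * a N n + C * a 1 n < e / 4"
      unfolding eventually_sequentially by blast
    show "\<exists>n0. \<forall>n\<ge>n0. norm (?e (Suc n) - 0) < e"
    proof (intro exI allI impI)
      fix n assume n: "n0 \<le> n"
      obtain s where s: "s \<in> borel_measurable (PiM {0..Suc n} (\<lambda>_. borel))" "\<And>y. \<bar>s y\<bar> \<le> (1::real)"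
        and le: "?e (Suc n) \<le> (\<integral>p. (r (fst p 0) - D n (Y n p)) * (s (Y (Suc n) p) * f (fst p (Suc n))) \<partial>P)
          + 2 * C * (\<integral>x. \<bar>\<rho> x - r x\<bar> \<partial>\<nu>) + C * a 1 n"
        unfolding a_def by (rule filter_difference_bound[where n=n, OF \<mu> \<mu>_eq \<rho> \<rho>0 f_meas C r D]) blast
      have "?e (Suc n) \<le> K * (3 * \<epsilon> + 2 * C * \<epsilon>) + B * a N n + 2 * C * (\<integral>x. \<bar>\<rho> x - r x\<bar> \<partial>\<nu>) + C * a 1 n"
        using le B[OF s, folded a_def] by linarith
      also have "\<dots> < e" using K\<epsilon> C\<delta> n0[OF n] e by linarith
      finally show "norm (?e (Suc n) - 0) < e" by simp
    qed
  qed
  then show ?thesis by (rule LIMSEQ_imp_Suc)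
qed

end
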